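(* In the setting described in the context, let $(u^+_{c1},u^+_{c2})$ be an open-loop Nash equilibrium of the Level 2 game with parameters $\eta_{1ij},\zeta_{1ij}$, and let $\tilde x$ be the corresponding state, i.e. $$d\tilde x=\Big[\bar A\tilde x+\sum_{i=1}^2\bar B_{ci}u^+_{ci}\Big]dt+\Big[\bar C\tilde x+\sum_{i=1}^2\bar D_{ci}u^+_{ci}\Big]dW,\quad\tilde x(0)=x_0.$$ If $u^+_{ci}(t)=u^*_{ci}(t)$ for $t\in[0,T]$ and $i=1,2$, then $\tilde x(t)=\bar x(t)$ for $t\in[0,T]$, $\mathbb P$-a.s., where $\bar x$ is the team-optimal trajectory.
   Context: Indices: $i\in\{1,2\}$, $j\in\{1,2,3\}$. Fix $T>0$ and a complete filtered probability space $(\Omega,\mathcal F,\mathbb F,\mathbb P)$ with a one-dimensional Brownian motion $W$, $\mathbb F$ its augmented natural filtration. $L^2_{\mathbb F}(0,T;\mathbb H)$ is the space of $\mathbb F$-progressively measurable $\phi$ with $\mathbb E\int_0^T|\phi|^2dt<\infty$. For symmetric matrix functions, $M\gg0$ means $M(t)\ge\delta I$ for some $\delta>0$. State equation: $$dx=\Big[Ax+\sum_iB_{1i}u_{1i}+\sum_{i,j}B_{2ij}u_{2ij}+\sum_{j,i}B_{3ji}u_{3ji}+Ev\Big]dt+\Big[Cx+\sum_iD_{1i}u_{1i}+\sum_{i,j}D_{2ij}u_{2ij}+\sum_{j,i}D_{3ji}u_{3ji}\Big]dW,\quad x(0)=x_0\in\mathbb R^n,$$ with deterministic bounded coefficients on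 $[0,T]$; $u_{1i}\in L^2_{\mathbb F}(0,T;\mathbb R^{m_{1i}})$ are controls of Level 1, $u_{2ij}\in L^2_{\mathbb F}(0,T;\mathbb R^{m_{2ij}})$ of player $i$ of Level 2, $u_{3ji}\in L^2_{\mathbb F}(0,T;\mathbb R^{m_{3ji}})$ of player $j$ of Level 3, $v\in L^2_{\mathbb F}(0,T;\mathbb R^{n_v})$ is the disturbance. Write $u_{ci}=\mathrm{col}[u_{2i1},u_{2i2},u_{2i3},u_{31i},u_{32i},u_{33i}]$. Costs (deterministic bounded symmetric weights): $J^1=\mathbb E\{\int_0^T[\langle Q_1x,x\rangle+\sum_i\langle R_iu_{1i},u_{1i}\rangle+\sum_{i,j}\langle R_{1ij}u_{2ij},u_{2ij}\rangle+\sum_{j,i}\langle\bar R_{1ji}u_{3ji},u_{3ji}\rangle]dt+\langle G_1x(T),x(T)\rangle\}$; $J^2_i=\mathbb E\{\int_0^T[\langle Q_{2i}x,x\rangle+\langle R_{2i}u_{1i},u_{1i}\rangle+\sum_j\langle R_{2ij}u_{2ij},u_{2ij}\rangle+\sum_j\langle\bar R_{2ji}u_{3ji},u_{3ji}\rangle]dt+\langle G_{2i}x(T),x(T)\rangle\}$. Standing assumptions: $Q_1,Q_{2i},G_1,G_{2i}\ge0$ and $R_i,R_{1ij},\bar R_{1ji},R_{2i},R_{2ij},\bar R_{2ji}\gg0$. Team-optimal strategy and worst-case disturbance ($\gamma>0$ is the disturbance attenuation level). $B_c=[B_{11},B_{12},B_{211},B_{212},B_{213},B_{221},B_{222},B_{223},B_{311},B_{312},B_{321},B_{322},B_{331},B_{332}]$,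 $D_c$ likewise from the $D$'s, $R_c=\mathrm{blockdiag}(R_1,R_2,R_{111},R_{112},R_{113},R_{121},R_{122},R_{123},\bar R_{111},\bar R_{112},\bar R_{121},\bar R_{122},\bar R_{131},\bar R_{132})$. $P$ denotes the solution (assumed to exist on $[0,T]$, with $I+PD_cR_c^{-1}D_c^\top$ having bounded inverse) of $$\dot P+PA+A^\top P-P(B_cR_c^{-1}B_c^\top-\gamma^{-2}EE^\top)P+Q_1+(C-D_cR_c^{-1}B_c^\top P)^\top(I+PD_cR_c^{-1}D_c^\top)^{-1}P(C-D_cR_c^{-1}B_c^\top P)=0,\ P(T)=G_1,$$ and $\Lambda:=(I+PD_cR_c^{-1}D_c^\top)^{-1}P(C-D_cR_c^{-1}B_c^\top P)$. Put $K_{1i}:=R_i^{-1}(B_{1i}^\top P+D_{1i}^\top\Lambda)$, $K_{2ij}:=R_{1ij}^{-1}(B_{2ij}^\top P+D_{2ij}^\top\Lambda)$, $K_{3ji}:=\bar R_{1ji}^{-1}(B_{3ji}^\top P+D_{3ji}^\top\Lambda)$. The team-optimal trajectory $\bar x$ is the state under $u^*_{1i}=-K_{1i}\bar x$, $u^*_{2ij}=-K_{2ij}\bar x$, $u^*_{3ji}=-K_{3ji}\bar x$, $v^*=\gamma^{-2}E^\top P\bar x$, with $\bar x(0)=x_0$; $u^*_{ci}$ is the stacked vector of $u^*_{2i1},u^*_{2i2},u^*_{2i3},u^*_{31i},u^*_{32i},u^*_{33i}$. Level 2 game for given continuous $\eta_{1ij}(t)\in\mathbb R^{m_{1i}\times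 m_{2ij}}$, $\zeta_{1ij}(t)\in\mathbb R^{m_{1i}\times m_{3ji}}$. Set $\xi_{1ij}:=-\frac13K_{1i}+\eta_{1ij}K_{2ij}+\zeta_{1ij}K_{3ji}$. Level 1 announces $u_{1i}=\sum_j\xi_{1ij}x+\sum_j\eta_{1ij}u_{2ij}+\sum_j\zeta_{1ij}u_{3ji}$, and the disturbance is taken as $v=\gamma^{-2}E^\top Px$. Substituting these into the state equation gives $dx=[\bar Ax+\sum_i\bar B_{ci}u_{ci}]dt+[\bar Cx+\sum_i\bar D_{ci}u_{ci}]dW$, $x(0)=x_0$, where, with $N_i:=[\eta_{1i1},\eta_{1i2},\eta_{1i3},\zeta_{1i1},\zeta_{1i2},\zeta_{1i3}]$ and $\xi_i:=\sum_j\xi_{1ij}$: $\bar A=A+\gamma^{-2}EE^\top P+\sum_iB_{1i}\xi_i$, $\bar C=C+\sum_iD_{1i}\xi_i$, $\bar B_{ci}=[B_{2i1},B_{2i2},B_{2i3},B_{31i},B_{32i},B_{33i}]+B_{1i}N_i$, $\bar D_{ci}=[D_{2i1},D_{2i2},D_{2i3},D_{31i},D_{32i},D_{33i}]+D_{1i}N_i$. $\bar J^2_i(u_{c1},u_{c2};x_0)$ denotes $J^2_i$ after this substitution. A pair $(u^+_{c1},u^+_{c2})$ of square-integrable adapted controls is an open-loop Nash equilibrium of Level 2 if $\bar J^2_1(u^+_{c1},u^+_{c2};x_0)\le\bar J^2_1(u_{c1},u^+_{c2};x_0)$ and $\bar J^2_2(u^+_{c1},u^+_{c2};x_0)\le\bar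 J^2_2(u^+_{c1},u_{c2};x_0)$ for all square-integrable adapted $u_{c1},u_{c2}$. *)

theory Defs
  imports
    "HOL-Probability.Probability"
    "Jordan_Normal_Form.Gauss_Jordan_Elimination"
begin

unbundle no vec_syntax and no inner_syntax

type_synonym 'w vproc = "real \<Rightarrow> 'w \<Rightarrow> real vec"

section \<open>Stochastic analysis on a finite horizon\<close>

definition augmented_filtration :: "'w measure \<Rightarrow> (real \<Rightarrow> 'w \<Rightarrow> real) \<Rightarrow> real \<Rightarrow> 'w measure" where
  "augmented_filtration M W t = sigma (space M)
     ({W s -` B \<inter> space M | s B. 0 \<le> s \<and> s \<le> t \<and> B \<in> sets borel} \<union> null_sets M)"

definition brownian_motion ::
  "'w measure \<Rightarrow> (real \<Rightarrow> 'w measure) \<Rightarrow> real \<Rightarrow> (real \<Rightarrow> 'w \<Rightarrow> real) \<Rightarrow> bool" where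
  "brownian_motion M F T W \<longleftrightarrow>
     (\<forall>t\<in>{0..T}. W t \<in> borel_measurable M \<and> W t \<in> borel_measurable (F t)) \<and>
     (AE \<omega> in M. W 0 \<omega> = 0) \<and>
     (AE \<omega> in M. continuous_on {0..T} (\<lambda>t. W t \<omega>)) \<and>
     (\<forall>s t. 0 \<le> s \<and> s < t \<and> t \<le> T \<longrightarrow>
        distributed M lborel (\<lambda>\<omega>. W t \<omega> - W s \<omega>) (\<lambda>y. ennreal (normal_density 0 (sqrt (t - s)) y)) \<and>
        prob_space.indep_set M (sets (F s))
          (sets (vimage_algebra (space M) (\<lambda>\<omega>. W t \<omega> - W s \<omega>) borel)))"

definition progressive ::
  "(real \<Rightarrow> 'w measure) \<Rightarrow> real \<Rightarrow> (real \<Rightarrow> 'w \<Rightarrow> real) \<Rightarrow> bool" where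
  "progressive F T \<phi> \<longleftrightarrow>
     (\<forall>t\<in>{0..T}. (\<lambda>(s, \<omega>). \<phi> s \<omega>) \<in> borel_measurable (restrict_space borel {0..t} \<Otimes>\<^sub>M F t))"

definition sq_norm_proc :: "'w measure \<Rightarrow> real \<Rightarrow> (real \<Rightarrow> 'w \<Rightarrow> real) \<Rightarrow> ennreal" where
  "sq_norm_proc M T \<phi> =
     (\<integral>\<^sup>+\<omega>. (\<integral>\<^sup>+t. ennreal ((\<phi> t \<omega>)\<^sup>2) * indicator {0..T} t \<partial>lborel) \<partial>M)"

definition L2F :: "'w measure \<Rightarrow> (real \<Rightarrow> 'w measure) \<Rightarrow> real \<Rightarrow> (real \<Rightarrow> 'w \<Rightarrow> real) set" where
  "L2F M F T = {\<phi>. progressive F T \<phi> \<and> sq_norm_proc M T \<phi> < \<infinity>}"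

definition L2F_vec :: "'w measure \<Rightarrow> (real \<Rightarrow> 'w measure) \<Rightarrow> real \<Rightarrow> nat \<Rightarrow> 'w vproc set" where
  "L2F_vec M F T d = {\<phi>. (\<forall>t\<in>{0..T}. \<forall>\<omega>\<in>space M. \<phi> t \<omega> \<in> carrier_vec d) \<and>
                          (\<forall>k<d. (\<lambda>t \<omega>. \<phi> t \<omega> $ k) \<in> L2F M F T)}"

definition simple_process ::
  "'w measure \<Rightarrow> (real \<Rightarrow> 'w measure) \<Rightarrow> real \<Rightarrow> nat \<Rightarrow> (nat \<Rightarrow> real) \<Rightarrow> (nat \<Rightarrow> 'w \<Rightarrow> real) \<Rightarrow> bool" where
  "simple_process M F T N \<tau> \<xi> \<longleftrightarrow>
     \<tau> 0 = 0 \<and> \<tau> N = T \<and> (\<forall>k<N. \<tau> k < \<tau> (Suc k)) \<and>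
     (\<forall>k<N. \<xi> k \<in> borel_measurable (F (\<tau> k)) \<and> (\<exists>c. \<forall>\<omega>\<in>space M. \<bar>\<xi> k \<omega>\<bar> \<le> c))"

definition simple_val :: "nat \<Rightarrow> (nat \<Rightarrow> real) \<Rightarrow> (nat \<Rightarrow> 'w \<Rightarrow> real) \<Rightarrow> real \<Rightarrow> 'w \<Rightarrow> real" where
  "simple_val N \<tau> \<xi> t \<omega> = (\<Sum>k<N. \<xi> k \<omega> * indicator {\<tau> k<..\<tau> (Suc k)} t)"

definition simple_integral ::
  "(real \<Rightarrow> 'w \<Rightarrow> real) \<Rightarrow> nat \<Rightarrow> (nat \<Rightarrow> real) \<Rightarrow> (nat \<Rightarrow> 'w \<Rightarrow> real) \<Rightarrow> real \<Rightarrow> 'w \<Rightarrow> real" where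
  "simple_integral W N \<tau> \<xi> t \<omega> =
     (\<Sum>k<N. \<xi> k \<omega> * (W (min (\<tau> (Suc k)) t) \<omega> - W (min (\<tau> k) t) \<omega>))"

text \<open>\<open>I\<close> is a continuous adapted version of the Ito integral process of \<open>\<phi>\<close>: the mean-square limit
  of the integrals of simple processes that approximate \<open>\<phi>\<close>. Such an \<open>I\<close> exists for
  every \<open>\<phi>\<close> in \<open>L2F\<close> and is unique up to indistinguishability.\<close>

definition ito_integral ::
  "'w measure \<Rightarrow> (real \<Rightarrow> 'w measure) \<Rightarrow> real \<Rightarrow> (real \<Rightarrow> 'w \<Rightarrow> real) \<Rightarrow>
   (real \<Rightarrow> 'w \<Rightarrow> real) \<Rightarrow> (real \<Rightarrow> 'w \<Rightarrow> real) \<Rightarrow> bool" where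
  "ito_integral M F T W \<phi> I \<longleftrightarrow>
     \<phi> \<in> L2F M F T \<and>
     (\<forall>t\<in>{0..T}. I t \<in> borel_measurable (F t)) \<and>
     (AE \<omega> in M. continuous_on {0..T} (\<lambda>t. I t \<omega>)) \<and>
     (\<exists>N \<tau> \<xi>. (\<forall>m. simple_process M F T (N m) (\<tau> m) (\<xi> m)) \<and>
        (\<lambda>m::nat. sq_norm_proc M T (\<lambda>t \<omega>. simple_val (N m) (\<tau> m) (\<xi> m) t \<omega> - \<phi> t \<omega>)) \<longlonglongrightarrow> 0 \<and>
        (\<forall>t\<in>{0..T}. (\<lambda>m. \<integral>\<^sup>+\<omega>. ennreal ((simple_integral W (N m) (\<tau> m) (\<xi> m) t \<omega> - I t \<omega>)\<^sup>2) \<partial>M)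
                      \<longlonglongrightarrow> 0))"

text \<open>\<open>x\<close> solves \<open>dx = b dt + \<sigma> dW\<close>, \<open>x(0) = x0\<close> on \<open>[0,T]\<close>, where \<open>b\<close> and \<open>\<sigma>\<close> are the drift and
  diffusion processes evaluated along \<open>x\<close>.\<close>

definition sde_solution ::
  "'w measure \<Rightarrow> (real \<Rightarrow> 'w measure) \<Rightarrow> real \<Rightarrow> (real \<Rightarrow> 'w \<Rightarrow> real) \<Rightarrow> nat \<Rightarrow>
   'w vproc \<Rightarrow> 'w vproc \<Rightarrow> real vec \<Rightarrow> 'w vproc \<Rightarrow> bool" where
  "sde_solution M F T W n b \<sigma> x0 x \<longleftrightarrow>
     x \<in> L2F_vec M F T n \<and>
     (\<forall>k<n. AE \<omega> in M. continuous_on {0..T} (\<lambda>t. x t \<omega> $ k)) \<and>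
     (\<exists>I. \<forall>k<n. ito_integral M F T W (\<lambda>t \<omega>. \<sigma> t \<omega> $ k) (I k) \<and>
        (AE \<omega> in M. \<forall>t\<in>{0..T}.
           x t \<omega> $ k = x0 $ k + (LBINT s:{0..t}. b s \<omega> $ k) + I k t \<omega>))"

section \<open>Matrix functions and block matrices\<close>

text \<open>Vectors and matrices of \<open>Jordan_Normal_Form\<close> carry their dimensions as values and form no
  additive monoid type, so the big operator \<open>sum\<close> does not apply to them.\<close>

abbreviation sum2 :: "(nat \<Rightarrow> 'a::plus) \<Rightarrow> 'a" where "sum2 f \<equiv> f 1 + f 2"
abbreviation sum3 :: "(nat \<Rightarrow> 'a::plus) \<Rightarrow> 'a" where "sum3 f \<equiv> f 1 + f 2 + f 3"

text \<open>The inverse of a square matrix; unspecified if the matrix is singular.\<close>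

definition minv :: "real mat \<Rightarrow> real mat" where
  "minv X = the (mat_inverse X)"

definition hcat :: "nat \<Rightarrow> real mat list \<Rightarrow> real mat" where
  "hcat r Xs = mat_of_cols r (concat (map cols Xs))"

definition vcat :: "real vec list \<Rightarrow> real vec" where
  "vcat vs = vec_of_list (concat (map list_of_vec vs))"

text \<open>The \<open>k\<close>-th block (counted from 0) of a vector stacked from blocks of dimensions \<open>ds\<close>.\<close>

definition vblock :: "nat list \<Rightarrow> nat \<Rightarrow> real vec \<Rightarrow> real vec" where
  "vblock ds k v = vec (ds ! k) (\<lambda>l. v $ (sum_list (take k ds) + l))"

definition bounded_coeff :: "real \<Rightarrow> nat \<Rightarrow> nat \<Rightarrow> (real \<Rightarrow> real mat) \<Rightarrow> bool" where
  "bounded_coeff T r c X \<longleftrightarrow>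
     (\<forall>t\<in>{0..T}. X t \<in> carrier_mat r c) \<and>
     (\<forall>a<r. \<forall>b<c. (\<lambda>t. X t $$ (a, b)) \<in> borel_measurable (restrict_space borel {0..T}) \<and>
                  (\<exists>K. \<forall>t\<in>{0..T}. \<bar>X t $$ (a, b)\<bar> \<le> K))"

definition continuous_coeff :: "real \<Rightarrow> nat \<Rightarrow> nat \<Rightarrow> (real \<Rightarrow> real mat) \<Rightarrow> bool" where
  "continuous_coeff T r c X \<longleftrightarrow>
     (\<forall>t\<in>{0..T}. X t \<in> carrier_mat r c) \<and>
     (\<forall>a<r. \<forall>b<c. continuous_on {0..T} (\<lambda>t. X t $$ (a, b)))"

definition sym_psd :: "nat \<Rightarrow> real mat \<Rightarrow> bool" where
  "sym_psd d X \<longleftrightarrow> X \<in> carrier_mat d d \<and> transpose_mat X = X \<and>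
     (\<forall>y\<in>carrier_vec d. 0 \<le> (X *\<^sub>v y) \<bullet> y)"

definition psd_weight :: "real \<Rightarrow> nat \<Rightarrow> (real \<Rightarrow> real mat) \<Rightarrow> bool" where
  "psd_weight T d X \<longleftrightarrow> bounded_coeff T d d X \<and> (\<forall>t\<in>{0..T}. sym_psd d (X t))"

definition pd_weight :: "real \<Rightarrow> nat \<Rightarrow> (real \<Rightarrow> real mat) \<Rightarrow> bool" where
  "pd_weight T d X \<longleftrightarrow> bounded_coeff T d d X \<and> (\<forall>t\<in>{0..T}. transpose_mat (X t) = X t) \<and>
     (\<exists>\<delta>>0. \<forall>t\<in>{0..T}. \<forall>y\<in>carrier_vec d. \<delta> * (y \<bullet> y) \<le> (X t *\<^sub>v y) \<bullet> y)"

section \<open>The three-level game\<close>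

text \<open>Index conventions: \<open>i\<close> ranges over \<open>{1,2}\<close> and \<open>j\<close> over \<open>{1,2,3}\<close>. Level 2 data take the
  arguments \<open>i j\<close>, Level 3 data \<open>j i\<close>. The weights are
  \<open>wR i\<close> $= R_i$, \<open>wR1 i j\<close> $= R_{1ij}$, \<open>wRb1 j i\<close> $= \bar R_{1ji}$ (cost $J^1$) and
  \<open>wR20 i\<close> $= R_{2i}$, \<open>wR2 i j\<close> $= R_{2ij}$, \<open>wRb2 j i\<close> $= \bar R_{2ji}$ (cost $J^2_i$).\<close>

record game =
  hor :: real
  gam :: real
  dimx :: nat
  dimv :: nat
  dim1 :: "nat \<Rightarrow> nat"
  dim2 :: "nat \<Rightarrow> nat \<Rightarrow> nat"
  dim3 :: "nat \<Rightarrow> nat \<Rightarrow> nat"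
  cA :: "real \<Rightarrow> real mat"
  cC :: "real \<Rightarrow> real mat"
  cE :: "real \<Rightarrow> real mat"
  cB1 :: "nat \<Rightarrow> real \<Rightarrow> real mat"
  cB2 :: "nat \<Rightarrow> nat \<Rightarrow> real \<Rightarrow> real mat"
  cB3 :: "nat \<Rightarrow> nat \<Rightarrow> real \<Rightarrow> real mat"
  cD1 :: "nat \<Rightarrow> real \<Rightarrow> real mat"
  cD2 :: "nat \<Rightarrow> nat \<Rightarrow> real \<Rightarrow> real mat"
  cD3 :: "nat \<Rightarrow> nat \<Rightarrow> real \<Rightarrow> real mat"
  wQ1 :: "real \<Rightarrow> real mat"
  wR :: "nat \<Rightarrow> real \<Rightarrow> real mat"
  wR1 :: "nat \<Rightarrow> nat \<Rightarrow> real \<Rightarrow> real mat"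
  wRb1 :: "nat \<Rightarrow> nat \<Rightarrow> real \<Rightarrow> real mat"
  wG1 :: "real mat"
  wQ2 :: "nat \<Rightarrow> real \<Rightarrow> real mat"
  wR20 :: "nat \<Rightarrow> real \<Rightarrow> real mat"
  wR2 :: "nat \<Rightarrow> nat \<Rightarrow> real \<Rightarrow> real mat"
  wRb2 :: "nat \<Rightarrow> nat \<Rightarrow> real \<Rightarrow> real mat"
  wG2 :: "nat \<Rightarrow> real mat"

definition standing_assumptions :: "game \<Rightarrow> bool" where
  "standing_assumptions G \<longleftrightarrow>
     (let T = hor G; n = dimx G in
      T > 0 \<and> gam G > 0 \<and>
      bounded_coeff T n n (cA G) \<and> bounded_coeff T n n (cC G) \<and> bounded_coeff T n (dimv G) (cE G) \<and>
      psd_weight T n (wQ1 G) \<and> sym_psd n (wG1 G) \<and>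
      (\<forall>i\<in>{1, 2}.
         bounded_coeff T n (dim1 G i) (cB1 G i) \<and> bounded_coeff T n (dim1 G i) (cD1 G i) \<and>
         pd_weight T (dim1 G i) (wR G i) \<and> pd_weight T (dim1 G i) (wR20 G i) \<and>
         psd_weight T n (wQ2 G i) \<and> sym_psd n (wG2 G i) \<and>
         (\<forall>j\<in>{1, 2, 3}.
            bounded_coeff T n (dim2 G i j) (cB2 G i j) \<and> bounded_coeff T n (dim2 G i j) (cD2 G i j) \<and>
            bounded_coeff T n (dim3 G j i) (cB3 G j i) \<and> bounded_coeff T n (dim3 G j i) (cD3 G j i) \<and>
            pd_weight T (dim2 G i j) (wR1 G i j) \<and> pd_weight T (dim2 G i j) (wR2 G i j) \<and>
            pd_weight T (dim3 G j i) (wRb1 G j i) \<and> pd_weight T (dim3 G j i) (wRb2 G j i))))"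

definition state_solution ::
  "'w measure \<Rightarrow> (real \<Rightarrow> 'w measure) \<Rightarrow> (real \<Rightarrow> 'w \<Rightarrow> real) \<Rightarrow> game \<Rightarrow> real vec \<Rightarrow>
   (nat \<Rightarrow> 'w vproc) \<Rightarrow> (nat \<Rightarrow> nat \<Rightarrow> 'w vproc) \<Rightarrow> (nat \<Rightarrow> nat \<Rightarrow> 'w vproc) \<Rightarrow> 'w vproc \<Rightarrow>
   'w vproc \<Rightarrow> bool" where
  "state_solution M F W G x0 u1 u2 u3 v x \<longleftrightarrow>
     sde_solution M F (hor G) W (dimx G)
       (\<lambda>t \<omega>. cA G t *\<^sub>v x t \<omega> + sum2 (\<lambda>i. cB1 G i t *\<^sub>v u1 i t \<omega>)
          + sum2 (\<lambda>i. sum3 (\<lambda>j. cB2 G i j t *\<^sub>v u2 i j t \<omega>))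
          + sum3 (\<lambda>j. sum2 (\<lambda>i. cB3 G j i t *\<^sub>v u3 j i t \<omega>)) + cE G t *\<^sub>v v t \<omega>)
       (\<lambda>t \<omega>. cC G t *\<^sub>v x t \<omega> + sum2 (\<lambda>i. cD1 G i t *\<^sub>v u1 i t \<omega>)
          + sum2 (\<lambda>i. sum3 (\<lambda>j. cD2 G i j t *\<^sub>v u2 i j t \<omega>))
          + sum3 (\<lambda>j. sum2 (\<lambda>i. cD3 G j i t *\<^sub>v u3 j i t \<omega>)))
       x0 x"

subsection \<open>Team-optimal strategy and worst-case disturbance\<close>

definition all_blocks ::
  "(nat \<Rightarrow> real mat) \<Rightarrow> (nat \<Rightarrow> nat \<Rightarrow> real mat) \<Rightarrow> (nat \<Rightarrow> nat \<Rightarrow> real mat) \<Rightarrow> real mat list" where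
  "all_blocks X1 X2 X3 =
     [X1 1, X1 2, X2 1 1, X2 1 2, X2 1 3, X2 2 1, X2 2 2, X2 2 3,
      X3 1 1, X3 1 2, X3 2 1, X3 2 2, X3 3 1, X3 3 2]"

definition Bc :: "game \<Rightarrow> real \<Rightarrow> real mat" where
  "Bc G t = hcat (dimx G)
     (all_blocks (\<lambda>i. cB1 G i t) (\<lambda>i j. cB2 G i j t) (\<lambda>j i. cB3 G j i t))"

definition Dc :: "game \<Rightarrow> real \<Rightarrow> real mat" where
  "Dc G t = hcat (dimx G)
     (all_blocks (\<lambda>i. cD1 G i t) (\<lambda>i j. cD2 G i j t) (\<lambda>j i. cD3 G j i t))"

definition Rc :: "game \<Rightarrow> real \<Rightarrow> real mat" where
  "Rc G t = diag_block_mat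
     (all_blocks (\<lambda>i. wR G i t) (\<lambda>i j. wR1 G i j t) (\<lambda>j i. wRb1 G j i t))"

definition ric_H :: "game \<Rightarrow> (real \<Rightarrow> real mat) \<Rightarrow> real \<Rightarrow> real mat" where
  "ric_H G P t = 1\<^sub>m (dimx G) + P t * Dc G t * minv (Rc G t) * transpose_mat (Dc G t)"

definition ric_C :: "game \<Rightarrow> (real \<Rightarrow> real mat) \<Rightarrow> real \<Rightarrow> real mat" where
  "ric_C G P t = cC G t - Dc G t * minv (Rc G t) * transpose_mat (Bc G t) * P t"

definition ric_Lambda :: "game \<Rightarrow> (real \<Rightarrow> real mat) \<Rightarrow> real \<Rightarrow> real mat" where
  "ric_Lambda G P t = minv (ric_H G P t) * P t * ric_C G P t"

definition ric_rhs :: "game \<Rightarrow> (real \<Rightarrow> real mat) \<Rightarrow> real \<Rightarrow> real mat" where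
  "ric_rhs G P t =
     P t * cA G t + transpose_mat (cA G t) * P t
     - P t * (Bc G t * minv (Rc G t) * transpose_mat (Bc G t)
              - (1 / (gam G)\<^sup>2) \<cdot>\<^sub>m (cE G t * transpose_mat (cE G t))) * P t
     + wQ1 G t
     + transpose_mat (ric_C G P t) * minv (ric_H G P t) * P t * ric_C G P t"

text \<open>The coefficients are merely bounded and measurable, so the terminal value problem
  $\dot P + \mathrm{rhs} = 0$, $P(T) = G_1$ is read in integrated form.\<close>

definition riccati_solution :: "game \<Rightarrow> (real \<Rightarrow> real mat) \<Rightarrow> bool" where
  "riccati_solution G P \<longleftrightarrow>
     continuous_coeff (hor G) (dimx G) (dimx G) P \<and>
     (\<forall>t\<in>{0..hor G}. invertible_mat (ric_H G P t)) \<and>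
     (\<exists>K. \<forall>t\<in>{0..hor G}. \<forall>a<dimx G. \<forall>b<dimx G. \<bar>minv (ric_H G P t) $$ (a, b)\<bar> \<le> K) \<and>
     (\<forall>a<dimx G. \<forall>b<dimx G.
        set_integrable lborel {0..hor G} (\<lambda>s. ric_rhs G P s $$ (a, b)) \<and>
        (\<forall>t\<in>{0..hor G}. P t $$ (a, b) = wG1 G $$ (a, b) + (LBINT s:{t..hor G}. ric_rhs G P s $$ (a, b))))"

definition K1 :: "game \<Rightarrow> (real \<Rightarrow> real mat) \<Rightarrow> nat \<Rightarrow> real \<Rightarrow> real mat" where
  "K1 G P i t = minv (wR G i t) *
     (transpose_mat (cB1 G i t) * P t + transpose_mat (cD1 G i t) * ric_Lambda G P t)"

definition K2 :: "game \<Rightarrow> (real \<Rightarrow> real mat) \<Rightarrow> nat \<Rightarrow> nat \<Rightarrow> real \<Rightarrow> real mat" where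
  "K2 G P i j t = minv (wR1 G i j t) *
     (transpose_mat (cB2 G i j t) * P t + transpose_mat (cD2 G i j t) * ric_Lambda G P t)"

definition K3 :: "game \<Rightarrow> (real \<Rightarrow> real mat) \<Rightarrow> nat \<Rightarrow> nat \<Rightarrow> real \<Rightarrow> real mat" where
  "K3 G P j i t = minv (wRb1 G j i t) *
     (transpose_mat (cB3 G j i t) * P t + transpose_mat (cD3 G j i t) * ric_Lambda G P t)"

definition u1_star :: "game \<Rightarrow> (real \<Rightarrow> real mat) \<Rightarrow> 'w vproc \<Rightarrow> nat \<Rightarrow> 'w vproc" where
  "u1_star G P x i t \<omega> = - (K1 G P i t *\<^sub>v x t \<omega>)"

definition u2_star :: "game \<Rightarrow> (real \<Rightarrow> real mat) \<Rightarrow> 'w vproc \<Rightarrow> nat \<Rightarrow> nat \<Rightarrow> 'w vproc" where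
  "u2_star G P x i j t \<omega> = - (K2 G P i j t *\<^sub>v x t \<omega>)"

definition u3_star :: "game \<Rightarrow> (real \<Rightarrow> real mat) \<Rightarrow> 'w vproc \<Rightarrow> nat \<Rightarrow> nat \<Rightarrow> 'w vproc" where
  "u3_star G P x j i t \<omega> = - (K3 G P j i t *\<^sub>v x t \<omega>)"

definition v_star :: "game \<Rightarrow> (real \<Rightarrow> real mat) \<Rightarrow> 'w vproc \<Rightarrow> 'w vproc" where
  "v_star G P x t \<omega> = (1 / (gam G)\<^sup>2) \<cdot>\<^sub>v ((transpose_mat (cE G t) * P t) *\<^sub>v x t \<omega>)"

definition team_optimal_trajectory ::
  "'w measure \<Rightarrow> (real \<Rightarrow> 'w measure) \<Rightarrow> (real \<Rightarrow> 'w \<Rightarrow> real) \<Rightarrow> game \<Rightarrow> (real \<Rightarrow> real mat) \<Rightarrow>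
   real vec \<Rightarrow> 'w vproc \<Rightarrow> bool" where
  "team_optimal_trajectory M F W G P x0 x \<longleftrightarrow>
     state_solution M F W G x0 (u1_star G P x) (u2_star G P x) (u3_star G P x) (v_star G P x) x"

subsection \<open>The Level 2 game\<close>

definition player_blocks :: "nat \<Rightarrow> (nat \<Rightarrow> nat \<Rightarrow> 'a) \<Rightarrow> (nat \<Rightarrow> nat \<Rightarrow> 'a) \<Rightarrow> 'a list" where
  "player_blocks i f2 f3 = [f2 i 1, f2 i 2, f2 i 3, f3 1 i, f3 2 i, f3 3 i]"

definition dims_c :: "game \<Rightarrow> nat \<Rightarrow> nat list" where
  "dims_c G i = player_blocks i (dim2 G) (dim3 G)"

definition dim_c :: "game \<Rightarrow> nat \<Rightarrow> nat" where
  "dim_c G i = sum_list (dims_c G i)"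

definition uc_star :: "game \<Rightarrow> (real \<Rightarrow> real mat) \<Rightarrow> 'w vproc \<Rightarrow> nat \<Rightarrow> 'w vproc" where
  "uc_star G P x i t \<omega> =
     vcat (player_blocks i (\<lambda>i j. u2_star G P x i j t \<omega>) (\<lambda>j i. u3_star G P x j i t \<omega>))"

text \<open>Both \<open>\<eta> i j\<close> $= \eta_{1ij}$ and \<open>\<zeta> i j\<close> $= \zeta_{1ij}$ take the Level 2 argument order.\<close>

type_synonym incentive = "nat \<Rightarrow> nat \<Rightarrow> real \<Rightarrow> real mat"

definition incentive_parameters :: "game \<Rightarrow> incentive \<Rightarrow> incentive \<Rightarrow> bool" where
  "incentive_parameters G \<eta> \<zeta> \<longleftrightarrow> (\<forall>i\<in>{1, 2}. \<forall>j\<in>{1, 2, 3}.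
     continuous_coeff (hor G) (dim1 G i) (dim2 G i j) (\<eta> i j) \<and>
     continuous_coeff (hor G) (dim1 G i) (dim3 G j i) (\<zeta> i j))"

definition xi1 :: "game \<Rightarrow> (real \<Rightarrow> real mat) \<Rightarrow> incentive \<Rightarrow> incentive \<Rightarrow> nat \<Rightarrow> nat \<Rightarrow> real \<Rightarrow> real mat" where
  "xi1 G P \<eta> \<zeta> i j t =
     (- 1 / 3) \<cdot>\<^sub>m K1 G P i t + \<eta> i j t * K2 G P i j t + \<zeta> i j t * K3 G P j i t"

definition xi :: "game \<Rightarrow> (real \<Rightarrow> real mat) \<Rightarrow> incentive \<Rightarrow> incentive \<Rightarrow> nat \<Rightarrow> real \<Rightarrow> real mat" where
  "xi G P \<eta> \<zeta> i t = sum3 (\<lambda>j. xi1 G P \<eta> \<zeta> i j t)"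

definition Nmat :: "game \<Rightarrow> incentive \<Rightarrow> incentive \<Rightarrow> nat \<Rightarrow> real \<Rightarrow> real mat" where
  "Nmat G \<eta> \<zeta> i t =
     hcat (dim1 G i) [\<eta> i 1 t, \<eta> i 2 t, \<eta> i 3 t, \<zeta> i 1 t, \<zeta> i 2 t, \<zeta> i 3 t]"

definition A_bar :: "game \<Rightarrow> (real \<Rightarrow> real mat) \<Rightarrow> incentive \<Rightarrow> incentive \<Rightarrow> real \<Rightarrow> real mat" where
  "A_bar G P \<eta> \<zeta> t = cA G t + (1 / (gam G)\<^sup>2) \<cdot>\<^sub>m (cE G t * transpose_mat (cE G t) * P t)
     + sum2 (\<lambda>i. cB1 G i t * xi G P \<eta> \<zeta> i t)"

definition C_bar :: "game \<Rightarrow> (real \<Rightarrow> real mat) \<Rightarrow> incentive \<Rightarrow> incentive \<Rightarrow> real \<Rightarrow> real mat" where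
  "C_bar G P \<eta> \<zeta> t = cC G t + sum2 (\<lambda>i. cD1 G i t * xi G P \<eta> \<zeta> i t)"

definition Bc_bar :: "game \<Rightarrow> incentive \<Rightarrow> incentive \<Rightarrow> nat \<Rightarrow> real \<Rightarrow> real mat" where
  "Bc_bar G \<eta> \<zeta> i t =
     hcat (dimx G) (player_blocks i (\<lambda>i j. cB2 G i j t) (\<lambda>j i. cB3 G j i t))
     + cB1 G i t * Nmat G \<eta> \<zeta> i t"

definition Dc_bar :: "game \<Rightarrow> incentive \<Rightarrow> incentive \<Rightarrow> nat \<Rightarrow> real \<Rightarrow> real mat" where
  "Dc_bar G \<eta> \<zeta> i t =
     hcat (dimx G) (player_blocks i (\<lambda>i j. cD2 G i j t) (\<lambda>j i. cD3 G j i t))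
     + cD1 G i t * Nmat G \<eta> \<zeta> i t"

definition level2_state ::
  "'w measure \<Rightarrow> (real \<Rightarrow> 'w measure) \<Rightarrow> (real \<Rightarrow> 'w \<Rightarrow> real) \<Rightarrow> game \<Rightarrow> (real \<Rightarrow> real mat) \<Rightarrow>
   incentive \<Rightarrow> incentive \<Rightarrow> real vec \<Rightarrow> (nat \<Rightarrow> 'w vproc) \<Rightarrow> 'w vproc \<Rightarrow> bool" where
  "level2_state M F W G P \<eta> \<zeta> x0 uc x \<longleftrightarrow>
     sde_solution M F (hor G) W (dimx G)
       (\<lambda>t \<omega>. A_bar G P \<eta> \<zeta> t *\<^sub>v x t \<omega> + sum2 (\<lambda>i. Bc_bar G \<eta> \<zeta> i t *\<^sub>v uc i t \<omega>))
       (\<lambda>t \<omega>. C_bar G P \<eta> \<zeta> t *\<^sub>v x t \<omega> + sum2 (\<lambda>i. Dc_bar G \<eta> \<zeta> i t *\<^sub>v uc i t \<omega>))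
       x0 x"

text \<open>The cost $J^2_i$; the arguments are $u_{1i}$, $u_{2ij}$ and $u_{3ji}$ as families in \<open>j\<close>.\<close>

definition J2 ::
  "'w measure \<Rightarrow> game \<Rightarrow> nat \<Rightarrow> 'w vproc \<Rightarrow> 'w vproc \<Rightarrow> (nat \<Rightarrow> 'w vproc) \<Rightarrow> (nat \<Rightarrow> 'w vproc) \<Rightarrow> real" where
  "J2 M G i x u1 u2 u3 =
     (\<integral>\<omega>. (LBINT t:{0..hor G}.
              (wQ2 G i t *\<^sub>v x t \<omega>) \<bullet> x t \<omega> + (wR20 G i t *\<^sub>v u1 t \<omega>) \<bullet> u1 t \<omega>
              + (\<Sum>j\<in>{1, 2, 3}. (wR2 G i j t *\<^sub>v u2 j t \<omega>) \<bullet> u2 j t \<omega>)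
              + (\<Sum>j\<in>{1, 2, 3}. (wRb2 G j i t *\<^sub>v u3 j t \<omega>) \<bullet> u3 j t \<omega>))
          + (wG2 G i *\<^sub>v x (hor G) \<omega>) \<bullet> x (hor G) \<omega> \<partial>M)"

text \<open>The reduced cost $\bar J^2_i(u_{c1},u_{c2};x_0)$. The state is unique up to
  indistinguishability, so the value does not depend on the choice made here.\<close>

definition J2_bar ::
  "'w measure \<Rightarrow> (real \<Rightarrow> 'w measure) \<Rightarrow> (real \<Rightarrow> 'w \<Rightarrow> real) \<Rightarrow> game \<Rightarrow> (real \<Rightarrow> real mat) \<Rightarrow>
   incentive \<Rightarrow> incentive \<Rightarrow> real vec \<Rightarrow> nat \<Rightarrow> (nat \<Rightarrow> 'w vproc) \<Rightarrow> real" where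
  "J2_bar M F W G P \<eta> \<zeta> x0 i uc =
     (let x = (SOME x. level2_state M F W G P \<eta> \<zeta> x0 uc x);
          u2 = (\<lambda>j t \<omega>. vblock (dims_c G i) (j - 1) (uc i t \<omega>));
          u3 = (\<lambda>j t \<omega>. vblock (dims_c G i) (j + 2) (uc i t \<omega>));
          u1 = (\<lambda>t \<omega>. sum3 (\<lambda>j. xi1 G P \<eta> \<zeta> i j t *\<^sub>v x t \<omega>)
                  + sum3 (\<lambda>j. \<eta> i j t *\<^sub>v u2 j t \<omega>) + sum3 (\<lambda>j. \<zeta> i j t *\<^sub>v u3 j t \<omega>))
      in J2 M G i x u1 u2 u3)"

definition open_loop_nash ::
  "'w measure \<Rightarrow> (real \<Rightarrow> 'w measure) \<Rightarrow> (real \<Rightarrow> 'w \<Rightarrow> real) \<Rightarrow> game \<Rightarrow> (real \<Rightarrow> real mat) \<Rightarrow>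
   incentive \<Rightarrow> incentive \<Rightarrow> real vec \<Rightarrow> (nat \<Rightarrow> 'w vproc) \<Rightarrow> bool" where
  "open_loop_nash M F W G P \<eta> \<zeta> x0 uc \<longleftrightarrow>
     (\<forall>i\<in>{1, 2}. uc i \<in> L2F_vec M F (hor G) (dim_c G i)) \<and>
     (\<forall>i\<in>{1, 2}. \<forall>u\<in>L2F_vec M F (hor G) (dim_c G i).
        J2_bar M F W G P \<eta> \<zeta> x0 i uc \<le> J2_bar M F W G P \<eta> \<zeta> x0 i (uc(i := u)))"

end

theory Submission
  imports Defs "Jordan_Normal_Form.Determinant"
begin

text \<open>The announced incentive is built so that it returns the team-optimal control of Level 1 whenever
  the followers play their team-optimal controls along the same trajectory. Hence, along
  \<open>u\<^sup>+ = u\<^sup>*\<close>, the coefficients of the equations of \<open>x_tilde\<close> and \<open>x_bar\<close> differ by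
  \<open>A_bar (x_tilde - x_bar)\<close> and \<open>C_bar (x_tilde - x_bar)\<close>, and the theorem is pathwise uniqueness
  for a linear equation with bounded measurable coefficients. The latter follows from the Ito isometry,
  the Cauchy-Schwarz inequality and Gronwall's lemma for \<open>E |x_tilde - x_bar|\<^sup>2\<close>. Only the
  mean-square bound for a difference of two Ito integrals is needed, and it passes to the
  limit from simple processes.\<close>

subsection \<open>Bounded measurable matrix functions\<close>

text \<open>Several circumstances shape the argument. The predicate \<open>ito_integral\<close>
  supplies each integrand with its own approximating sequence of simple processes, so two integrals
  are compared through unrelated partitions, and the resulting estimate carries a constant larger
  than one that Gronwall's lemma absorbs. The controls agree only almost everywhere for the product
  of time and probability, so the Lipschitz bound is an almost-everywhere statement too; this
  suffices because the coefficients enter only under integrals. The Lebesgue integral of a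
  non-integrable function defaults to zero, so subtracting the two integrated equations requires
  integrable drifts, hence bounded and measurable gains \<open>K1\<close>, \<open>K2\<close>,
  \<open>K3\<close>. These contain inverses of weights and of \<open>ric_H\<close>: measurability of
  an inverse comes from Cramer's formula, while its bound comes from uniform positive definiteness
  for the weights and from the definition of a Riccati solution for \<open>ric_H\<close>. Finally,
  Gronwall's lemma yields equality at each fixed time, and path continuity provides one null set for
  all times.\<close>

definition bdd_meas :: "real \<Rightarrow> (real \<Rightarrow> real) \<Rightarrow> bool" where
  "bdd_meas T f \<longleftrightarrow> f \<in> borel_measurable (restrict_space borel {0..T}) \<and> (\<exists>K. \<forall>t\<in>{0..T}. \<bar>f t\<bar> \<le> K)"

lemma bdd_meas_cong: "(\<And>t. t \<in> {0..T} \<Longrightarrow> f t = g t) \<Longrightarrow> bdd_meas T f \<longleftrightarrow> bdd_meas T g"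
  unfolding bdd_meas_def by (intro conj_cong measurable_cong) (auto simp: space_restrict_space)

lemma bdd_meas_measurable: "bdd_meas T f \<Longrightarrow> f \<in> borel_measurable (restrict_space borel {0..T})"
  by (simp add: bdd_meas_def)

lemma bdd_meas_const: "bdd_meas T (\<lambda>t. c)"
  unfolding bdd_meas_def by auto

lemma bdd_meas_add:
  assumes f: "bdd_meas T f" and g: "bdd_meas T g"
  shows "bdd_meas T (\<lambda>t. f t + g t)"
proof -
  obtain c d where "\<forall>t\<in>{0..T}. \<bar>f t\<bar> \<le> c" "\<forall>t\<in>{0..T}. \<bar>g t\<bar> \<le> d"
    using f g unfolding bdd_meas_def by blast
  then have "\<forall>t\<in>{0..T}. \<bar>f t + g t\<bar> \<le> c + d" by (auto intro!: order_trans[OF abs_triangle_ineq add_mono])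
  then show ?thesis using f g unfolding bdd_meas_def by (blast intro: borel_measurable_add)
qed

lemma bdd_meas_mult:
  assumes f: "bdd_meas T f" and g: "bdd_meas T g"
  shows "bdd_meas T (\<lambda>t. f t * g t)"
proof -
  obtain c d where "\<forall>t\<in>{0..T}. \<bar>f t\<bar> \<le> c" "\<forall>t\<in>{0..T}. \<bar>g t\<bar> \<le> d"
    using f g unfolding bdd_meas_def by blast
  then have "\<forall>t\<in>{0..T}. \<bar>f t * g t\<bar> \<le> c * d" by (auto simp: abs_mult intro!: mult_mono')
  then show ?thesis using f g unfolding bdd_meas_def by (blast intro: borel_measurable_times)
qed

lemma bdd_meas_sum: "(\<And>k. k \<in> K \<Longrightarrow> bdd_meas T (f k)) \<Longrightarrow> bdd_meas T (\<lambda>t. \<Sum>k\<in>K. f k t)"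
  by (induction K rule: infinite_finite_induct) (simp_all add: bdd_meas_const bdd_meas_add)

lemma bdd_meas_prod: "(\<And>k. k \<in> K \<Longrightarrow> bdd_meas T (f k)) \<Longrightarrow> bdd_meas T (\<lambda>t. \<Prod>k\<in>K. f k t)"
  by (induction K rule: infinite_finite_induct) (simp_all add: bdd_meas_const bdd_meas_mult)

lemma bounded_coeff_iff:
  "bounded_coeff T r c X \<longleftrightarrow> (\<forall>t\<in>{0..T}. X t \<in> carrier_mat r c) \<and> (\<forall>a<r. \<forall>b<c. bdd_meas T (\<lambda>t. X t $$ (a, b)))"
  by (simp add: bounded_coeff_def bdd_meas_def)

lemma bounded_coeffD:
  assumes "bounded_coeff T r c X"
  shows "t \<in> {0..T} \<Longrightarrow> X t \<in> carrier_mat r c" "a < r \<Longrightarrow> b < c \<Longrightarrow> bdd_meas T (\<lambda>t. X t $$ (a, b))"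
  using assms by (simp_all add: bounded_coeff_iff)

text \<open>The functions \<open>g a b\<close> have to agree with the entries of \<open>X\<close> on
  the horizon only: outside it the dimensions of \<open>X t\<close> are unknown, and the entries of
  a sum or a product cannot be computed.\<close>

lemma bounded_coeffI:
  assumes "\<And>t. t \<in> {0..T} \<Longrightarrow> X t \<in> carrier_mat r c"
    and "\<And>a b. a < r \<Longrightarrow> b < c \<Longrightarrow> bdd_meas T (g a b)"
    and "\<And>t a b. t \<in> {0..T} \<Longrightarrow> a < r \<Longrightarrow> b < c \<Longrightarrow> X t $$ (a, b) = g a b t"
  shows "bounded_coeff T r c X"
  unfolding bounded_coeff_iff
proof (intro conjI ballI allI impI)
  fix a b assume ab: "a < r" "b < c"
  have "bdd_meas T (\<lambda>t. X t $$ (a, b)) \<longleftrightarrow> bdd_meas T (g a b)"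
    using assms(3) ab by (intro bdd_meas_cong) simp
  then show "bdd_meas T (\<lambda>t. X t $$ (a, b))" using assms(2) ab by simp
qed (use assms(1) in auto)

lemma bounded_coeff_add:
  assumes X: "bounded_coeff T r c X" and Y: "bounded_coeff T r c Y"
  shows "bounded_coeff T r c (\<lambda>t. X t + Y t)"
proof (rule bounded_coeffI[where g = "\<lambda>a b t. X t $$ (a, b) + Y t $$ (a, b)"], goal_cases)
  case (1 t)
  show ?case using bounded_coeffD(1)[OF Y 1] by (rule add_carrier_mat)
next
  case (2 a b)
  show ?case using bounded_coeffD(2)[OF X 2] bounded_coeffD(2)[OF Y 2] by (rule bdd_meas_add)
next
  case (3 t a b)
  then show ?case using bounded_coeffD(1)[OF Y 3(1)] by simp
qed

lemma bounded_coeff_smult: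
  assumes X: "bounded_coeff T r c X"
  shows "bounded_coeff T r c (\<lambda>t. k \<cdot>\<^sub>m X t)"
proof (rule bounded_coeffI[where g = "\<lambda>a b t. k * X t $$ (a, b)"], goal_cases)
  case (1 t)
  show ?case using bounded_coeffD(1)[OF X 1] by (rule smult_carrier_mat)
next
  case (2 a b)
  show ?case using bdd_meas_const bounded_coeffD(2)[OF X 2] by (rule bdd_meas_mult)
next
  case (3 t a b)
  then show ?case using bounded_coeffD(1)[OF X 3(1)] by simp
qed

lemma bounded_coeff_minus:
  assumes X: "bounded_coeff T r c X" and Y: "bounded_coeff T r c Y"
  shows "bounded_coeff T r c (\<lambda>t. X t - Y t)"
proof (rule bounded_coeffI[where g = "\<lambda>a b t. X t $$ (a, b) + (- 1) * Y t $$ (a, b)"], goal_cases)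
  case (1 t)
  show ?case using bounded_coeffD(1)[OF Y 1] by (rule minus_carrier_mat)
next
  case (2 a b)
  show ?case using bounded_coeffD(2)[OF X 2] bdd_meas_mult[OF bdd_meas_const bounded_coeffD(2)[OF Y 2]]
    by (rule bdd_meas_add)
next
  case (3 t a b)
  then show ?case using bounded_coeffD(1)[OF Y 3(1)] by simp
qed

lemma bounded_coeff_transpose:
  assumes X: "bounded_coeff T r c X"
  shows "bounded_coeff T c r (\<lambda>t. transpose_mat (X t))"
proof (rule bounded_coeffI[where g = "\<lambda>a b t. X t $$ (b, a)"], goal_cases)
  case (1 t)
  show ?case using bounded_coeffD(1)[OF X 1] by simp
next
  case (2 a b)
  show ?case using bounded_coeffD(2)[OF X 2(2,1)] .
next
  case (3 t a b)
  then show ?case using bounded_coeffD(1)[OF X 3(1)] by simp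
qed

lemma bounded_coeff_one: "bounded_coeff T d d (\<lambda>t. 1\<^sub>m d)"
  by (rule bounded_coeffI[where g = "\<lambda>a b t. if a = b then 1 else 0"]) (auto intro: bdd_meas_const)

lemma bounded_coeff_mult:
  assumes X: "bounded_coeff T r d X" and Y: "bounded_coeff T d c Y"
  shows "bounded_coeff T r c (\<lambda>t. X t * Y t)"
proof (rule bounded_coeffI[where g = "\<lambda>a b t. \<Sum>k\<in>{0..<d}. X t $$ (a, k) * Y t $$ (k, b)"], goal_cases)
  case (1 t)
  show ?case using bounded_coeffD(1)[OF X 1] bounded_coeffD(1)[OF Y 1] by (rule mult_carrier_mat)
next
  case (2 a b)
  then show ?case by (intro bdd_meas_sum bdd_meas_mult bounded_coeffD(2)[OF X] bounded_coeffD(2)[OF Y]) simp_all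
next
  case (3 t a b)
  then show ?case
    using bounded_coeffD(1)[OF X 3(1)] bounded_coeffD(1)[OF Y 3(1)] by (simp add: scalar_prod_def)
qed

lemma bounded_coeff_continuous:
  assumes X: "continuous_coeff T r c X"
  shows "bounded_coeff T r c X"
  unfolding bounded_coeff_def
proof (intro conjI allI impI)
  fix a b assume "a < r" "b < c"
  then have c: "continuous_on {0..T} (\<lambda>t. X t $$ (a, b))" using X by (simp add: continuous_coeff_def)
  then show "(\<lambda>t. X t $$ (a, b)) \<in> borel_measurable (restrict_space borel {0..T})"
    by (rule borel_measurable_continuous_on_restrict)
  have "bounded ((\<lambda>t. X t $$ (a, b)) ` {0..T})"
    using compact_continuous_image[OF c] compact_imp_bounded by blast
  then show "\<exists>K. \<forall>t\<in>{0..T}. \<bar>X t $$ (a, b)\<bar> \<le> K" unfolding bounded_iff by auto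
qed (use X in \<open>simp add: continuous_coeff_def\<close>)

section \<open>Matrices assembled from column blocks\<close>

lemma hcat_carrier: "hcat r Xs \<in> carrier_mat r (sum_list (map dim_col Xs))"
proof -
  have "length (concat (map cols Xs)) = sum_list (map dim_col Xs)"
    by (induction Xs) auto
  then show ?thesis unfolding hcat_def by (metis mat_of_cols_carrier(1))
qed

lemma hcat_Cons_index:
  assumes "X \<in> carrier_mat r c" "a < r" "b < c + dim_col (hcat r Xs)"
  shows "hcat r (X # Xs) $$ (a, b) = (if b < c then X $$ (a, b) else hcat r Xs $$ (a, b - c))"
  using assms by (auto simp: hcat_def mat_of_cols_index nth_append)

lemma bounded_coeff_hcat_Nil: "bounded_coeff T r 0 (\<lambda>t. hcat r [])"
  using hcat_carrier[of r "[]"] by (auto simp: bounded_coeff_iff)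

lemma bounded_coeff_hcat_Cons:
  assumes X: "bounded_coeff T r c X" and Xs: "bounded_coeff T r d (\<lambda>t. hcat r (Xs t))"
  shows "bounded_coeff T r (c + d) (\<lambda>t. hcat r (X t # Xs t))"
proof (rule bounded_coeffI[where g = "\<lambda>a b t. if b < c then X t $$ (a, b) else hcat r (Xs t) $$ (a, b - c)"],
    goal_cases)
  case (1 t)
  show ?case using bounded_coeffD(1)[OF X 1] bounded_coeffD(1)[OF Xs 1]
    hcat_carrier[of r "Xs t"] hcat_carrier[of r "X t # Xs t"] by auto
next
  case (2 a b)
  then show ?case
    using bounded_coeffD(2)[OF X, of a b] bounded_coeffD(2)[OF Xs, of a "b - c"] by (cases "b < c") simp_all
next
  case (3 t a b)
  then show ?case
    using bounded_coeffD(1)[OF X 3(1)] bounded_coeffD(1)[OF Xs 3(1)] by (intro hcat_Cons_index) auto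
qed

subsection \<open>Inverses\<close>

lemma minv_inverse:
  assumes X: "X \<in> carrier_mat d d" and det: "Determinant.det X \<noteq> 0"
  shows "minv X \<in> carrier_mat d d" "X * minv X = 1\<^sub>m d" "minv X * X = 1\<^sub>m d"
proof -
  have "mat_inverse X \<noteq> None"
    using mat_inverse(1)[OF X, where b = "()"] det_non_zero_imp_unit[OF X det, where b = "()"] by blast
  then obtain B where "mat_inverse X = Some B" by blast
  then show "minv X \<in> carrier_mat d d" "X * minv X = 1\<^sub>m d" "minv X * X = 1\<^sub>m d"
    using mat_inverse(2)[OF X, of B] by (auto simp: minv_def)
qed

text \<open>Cramer's formula, obtained by multiplying the adjugate identity from the left by the
  inverse. It exhibits the entries of the inverse as measurable functions of the entries of
  \<open>X\<close>.\<close>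

lemma minv_index:
  assumes X: "X \<in> carrier_mat d d" and det: "Determinant.det X \<noteq> 0" and ij: "i < d" "j < d"
  shows "minv X $$ (i, j) = inverse (Determinant.det X) * cofactor X j i"
proof -
  note I = minv_inverse[OF X det] and A = adj_mat[OF X]
  have "adj_mat X = (minv X * X) * adj_mat X" using I A by simp
  also have "\<dots> = minv X * (X * adj_mat X)" by (rule assoc_mult_mat[OF I(1) X A(1)])
  also have "\<dots> = minv X * (Determinant.det X \<cdot>\<^sub>m 1\<^sub>m d)" by (simp only: A(2))
  also have "\<dots> = Determinant.det X \<cdot>\<^sub>m minv X"
    using I by (metis mult_smult_distrib one_carrier_mat right_mult_one_mat)
  finally have "adj_mat X $$ (i, j) = (Determinant.det X \<cdot>\<^sub>m minv X) $$ (i, j)" by simp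
  then have "cofactor X j i = Determinant.det X * minv X $$ (i, j)"
    using X I ij by (simp add: adj_mat_def)
  then show ?thesis using det by (simp add: field_simps)
qed

text \<open>By the Leibniz formula the determinant is a polynomial in the entries, and bounded
  measurable functions form an algebra.\<close>

lemma bdd_meas_det:
  assumes X: "bounded_coeff T d d X"
  shows "bdd_meas T (\<lambda>t. Determinant.det (X t))"
proof -
  have eq: "bdd_meas T (\<lambda>t. Determinant.det (X t)) \<longleftrightarrow>
      bdd_meas T (\<lambda>t. \<Sum>p\<in>{p. p permutes {0..<d}}. signof p * (\<Prod>i\<in>{0..<d}. X t $$ (i, p i)))"
  proof (rule bdd_meas_cong)
    fix t assume "t \<in> {0..T}"
    then have "X t \<in> carrier_mat d d" by (rule bounded_coeffD(1)[OF X])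
    then show "Determinant.det (X t) = (\<Sum>p\<in>{p. p permutes {0..<d}}. signof p * (\<Prod>i\<in>{0..<d}. X t $$ (i, p i)))"
      by (rule det_def')
  qed
  show ?thesis unfolding eq
  proof (intro bdd_meas_sum bdd_meas_mult[OF bdd_meas_const] bdd_meas_prod)
    fix p i assume "p \<in> {p. p permutes {0..<d}}" "i \<in> {0..<d}"
    then have "i < d" "p i < d" using permutes_in_image[of p "{0..<d}" i] by simp_all
    then show "bdd_meas T (\<lambda>t. X t $$ (i, p i))" by (rule bounded_coeffD(2)[OF X])
  qed
qed

lemma bounded_coeff_mat_delete:
  assumes X: "bounded_coeff T d d X" and ij: "i < d" "j < d"
  shows "bounded_coeff T (d - 1) (d - 1) (\<lambda>t. mat_delete (X t) i j)"
proof (rule bounded_coeffI[where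
    g = "\<lambda>a b t. X t $$ (if a < i then a else Suc a, if b < j then b else Suc b)"], goal_cases)
  case (1 t)
  show ?case using bounded_coeffD(1)[OF X 1] by (auto simp: mat_delete_def)
next
  case (2 a b)
  then show ?case by (intro bounded_coeffD(2)[OF X]) auto
next
  case (3 t a b)
  then show ?case using bounded_coeffD(1)[OF X 3(1)] by (auto simp: mat_delete_def)
qed

text \<open>Cramer's formula settles measurability, but it gives no bound, since the determinant may
  come arbitrarily close to zero. The bound is therefore a premise, justified differently for
  \<open>Rc\<close> and for \<open>ric_H\<close>.\<close>

lemma bounded_coeff_minv:
  assumes X: "bounded_coeff T d d X"
    and det: "\<And>t. t \<in> {0..T} \<Longrightarrow> Determinant.det (X t) \<noteq> 0"
    and bdd: "\<And>t a b. t \<in> {0..T} \<Longrightarrow> a < d \<Longrightarrow> b < d \<Longrightarrow> \<bar>minv (X t) $$ (a, b)\<bar> \<le> K"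
  shows "bounded_coeff T d d (\<lambda>t. minv (X t))"
  unfolding bounded_coeff_def
proof (intro conjI allI impI ballI)
  show "minv (X t) \<in> carrier_mat d d" if "t \<in> {0..T}" for t
    using minv_inverse(1)[OF bounded_coeffD(1)[OF X that] det[OF that]] .
  fix a b assume ab: "a < d" "b < d"
  show "\<exists>K. \<forall>t\<in>{0..T}. \<bar>minv (X t) $$ (a, b)\<bar> \<le> K" using bdd ab by blast
  have "(\<lambda>t. inverse (Determinant.det (X t)) * ((- 1) ^ (b + a) * Determinant.det (mat_delete (X t) b a)))
      \<in> borel_measurable (restrict_space borel {0..T})"
    using bdd_meas_det[OF X] bdd_meas_det[OF bounded_coeff_mat_delete[OF X ab(2,1)]]
    by (intro borel_measurable_times borel_measurable_inverse borel_measurable_const bdd_meas_measurable)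
  moreover have "minv (X t) $$ (a, b) = inverse (Determinant.det (X t)) * ((- 1) ^ (b + a) * Determinant.det (mat_delete (X t) b a))"
    if "t \<in> {0..T}" for t
    using minv_index[OF bounded_coeffD(1)[OF X that] det[OF that] ab] by (simp add: cofactor_def)
  ultimately show "(\<lambda>t. minv (X t) $$ (a, b)) \<in> borel_measurable (restrict_space borel {0..T})"
    by (subst measurable_cong) (auto simp: space_restrict_space)
qed

section \<open>Uniformly positive definite weights\<close>

definition coercive :: "real \<Rightarrow> nat \<Rightarrow> (real \<Rightarrow> real mat) \<Rightarrow> bool" where
  "coercive T d X \<longleftrightarrow> bounded_coeff T d d X \<and>
     (\<exists>\<delta>>0. \<forall>t\<in>{0..T}. \<forall>y\<in>carrier_vec d. \<delta> * (y \<bullet> y) \<le> (X t *\<^sub>v y) \<bullet> y)"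

lemma pd_weight_coercive: "pd_weight T d X \<Longrightarrow> coercive T d X"
  by (simp add: pd_weight_def coercive_def)

lemma square_le_scalar_prod:
  fixes z :: "real vec"
  assumes "z \<in> carrier_vec d" "i < d"
  shows "(z $ i)\<^sup>2 \<le> z \<bullet> z"
proof -
  have "z $ i * z $ i \<le> (\<Sum>k = 0..<d. z $ k * z $ k)"
    by (rule member_le_sum) (use assms in auto)
  then show ?thesis using assms by (simp add: scalar_prod_def power2_eq_square)
qed

lemma scalar_prod_self_eq_0:
  fixes z :: "real vec"
  assumes "z \<in> carrier_vec d" "z \<bullet> z \<le> 0"
  shows "z = 0\<^sub>v d"
proof (rule eq_vecI)
  fix i assume i: "i < dim_vec (0\<^sub>v d)"
  then have "(z $ i)\<^sup>2 \<le> z \<bullet> z" by (intro square_le_scalar_prod[OF assms(1)]) simp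
  also note assms(2)
  finally have "z $ i = 0" by simp
  then show "z $ i = 0\<^sub>v d $ i" using i by simp
qed (use assms in simp)

text \<open>A kernel vector would contradict coercivity, so the determinant does not vanish. Column
  \<open>b\<close> of the inverse is the solution \<open>z\<close> of \<open>X z = e_b\<close>;
  testing coercivity on it gives \<delta> |z|^2 \<le> z_b. Applied to the entry \<open>b\<close>
  this yields z_b \<le> 1/\<delta>, and applied to the entry \<open>a\<close> it then yields |z_a|
  \<le> 1/\<delta>.\<close>

lemma coercive_minv:
  assumes X: "coercive T d X"
  shows "bounded_coeff T d d (\<lambda>t. minv (X t))"
proof -
  obtain \<delta> where d0: "\<delta> > 0" and \<delta>: "\<And>t y. t \<in> {0..T} \<Longrightarrow> y \<in> carrier_vec d \<Longrightarrow> \<delta> * (y \<bullet> y) \<le> (X t *\<^sub>v y) \<bullet> y"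
    using X unfolding coercive_def by blast
  have bX: "bounded_coeff T d d X" using X by (simp add: coercive_def)
  have det: "Determinant.det (X t) \<noteq> 0" if t: "t \<in> {0..T}" for t
  proof
    assume "Determinant.det (X t) = 0"
    then obtain v where v: "v \<in> carrier_vec d" "v \<noteq> 0\<^sub>v d" "X t *\<^sub>v v = 0\<^sub>v d"
      using det_0_iff_vec_prod_zero[OF bounded_coeffD(1)[OF bX t]] by blast
    then have "\<delta> * (v \<bullet> v) \<le> 0" using \<delta>[OF t v(1)] by simp
    then have "v \<bullet> v \<le> 0" using d0 by (simp add: mult_le_0_iff)
    then show False using scalar_prod_self_eq_0 v by blast
  qed
  show ?thesis
  proof (rule bounded_coeff_minv[OF bX det])
    fix t a b assume t: "t \<in> {0..T}" and ab: "a < d" "b < d"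
    note Xc = bounded_coeffD(1)[OF bX t] and I = minv_inverse[OF bounded_coeffD(1)[OF bX t] det[OF t]]
    define z where "z = col (minv (X t)) b"
    have z: "z \<in> carrier_vec d" using I by (simp add: z_def carrier_vecI)
    have "X t *\<^sub>v z = col (X t * minv (X t)) b"
      unfolding z_def by (rule col_mult2[OF Xc I(1) ab(2), symmetric])
    then have Xz: "X t *\<^sub>v z = unit_vec d b" using I ab by simp
    have "\<delta> * (z \<bullet> z) \<le> z $ b" using \<delta>[OF t z] z ab by (simp add: Xz)
    moreover have "(z $ b)\<^sup>2 \<le> z \<bullet> z" "(z $ a)\<^sup>2 \<le> z \<bullet> z" using square_le_scalar_prod z ab by auto
    ultimately have 1: "\<delta> * (z $ b)\<^sup>2 \<le> z $ b" "\<delta> * (z $ a)\<^sup>2 \<le> z $ b"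
      using d0 by (smt (verit) mult_left_mono)+
    have zb: "z $ b \<le> 1 / \<delta>"
    proof (cases "z $ b > 0")
      case True
      have "(\<delta> * z $ b) * z $ b \<le> 1 * z $ b" using 1(1) by (simp add: power2_eq_square algebra_simps)
      then have "\<delta> * z $ b \<le> 1" using True by (rule mult_right_le_imp_le)
      then show ?thesis using d0 by (simp add: field_simps)
    next
      case False then show ?thesis using d0 by (smt (verit) divide_pos_pos)
    qed
    have "(\<delta> * z $ a)\<^sup>2 = \<delta> * (\<delta> * (z $ a)\<^sup>2)" by (simp add: power2_eq_square)
    also have "\<dots> \<le> \<delta> * (1 / \<delta>)" using 1(2) zb d0 by (intro mult_left_mono) linarith+
    finally have "(\<delta> * z $ a)\<^sup>2 \<le> 1\<^sup>2" using d0 by simp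
    then have "\<bar>\<delta> * z $ a\<bar> \<le> 1" by (metis abs_le_square_iff abs_one)
    then have "\<bar>z $ a\<bar> \<le> 1 / \<delta>" using d0 by (simp add: abs_mult field_simps)
    then show "\<bar>minv (X t) $$ (a, b)\<bar> \<le> 1 / \<delta>" using I ab by (simp add: z_def)
  qed
qed

lemma coercive_diag_Nil: "coercive T 0 (\<lambda>t. diag_block_mat [])"
proof -
  have "bounded_coeff T 0 0 (\<lambda>t. 0\<^sub>m 0 0)" by (simp add: bounded_coeff_iff)
  then show ?thesis unfolding coercive_def by (intro conjI exI[of _ 1]) (auto simp: scalar_prod_def)
qed

text \<open>The quadratic form of a block diagonal matrix is the sum of the forms of its blocks, so
  the smaller of the two coercivity constants serves. Iterating this brings \<open>Rc\<close> within
  reach of \<open>coercive_minv\<close>.\<close>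

lemma coercive_diag_Cons:
  assumes X: "coercive T c X" and Y: "coercive T d (\<lambda>t. diag_block_mat (Xs t))"
  shows "coercive T (c + d) (\<lambda>t. diag_block_mat (X t # Xs t))"
proof -
  let ?Y = "\<lambda>t. diag_block_mat (Xs t)"
  let ?Z = "\<lambda>t. four_block_mat (X t) (0\<^sub>m c d) (0\<^sub>m d c) (?Y t)"
  have bX: "bounded_coeff T c c X" and bY: "bounded_coeff T d d ?Y" using X Y by (auto simp: coercive_def)
  have Z: "diag_block_mat (X t # Xs t) = ?Z t" if "t \<in> {0..T}" for t
    using bounded_coeffD(1)[OF bX that] bounded_coeffD(1)[OF bY that] by (auto simp: Let_def)
  obtain \<delta> where d0: "\<delta> > 0" and \<delta>: "\<And>t y. t \<in> {0..T} \<Longrightarrow> y \<in> carrier_vec c \<Longrightarrow> \<delta> * (y \<bullet> y) \<le> (X t *\<^sub>v y) \<bullet> y"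
    using X unfolding coercive_def by blast
  obtain \<epsilon> where e0: "\<epsilon> > 0" and \<epsilon>: "\<And>t y. t \<in> {0..T} \<Longrightarrow> y \<in> carrier_vec d \<Longrightarrow> \<epsilon> * (y \<bullet> y) \<le> (?Y t *\<^sub>v y) \<bullet> y"
    using Y unfolding coercive_def by blast
  have "bounded_coeff T (c + d) (c + d) (\<lambda>t. diag_block_mat (X t # Xs t))"
  proof (rule bounded_coeffI[where g = "\<lambda>a b t. if a < c \<and> b < c then X t $$ (a, b)
      else if \<not> a < c \<and> \<not> b < c then ?Y t $$ (a - c, b - c) else 0"])
    fix t assume t: "t \<in> {0..T}"
    note XY = bounded_coeffD(1)[OF bX t] bounded_coeffD(1)[OF bY t]
    show "diag_block_mat (X t # Xs t) \<in> carrier_mat (c + d) (c + d)" unfolding Z[OF t] using XY by simp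
    fix a b assume "a < c + d" "b < c + d"
    then show "diag_block_mat (X t # Xs t) $$ (a, b) = (if a < c \<and> b < c then X t $$ (a, b)
      else if \<not> a < c \<and> \<not> b < c then ?Y t $$ (a - c, b - c) else 0)"
      unfolding Z[OF t] using XY by auto
  next
    fix a b assume "a < c + d" "b < c + d"
    then show "bdd_meas T (\<lambda>t. if a < c \<and> b < c then X t $$ (a, b)
      else if \<not> a < c \<and> \<not> b < c then ?Y t $$ (a - c, b - c) else 0)"
      using bounded_coeffD(2)[OF bX, of a b] bounded_coeffD(2)[OF bY, of "a - c" "b - c"]
      by (cases "a < c"; cases "b < c") (auto intro: bdd_meas_const)
  qed
  moreover have "min \<delta> \<epsilon> * (y \<bullet> y) \<le> (diag_block_mat (X t # Xs t) *\<^sub>v y) \<bullet> y"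
    if t: "t \<in> {0..T}" and y: "y \<in> carrier_vec (c + d)" for t y
  proof -
    note XY = bounded_coeffD(1)[OF bX t] bounded_coeffD(1)[OF bY t]
    define u v where "u = vec_first y c" and "v = vec_last y d"
    have uv: "u \<in> carrier_vec c" "v \<in> carrier_vec d" and yuv: "y = u @\<^sub>v v"
      using y by (simp_all add: u_def v_def)
    have "0 \<le> u \<bullet> u" "0 \<le> v \<bullet> v" by (auto simp: scalar_prod_def intro: sum_nonneg)
    then have "min \<delta> \<epsilon> * (u \<bullet> u) \<le> \<delta> * (u \<bullet> u)" "min \<delta> \<epsilon> * (v \<bullet> v) \<le> \<epsilon> * (v \<bullet> v)"
      by (simp_all add: mult_right_mono)
    moreover have "diag_block_mat (X t # Xs t) *\<^sub>v y = (X t *\<^sub>v u) @\<^sub>v (?Y t *\<^sub>v v)"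
      unfolding Z[OF t] yuv by (rule mult_mat_vec_split) (use XY uv in auto)
    moreover have "((X t *\<^sub>v u) @\<^sub>v (?Y t *\<^sub>v v)) \<bullet> y = (X t *\<^sub>v u) \<bullet> u + (?Y t *\<^sub>v v) \<bullet> v"
      unfolding yuv using XY uv by (intro scalar_prod_append) auto
    moreover have "y \<bullet> y = u \<bullet> u + v \<bullet> v"
      unfolding yuv using uv by (intro scalar_prod_append) auto
    ultimately show ?thesis using \<delta>[OF t uv(1)] \<epsilon>[OF t uv(2)] by (simp add: distrib_left)
  qed
  moreover have "min \<delta> \<epsilon> > 0" using d0 e0 by simp
  ultimately show ?thesis unfolding coercive_def by blast
qed

lemma invertible_mat_det:
  fixes X :: "real mat"
  assumes X: "X \<in> carrier_mat d d" and inv: "invertible_mat X"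
  shows "Determinant.det X \<noteq> 0"
proof -
  obtain B where B: "X * B = 1\<^sub>m (dim_row X)" "B * X = 1\<^sub>m (dim_row B)"
    using inv unfolding invertible_mat_def inverts_mat_def by blast
  have "dim_row B = d" using arg_cong[OF B(2), of dim_col] X by simp
  moreover have "dim_col B = d" using arg_cong[OF B(1), of dim_col] X by simp
  ultimately have Bc: "B \<in> carrier_mat d d" by (rule carrier_matI)
  have "Determinant.det X * Determinant.det B = 1"
    using det_mult[OF X Bc] B(1) X by simp
  then show ?thesis by auto
qed

subsection \<open>Block products\<close>

lemma dim_vcat: "dim_vec (vcat vs) = sum_list (map dim_vec vs)"
  by (induction vs) (simp_all add: vcat_def)

lemma vcat_Cons: "vcat (v # vs) = v @\<^sub>v vcat vs"
proof (rule eq_vecI)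
  fix k assume "k < dim_vec (v @\<^sub>v vcat vs)"
  then show "vcat (v # vs) $ k = (v @\<^sub>v vcat vs) $ k"
    by (simp add: vcat_def vec_of_list_index nth_append list_of_vec_index)
qed (simp add: dim_vcat)

lemma mult_mat_vec_uminus:
  fixes A :: "real mat"
  assumes "A \<in> carrier_mat r c" "v \<in> carrier_vec c"
  shows "A *\<^sub>v - v = - (A *\<^sub>v v)"
  using assms by (intro eq_vecI) (simp_all add: scalar_prod_def sum_negf)

lemma smult_mat_mult_vec:
  fixes A :: "real mat"
  assumes "A \<in> carrier_mat r c" "v \<in> carrier_vec c"
  shows "(a \<cdot>\<^sub>m A) *\<^sub>v v = a \<cdot>\<^sub>v (A *\<^sub>v v)"
  using assms by (intro eq_vecI) (simp_all add: scalar_prod_def sum_distrib_left mult.assoc)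

lemma hcat_vcat_Nil: "hcat r [] *\<^sub>v vcat [] = 0\<^sub>v r"
  by (rule eq_vecI) (simp_all add: hcat_def vcat_def scalar_prod_def)

lemma hcat_vcat_Cons:
  assumes X: "X \<in> carrier_mat r c" "v \<in> carrier_vec c"
    and Xs: "hcat r Xs \<in> carrier_mat r d" "vcat vs \<in> carrier_vec d"
  shows "hcat r (X # Xs) *\<^sub>v vcat (v # vs) = X *\<^sub>v v + hcat r Xs *\<^sub>v vcat vs"
proof (rule eq_vecI)
  have C: "hcat r (X # Xs) \<in> carrier_mat r (c + d)"
    using X Xs hcat_carrier[of r Xs] hcat_carrier[of r "X # Xs"] by auto
  show "dim_vec (hcat r (X # Xs) *\<^sub>v vcat (v # vs)) = dim_vec (X *\<^sub>v v + hcat r Xs *\<^sub>v vcat vs)"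
    using C Xs by simp
  fix i assume "i < dim_vec (X *\<^sub>v v + hcat r Xs *\<^sub>v vcat vs)"
  then have i: "i < r" using Xs by simp
  have rc: "row X i \<in> carrier_vec c" "row (hcat r Xs) i \<in> carrier_vec d"
    using X(1) Xs(1) by (simp_all add: carrier_vecI)
  have "row (hcat r (X # Xs)) i = row X i @\<^sub>v row (hcat r Xs) i"
  proof (rule eq_vecI)
    fix k assume "k < dim_vec (row X i @\<^sub>v row (hcat r Xs) i)"
    then have k: "k < c + d" using X Xs by simp
    show "row (hcat r (X # Xs)) i $ k = (row X i @\<^sub>v row (hcat r Xs) i) $ k"
      using k i X Xs C hcat_Cons_index[OF X(1) i, of k Xs] by simp
  qed (use X Xs C in simp)
  then have "row (hcat r (X # Xs)) i \<bullet> vcat (v # vs) = row X i \<bullet> v + row (hcat r Xs) i \<bullet> vcat vs"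
    unfolding vcat_Cons using scalar_prod_append[OF rc X(2) Xs(2)] by simp
  then show "(hcat r (X # Xs) *\<^sub>v vcat (v # vs)) $ i = (X *\<^sub>v v + hcat r Xs *\<^sub>v vcat vs) $ i"
    using i C X Xs by simp
qed

text \<open>Six is the number of blocks in the control of one Level 2 player. The trailing zero is
  the product of the empty block lists; it disappears once a component is taken.\<close>

lemma hcat_vcat_six:
  assumes "X1 \<in> carrier_mat r d1" "X2 \<in> carrier_mat r d2" "X3 \<in> carrier_mat r d3"
    "X4 \<in> carrier_mat r d4" "X5 \<in> carrier_mat r d5" "X6 \<in> carrier_mat r d6"
    and "v1 \<in> carrier_vec d1" "v2 \<in> carrier_vec d2" "v3 \<in> carrier_vec d3"
    "v4 \<in> carrier_vec d4" "v5 \<in> carrier_vec d5" "v6 \<in> carrier_vec d6"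
  shows "hcat r [X1, X2, X3, X4, X5, X6] *\<^sub>v vcat [v1, v2, v3, v4, v5, v6] =
    X1 *\<^sub>v v1 + (X2 *\<^sub>v v2 + (X3 *\<^sub>v v3 + (X4 *\<^sub>v v4 + (X5 *\<^sub>v v5 + (X6 *\<^sub>v v6 + 0\<^sub>v r)))))"
proof -
  have dims: "dim_col X1 = d1" "dim_col X2 = d2" "dim_col X3 = d3" "dim_col X4 = d4" "dim_col X5 = d5" "dim_col X6 = d6"
    "dim_vec v1 = d1" "dim_vec v2 = d2" "dim_vec v3 = d3" "dim_vec v4 = d4" "dim_vec v5 = d5" "dim_vec v6 = d6"
    using assms by simp_all
  have H: "hcat r Xs \<in> carrier_mat r (sum_list ds)" if "map dim_col Xs = ds" for Xs ds
    using hcat_carrier[of r Xs] that by simp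
  have V: "vcat vs \<in> carrier_vec (sum_list ds)" if "map dim_vec vs = ds" for vs ds
    using dim_vcat[of vs] that by (intro carrier_vecI) simp
  show ?thesis
    using hcat_vcat_Cons[OF assms(1,7) H[of _ "[d2,d3,d4,d5,d6]"] V[of _ "[d2,d3,d4,d5,d6]"], of "[X2,X3,X4,X5,X6]" "[v2,v3,v4,v5,v6]"]
      hcat_vcat_Cons[OF assms(2,8) H[of _ "[d3,d4,d5,d6]"] V[of _ "[d3,d4,d5,d6]"], of "[X3,X4,X5,X6]" "[v3,v4,v5,v6]"]
      hcat_vcat_Cons[OF assms(3,9) H[of _ "[d4,d5,d6]"] V[of _ "[d4,d5,d6]"], of "[X4,X5,X6]" "[v4,v5,v6]"]
      hcat_vcat_Cons[OF assms(4,10) H[of _ "[d5,d6]"] V[of _ "[d5,d6]"], of "[X5,X6]" "[v5,v6]"]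
      hcat_vcat_Cons[OF assms(5,11) H[of _ "[d6]"] V[of _ "[d6]"], of "[X6]" "[v6]"]
      hcat_vcat_Cons[OF assms(6,12) H[of _ "[]"] V[of _ "[]"], of "[]" "[]"] dims
    by (simp only: list.map hcat_vcat_Nil)
qed

text \<open>Announcing \<open>\<xi>\<close> makes the incentive reproduce \<open>- K x\<close> exactly when the followers play their
  team-optimal feedback along \<open>x\<close>; away from \<open>x\<close> it only adds a feedback in the deviation.\<close>

lemma incentive_identity:
  fixes X K \<xi> :: "real mat"
  assumes X: "X \<in> carrier_mat n m" and K: "K \<in> carrier_mat m n"
    and Y: "Y1 \<in> carrier_mat n da" "Y2 \<in> carrier_mat n db" "Y3 \<in> carrier_mat n dc"
      "Y4 \<in> carrier_mat n dd" "Y5 \<in> carrier_mat n de" "Y6 \<in> carrier_mat n df"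
    and E: "E1 \<in> carrier_mat m da" "E2 \<in> carrier_mat m db" "E3 \<in> carrier_mat m dc"
      "E4 \<in> carrier_mat m dd" "E5 \<in> carrier_mat m de" "E6 \<in> carrier_mat m df"
    and L: "L1 \<in> carrier_mat da n" "L2 \<in> carrier_mat db n" "L3 \<in> carrier_mat dc n"
      "L4 \<in> carrier_mat dd n" "L5 \<in> carrier_mat de n" "L6 \<in> carrier_mat df n"
    and x: "x \<in> carrier_vec n" and z: "z \<in> carrier_vec n" and k: "k < n"
    and \<xi>: "\<xi> = ((- 1 / 3) \<cdot>\<^sub>m K + E1 * L1 + E4 * L4) + ((- 1 / 3) \<cdot>\<^sub>m K + E2 * L2 + E5 * L5)
      + ((- 1 / 3) \<cdot>\<^sub>m K + E3 * L3 + E6 * L6)"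
  shows "((X * \<xi>) *\<^sub>v z) $ k + ((hcat n [Y1, Y2, Y3, Y4, Y5, Y6] + X * hcat m [E1, E2, E3, E4, E5, E6]) *\<^sub>v
      vcat [- (L1 *\<^sub>v x), - (L2 *\<^sub>v x), - (L3 *\<^sub>v x), - (L4 *\<^sub>v x), - (L5 *\<^sub>v x), - (L6 *\<^sub>v x)]) $ k =
    ((X * \<xi>) *\<^sub>v (z - x)) $ k + (X *\<^sub>v - (K *\<^sub>v x)) $ k
    + ((Y1 *\<^sub>v - (L1 *\<^sub>v x)) $ k + (Y2 *\<^sub>v - (L2 *\<^sub>v x)) $ k + (Y3 *\<^sub>v - (L3 *\<^sub>v x)) $ k)
    + ((Y4 *\<^sub>v - (L4 *\<^sub>v x)) $ k + (Y5 *\<^sub>v - (L5 *\<^sub>v x)) $ k + (Y6 *\<^sub>v - (L6 *\<^sub>v x)) $ k)"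
proof -
  let ?w = "vcat [- (L1 *\<^sub>v x), - (L2 *\<^sub>v x), - (L3 *\<^sub>v x), - (L4 *\<^sub>v x), - (L5 *\<^sub>v x), - (L6 *\<^sub>v x)]"
  let ?H = "hcat n [Y1, Y2, Y3, Y4, Y5, Y6]" and ?N = "hcat m [E1, E2, E3, E4, E5, E6]"
  let ?d = "da + db + dc + dd + de + df"
  have Lx: "- (L1 *\<^sub>v x) \<in> carrier_vec da" "- (L2 *\<^sub>v x) \<in> carrier_vec db" "- (L3 *\<^sub>v x) \<in> carrier_vec dc"
    "- (L4 *\<^sub>v x) \<in> carrier_vec dd" "- (L5 *\<^sub>v x) \<in> carrier_vec de" "- (L6 *\<^sub>v x) \<in> carrier_vec df"
    using L x by simp_all
  have H: "?H \<in> carrier_mat n ?d" using hcat_carrier[of n "[Y1, Y2, Y3, Y4, Y5, Y6]"] Y by (simp add: add.assoc)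
  have N: "?N \<in> carrier_mat m ?d" using hcat_carrier[of m "[E1, E2, E3, E4, E5, E6]"] E by (simp add: add.assoc)
  have w: "?w \<in> carrier_vec ?d" by (rule carrier_vecI) (use L in \<open>simp add: dim_vcat\<close>)
  have \<xi>c: "\<xi> \<in> carrier_mat m n" unfolding \<xi> by (rule add_carrier_mat[OF add_carrier_mat[OF mult_carrier_mat[OF E(6) L(6)]]])
  have EL: "(Ei * Li) *\<^sub>v x = Ei *\<^sub>v (Li *\<^sub>v x)" "Ei *\<^sub>v - (Li *\<^sub>v x) = - (Ei *\<^sub>v (Li *\<^sub>v x))"
    if "Ei \<in> carrier_mat m d" "Li \<in> carrier_mat d n" for Ei Li d
    using assoc_mult_mat_vec[OF that x] mult_mat_vec_uminus[OF that(1) mult_mat_vec_carrier[OF that(2) x]]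
    by simp_all
  \<comment> \<open>The stacked vector consists of the blocks \<open>- (L x)\<close>, so
    \<open>?N *\<^sub>v ?w\<close> is minus the sum of the \<open>E L x\<close>, while each of the
    three summands of \<open>\<xi>\<close> contributes a third of \<open>- K x\<close>. This is the
    origin of the factor -1/3.\<close>
  have \<xi>x: "\<xi> *\<^sub>v x = - (K *\<^sub>v x) - ?N *\<^sub>v ?w"
  proof (rule eq_vecI)
    fix a assume "a < dim_vec (- (K *\<^sub>v x) - ?N *\<^sub>v ?w)"
    then have a: "a < m" using N by simp
    have K3: "((- 1 / 3) \<cdot>\<^sub>m K) *\<^sub>v x = (- 1 / 3) \<cdot>\<^sub>v (K *\<^sub>v x)"
      by (rule smult_mat_mult_vec[OF K x])
    have part: "(((- 1 / 3) \<cdot>\<^sub>m K + Ei * Li + Ej * Lj) *\<^sub>v x) = (- 1 / 3) \<cdot>\<^sub>v (K *\<^sub>v x) + Ei *\<^sub>v (Li *\<^sub>v x) + Ej *\<^sub>v (Lj *\<^sub>v x)"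
      if "Ei \<in> carrier_mat m di" "Li \<in> carrier_mat di n" "Ej \<in> carrier_mat m dj" "Lj \<in> carrier_mat dj n" for Ei Li Ej Lj di dj
    proof -
      have "(((- 1 / 3) \<cdot>\<^sub>m K + Ei * Li + Ej * Lj) *\<^sub>v x) = ((- 1 / 3) \<cdot>\<^sub>m K + Ei * Li) *\<^sub>v x + (Ej * Lj) *\<^sub>v x"
        by (rule add_mult_distrib_mat_vec[OF add_carrier_mat[OF mult_carrier_mat[OF that(1,2)]] mult_carrier_mat[OF that(3,4)] x])
      also have "((- 1 / 3) \<cdot>\<^sub>m K + Ei * Li) *\<^sub>v x = ((- 1 / 3) \<cdot>\<^sub>m K) *\<^sub>v x + (Ei * Li) *\<^sub>v x"
        by (rule add_mult_distrib_mat_vec[OF smult_carrier_mat[OF K] mult_carrier_mat[OF that(1,2)] x])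
      finally show ?thesis unfolding K3 EL(1)[OF that(1,2)] EL(1)[OF that(3,4)] .
    qed
    let ?p = "\<lambda>Ei Li Ej Lj. (- 1 / 3) \<cdot>\<^sub>m K + Ei * Li + Ej * Lj"
    have pc: "?p E1 L1 E4 L4 \<in> carrier_mat m n" "?p E2 L2 E5 L5 \<in> carrier_mat m n" "?p E3 L3 E6 L6 \<in> carrier_mat m n"
      by (rule add_carrier_mat[OF mult_carrier_mat[OF E(4) L(4)]] add_carrier_mat[OF mult_carrier_mat[OF E(5) L(5)]]
        add_carrier_mat[OF mult_carrier_mat[OF E(6) L(6)]])+
    have "\<xi> *\<^sub>v x = ?p E1 L1 E4 L4 *\<^sub>v x + ?p E2 L2 E5 L5 *\<^sub>v x + ?p E3 L3 E6 L6 *\<^sub>v x"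
      unfolding \<xi>
      by (simp only: add_mult_distrib_mat_vec[OF add_carrier_mat[OF pc(2)] pc(3) x] add_mult_distrib_mat_vec[OF pc(1,2) x])
    then have "(\<xi> *\<^sub>v x) $ a = (?p E1 L1 E4 L4 *\<^sub>v x) $ a + (?p E2 L2 E5 L5 *\<^sub>v x) $ a + (?p E3 L3 E6 L6 *\<^sub>v x) $ a"
      using a E by (simp del: index_mult_mat_vec)
    also have "\<dots> = - (K *\<^sub>v x) $ a + (E1 *\<^sub>v (L1 *\<^sub>v x)) $ a + (E2 *\<^sub>v (L2 *\<^sub>v x)) $ a + (E3 *\<^sub>v (L3 *\<^sub>v x)) $ a
        + (E4 *\<^sub>v (L4 *\<^sub>v x)) $ a + (E5 *\<^sub>v (L5 *\<^sub>v x)) $ a + (E6 *\<^sub>v (L6 *\<^sub>v x)) $ a"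
      unfolding part[OF E(1) L(1) E(4) L(4)] part[OF E(2) L(2) E(5) L(5)] part[OF E(3) L(3) E(6) L(6)]
      using a K E by (simp del: index_mult_mat_vec)
    finally have 1: "(\<xi> *\<^sub>v x) $ a = - (K *\<^sub>v x) $ a + (E1 *\<^sub>v (L1 *\<^sub>v x)) $ a + (E2 *\<^sub>v (L2 *\<^sub>v x)) $ a + (E3 *\<^sub>v (L3 *\<^sub>v x)) $ a
        + (E4 *\<^sub>v (L4 *\<^sub>v x)) $ a + (E5 *\<^sub>v (L5 *\<^sub>v x)) $ a + (E6 *\<^sub>v (L6 *\<^sub>v x)) $ a" .
    have 2: "(?N *\<^sub>v ?w) $ a = - (E1 *\<^sub>v (L1 *\<^sub>v x)) $ a - (E2 *\<^sub>v (L2 *\<^sub>v x)) $ a - (E3 *\<^sub>v (L3 *\<^sub>v x)) $ a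
        - (E4 *\<^sub>v (L4 *\<^sub>v x)) $ a - (E5 *\<^sub>v (L5 *\<^sub>v x)) $ a - (E6 *\<^sub>v (L6 *\<^sub>v x)) $ a"
      unfolding hcat_vcat_six[OF E Lx] EL(2)[OF E(1) L(1)] EL(2)[OF E(2) L(2)] EL(2)[OF E(3) L(3)]
        EL(2)[OF E(4) L(4)] EL(2)[OF E(5) L(5)] EL(2)[OF E(6) L(6)]
      using a E by (simp del: index_mult_mat_vec)
    have "(- (K *\<^sub>v x) - ?N *\<^sub>v ?w) $ a = - (K *\<^sub>v x) $ a - (?N *\<^sub>v ?w) $ a"
      using a K N by (simp del: index_mult_mat_vec)
    then show "(\<xi> *\<^sub>v x) $ a = (- (K *\<^sub>v x) - ?N *\<^sub>v ?w) $ a" unfolding 1 2 by simp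
  qed (use \<xi>c N in simp)
  have Kx: "- (K *\<^sub>v x) \<in> carrier_vec m" and Nw: "?N *\<^sub>v ?w \<in> carrier_vec m" using K x N w by simp_all
  have "((X * \<xi>) *\<^sub>v (z - x)) = (X * \<xi>) *\<^sub>v z - (X * \<xi>) *\<^sub>v x"
    by (rule mult_minus_distrib_mat_vec[OF mult_carrier_mat[OF X \<xi>c] z x])
  also have "(X * \<xi>) *\<^sub>v x = X *\<^sub>v (\<xi> *\<^sub>v x)" using X \<xi>c x by (intro assoc_mult_mat_vec)
  also have "\<dots> = X *\<^sub>v - (K *\<^sub>v x) - X *\<^sub>v (?N *\<^sub>v ?w)"
    unfolding \<xi>x using X Kx Nw by (rule mult_minus_distrib_mat_vec)
  finally have 1: "((X * \<xi>) *\<^sub>v (z - x)) $ k = ((X * \<xi>) *\<^sub>v z) $ k - ((X *\<^sub>v - (K *\<^sub>v x)) $ k - (X *\<^sub>v (?N *\<^sub>v ?w)) $ k)"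
    using k X by (simp del: index_mult_mat_vec)
  have "(?H + X * ?N) *\<^sub>v ?w = ?H *\<^sub>v ?w + (X * ?N) *\<^sub>v ?w"
    by (rule add_mult_distrib_mat_vec[OF H mult_carrier_mat[OF X N] w])
  also have "(X * ?N) *\<^sub>v ?w = X *\<^sub>v (?N *\<^sub>v ?w)" using X N w by (rule assoc_mult_mat_vec)
  finally have 2: "((?H + X * ?N) *\<^sub>v ?w) $ k = (?H *\<^sub>v ?w) $ k + (X *\<^sub>v (?N *\<^sub>v ?w)) $ k"
    using k X H by (simp del: index_mult_mat_vec)
  have 3: "(?H *\<^sub>v ?w) $ k = (Y1 *\<^sub>v - (L1 *\<^sub>v x)) $ k + (Y2 *\<^sub>v - (L2 *\<^sub>v x)) $ k + (Y3 *\<^sub>v - (L3 *\<^sub>v x)) $ k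
      + (Y4 *\<^sub>v - (L4 *\<^sub>v x)) $ k + (Y5 *\<^sub>v - (L5 *\<^sub>v x)) $ k + (Y6 *\<^sub>v - (L6 *\<^sub>v x)) $ k"
    unfolding hcat_vcat_six[OF Y Lx] using k Y by (simp del: index_mult_mat_vec)
  \<comment> \<open>The term \<open>X *\<^sub>v (?N *\<^sub>v ?w)\<close> occurs in both
    \<open>1\<close> and \<open>2\<close> and cancels.\<close>
  show ?thesis using 1 2 3 by linarith
qed

subsection \<open>The coefficients of the game\<close>

locale riccati_game =
  fixes G :: game and P :: "real \<Rightarrow> real mat" and \<eta> \<zeta> :: incentive
  assumes standing: "standing_assumptions G"
    and riccati: "riccati_solution G P"
    and incentive: "incentive_parameters G \<eta> \<zeta>"
begin

abbreviation "T \<equiv> hor G"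
abbreviation "n \<equiv> dimx G"

section \<open>Boundedness of the coefficients and the gains\<close>

lemma basic_bounded:
  "bounded_coeff T n n (cA G)" "bounded_coeff T n n (cC G)" "bounded_coeff T n (dimv G) (cE G)"
  using standing unfolding standing_assumptions_def Let_def by blast+

lemma level1_bounded:
  assumes "i \<in> {1, 2}"
  shows "bounded_coeff T n (dim1 G i) (cB1 G i)" "bounded_coeff T n (dim1 G i) (cD1 G i)"
    "coercive T (dim1 G i) (wR G i)"
  using standing assms unfolding standing_assumptions_def Let_def by (blast intro: pd_weight_coercive)+

lemma level23_bounded:
  assumes "i \<in> {1, 2}" "j \<in> {1, 2, 3}"
  shows "bounded_coeff T n (dim2 G i j) (cB2 G i j)" "bounded_coeff T n (dim2 G i j) (cD2 G i j)"
    "bounded_coeff T n (dim3 G j i) (cB3 G j i)" "bounded_coeff T n (dim3 G j i) (cD3 G j i)"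
    "coercive T (dim2 G i j) (wR1 G i j)" "coercive T (dim3 G j i) (wRb1 G j i)"
  using standing assms unfolding standing_assumptions_def Let_def by (blast intro: pd_weight_coercive)+

lemma P_bounded: "bounded_coeff T n n P"
  using riccati unfolding riccati_solution_def by (blast intro: bounded_coeff_continuous)

lemma incentive_bounded:
  assumes "i \<in> {1, 2}" "j \<in> {1, 2, 3}"
  shows "bounded_coeff T (dim1 G i) (dim2 G i j) (\<eta> i j)" "bounded_coeff T (dim1 G i) (dim3 G j i) (\<zeta> i j)"
  using incentive assms unfolding incentive_parameters_def by (blast intro: bounded_coeff_continuous)+

text \<open>Nesting to the right with a final 0 is the shape of the dimension that results from
  adding one block at a time to an empty list.\<close>

definition "dim_all = dim1 G 1 + (dim1 G 2 + (dim2 G 1 1 + (dim2 G 1 2 + (dim2 G 1 3 +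
  (dim2 G 2 1 + (dim2 G 2 2 + (dim2 G 2 3 + (dim3 G 1 1 + (dim3 G 1 2 + (dim3 G 2 1 +
  (dim3 G 2 2 + (dim3 G 3 1 + (dim3 G 3 2 + 0)))))))))))))"

lemma Bc_bounded: "bounded_coeff T n dim_all (Bc G)"
  unfolding Bc_def[abs_def] all_blocks_def dim_all_def
  by (intro bounded_coeff_hcat_Cons bounded_coeff_hcat_Nil level1_bounded level23_bounded) simp_all

lemma Dc_bounded: "bounded_coeff T n dim_all (Dc G)"
  unfolding Dc_def[abs_def] all_blocks_def dim_all_def
  by (intro bounded_coeff_hcat_Cons bounded_coeff_hcat_Nil level1_bounded level23_bounded) simp_all

lemma Rc_coercive: "coercive T dim_all (Rc G)"
  unfolding Rc_def[abs_def] all_blocks_def dim_all_def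
  by (intro coercive_diag_Cons coercive_diag_Nil level1_bounded level23_bounded) simp_all

lemma ric_H_bounded: "bounded_coeff T n n (ric_H G P)"
  unfolding ric_H_def[abs_def]
  by (intro bounded_coeff_add bounded_coeff_one
      bounded_coeff_mult[OF bounded_coeff_mult[OF bounded_coeff_mult[OF P_bounded Dc_bounded]
          coercive_minv[OF Rc_coercive]] bounded_coeff_transpose[OF Dc_bounded]])

text \<open>The matrix \<open>ric_H\<close> need be neither symmetric nor coercive, so the bound on
  its inverse is taken from the notion of a Riccati solution.\<close>

lemma minv_ric_H_bounded: "bounded_coeff T n n (\<lambda>t. minv (ric_H G P t))"
proof -
  obtain K where K: "\<forall>t\<in>{0..T}. \<forall>a<n. \<forall>b<n. \<bar>minv (ric_H G P t) $$ (a, b)\<bar> \<le> K"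
    using riccati unfolding riccati_solution_def by blast
  show ?thesis
  proof (rule bounded_coeff_minv[OF ric_H_bounded])
    fix t assume t: "t \<in> {0..T}"
    then have "invertible_mat (ric_H G P t)" using riccati unfolding riccati_solution_def by blast
    then show "Determinant.det (ric_H G P t) \<noteq> 0"
      by (rule invertible_mat_det[OF bounded_coeffD(1)[OF ric_H_bounded t]])
  qed (use K in blast)
qed

lemma ric_Lambda_bounded: "bounded_coeff T n n (ric_Lambda G P)"
  unfolding ric_Lambda_def[abs_def] ric_C_def
  by (intro bounded_coeff_minus minv_ric_H_bounded P_bounded basic_bounded
      bounded_coeff_mult[OF bounded_coeff_mult[OF minv_ric_H_bounded P_bounded]]
      bounded_coeff_mult[OF bounded_coeff_mult[OF bounded_coeff_mult[OF Dc_bounded coercive_minv[OF Rc_coercive]]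
          bounded_coeff_transpose[OF Bc_bounded]] P_bounded])

text \<open>The common shape of the three families of gains.\<close>

lemma gain_bounded:
  assumes "coercive T d R" "bounded_coeff T n d B" "bounded_coeff T n d D"
  shows "bounded_coeff T d n
    (\<lambda>t. minv (R t) * (transpose_mat (B t) * P t + transpose_mat (D t) * ric_Lambda G P t))"
  by (intro bounded_coeff_mult[OF coercive_minv[OF assms(1)]] bounded_coeff_add
      bounded_coeff_mult[OF bounded_coeff_transpose[OF assms(2)] P_bounded]
      bounded_coeff_mult[OF bounded_coeff_transpose[OF assms(3)] ric_Lambda_bounded])

lemma K1_bounded: "i \<in> {1, 2} \<Longrightarrow> bounded_coeff T (dim1 G i) n (K1 G P i)"
  unfolding K1_def[abs_def] by (intro gain_bounded level1_bounded)

lemma K2_bounded: "i \<in> {1, 2} \<Longrightarrow> j \<in> {1, 2, 3} \<Longrightarrow> bounded_coeff T (dim2 G i j) n (K2 G P i j)"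
  unfolding K2_def[abs_def] by (intro gain_bounded level23_bounded)

lemma K3_bounded: "i \<in> {1, 2} \<Longrightarrow> j \<in> {1, 2, 3} \<Longrightarrow> bounded_coeff T (dim3 G j i) n (K3 G P j i)"
  unfolding K3_def[abs_def] by (intro gain_bounded level23_bounded)

lemma xi_bounded:
  assumes i: "i \<in> {1, 2}"
  shows "bounded_coeff T (dim1 G i) n (xi G P \<eta> \<zeta> i)"
proof -
  have "bounded_coeff T (dim1 G i) n (xi1 G P \<eta> \<zeta> i j)" if j: "j \<in> {1, 2, 3}" for j
    unfolding xi1_def[abs_def]
    by (intro bounded_coeff_add bounded_coeff_smult K1_bounded[OF i]
        bounded_coeff_mult[OF incentive_bounded(1)[OF i j] K2_bounded[OF i j]]
        bounded_coeff_mult[OF incentive_bounded(2)[OF i j] K3_bounded[OF i j]])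
  then show ?thesis unfolding xi_def[abs_def] by (intro bounded_coeff_add) simp_all
qed

lemma dim_c_eq: "dim_c G i = dim2 G i 1 + (dim2 G i 2 + (dim2 G i 3 + (dim3 G 1 i + (dim3 G 2 i + (dim3 G 3 i + 0)))))"
  by (simp add: dim_c_def dims_c_def player_blocks_def)

lemma Nmat_bounded: "i \<in> {1, 2} \<Longrightarrow> bounded_coeff T (dim1 G i) (dim_c G i) (Nmat G \<eta> \<zeta> i)"
  unfolding Nmat_def[abs_def] dim_c_eq
  by (intro bounded_coeff_hcat_Cons bounded_coeff_hcat_Nil incentive_bounded) simp_all

lemma Bc_bar_bounded: "i \<in> {1, 2} \<Longrightarrow> bounded_coeff T n (dim_c G i) (Bc_bar G \<eta> \<zeta> i)"
  unfolding Bc_bar_def[abs_def] player_blocks_def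
  by (intro bounded_coeff_add bounded_coeff_mult[OF level1_bounded(1) Nmat_bounded], unfold dim_c_eq)
     (intro bounded_coeff_hcat_Cons bounded_coeff_hcat_Nil level23_bounded, simp_all)

lemma A_bar_bounded: "bounded_coeff T n n (A_bar G P \<eta> \<zeta>)"
proof -
  have "bounded_coeff T n n (\<lambda>t. cB1 G i t * xi G P \<eta> \<zeta> i t)" if "i \<in> {1, 2}" for i
    by (rule bounded_coeff_mult[OF level1_bounded(1)[OF that] xi_bounded[OF that]])
  then show ?thesis unfolding A_bar_def[abs_def]
    by (intro bounded_coeff_add bounded_coeff_smult basic_bounded
        bounded_coeff_mult[OF bounded_coeff_mult[OF basic_bounded(3) bounded_coeff_transpose[OF basic_bounded(3)]] P_bounded])
       simp_all
qed

lemma C_bar_bounded: "bounded_coeff T n n (C_bar G P \<eta> \<zeta>)"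
proof -
  have "bounded_coeff T n n (\<lambda>t. cD1 G i t * xi G P \<eta> \<zeta> i t)" if "i \<in> {1, 2}" for i
    by (rule bounded_coeff_mult[OF level1_bounded(2)[OF that] xi_bounded[OF that]])
  then show ?thesis unfolding C_bar_def[abs_def]
    by (intro bounded_coeff_add basic_bounded) simp_all
qed

text \<open>The matrices \<open>X\<close>, \<open>Y\<close>, \<open>Z\<close> stay arbitrary so that
  the same identity serves the drift (the B coefficients) and the diffusion (the D
  coefficients).\<close>

lemma player_identity:
  fixes xb :: "'w vproc"
  assumes i: "i \<in> {1, 2}" and t: "t \<in> {0..T}" and x: "xb t \<omega> \<in> carrier_vec n" and z: "z \<in> carrier_vec n"
    and X: "X \<in> carrier_mat n (dim1 G i)"
    and Y: "\<And>j. j \<in> {1, 2, 3} \<Longrightarrow> Y i j \<in> carrier_mat n (dim2 G i j)"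
    and Z: "\<And>j. j \<in> {1, 2, 3} \<Longrightarrow> Z j i \<in> carrier_mat n (dim3 G j i)"
    and k: "k < n"
  shows "((X * xi G P \<eta> \<zeta> i t) *\<^sub>v z) $ k
      + ((hcat n (player_blocks i Y Z) + X * Nmat G \<eta> \<zeta> i t) *\<^sub>v uc_star G P xb i t \<omega>) $ k =
    ((X * xi G P \<eta> \<zeta> i t) *\<^sub>v (z - xb t \<omega>)) $ k + (X *\<^sub>v u1_star G P xb i t \<omega>) $ k
      + sum3 (\<lambda>j. (Y i j *\<^sub>v u2_star G P xb i j t \<omega>) $ k)
      + sum3 (\<lambda>j. (Z j i *\<^sub>v u3_star G P xb j i t \<omega>) $ k)"
  unfolding player_blocks_def Nmat_def uc_star_def u1_star_def u2_star_def u3_star_def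
  by (rule incentive_identity[where m = "dim1 G i" and n = n and da = "dim2 G i 1" and db = "dim2 G i 2"
        and dc = "dim2 G i 3" and dd = "dim3 G 1 i" and de = "dim3 G 2 i" and df = "dim3 G 3 i"])
     (simp_all add: X Y Z x z k xi_def xi1_def bounded_coeffD(1)[OF K1_bounded[OF i] t]
       bounded_coeffD(1)[OF K2_bounded[OF i] t] bounded_coeffD(1)[OF K3_bounded[OF i] t]
       bounded_coeffD(1)[OF incentive_bounded(1)[OF i] t] bounded_coeffD(1)[OF incentive_bounded(2)[OF i] t])

text \<open>Here \<open>z\<close> stands for the actual state, while the followers play the feedback
  along \<open>xb\<close>. The Level 1 terms are handled by \<open>player_identity\<close>; the
  remaining discrepancy is the disturbance, which \<open>A_bar\<close> contains as a feedback in
  \<open>z\<close> and the team equation as \<open>v_star\<close> along \<open>xb\<close>. Every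
  mismatch is linear in \<open>z - xb\<close> and collects into \<open>A_bar\<close>.\<close>

lemma drift_identity:
  fixes xb :: "'w vproc"
  assumes t: "t \<in> {0..T}" and x: "xb t \<omega> \<in> carrier_vec n" and z: "z \<in> carrier_vec n" and k: "k < n"
  shows "(A_bar G P \<eta> \<zeta> t *\<^sub>v z + sum2 (\<lambda>i. Bc_bar G \<eta> \<zeta> i t *\<^sub>v uc_star G P xb i t \<omega>)) $ k =
    (cA G t *\<^sub>v xb t \<omega> + sum2 (\<lambda>i. cB1 G i t *\<^sub>v u1_star G P xb i t \<omega>)
      + sum2 (\<lambda>i. sum3 (\<lambda>j. cB2 G i j t *\<^sub>v u2_star G P xb i j t \<omega>))
      + sum3 (\<lambda>j. sum2 (\<lambda>i. cB3 G j i t *\<^sub>v u3_star G P xb j i t \<omega>)) + cE G t *\<^sub>v v_star G P xb t \<omega>) $ k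
    + (A_bar G P \<eta> \<zeta> t *\<^sub>v (z - xb t \<omega>)) $ k"
proof -
  let ?x = "xb t \<omega>" and ?B = "\<lambda>i. cB1 G i t * xi G P \<eta> \<zeta> i t"
  let ?E = "(1 / (gam G)\<^sup>2) \<cdot>\<^sub>m (cE G t * transpose_mat (cE G t) * P t)"
  note A = bounded_coeffD(1)[OF basic_bounded(1) t] and E = bounded_coeffD(1)[OF basic_bounded(3) t]
    and P = bounded_coeffD(1)[OF P_bounded t]
  have B1: "cB1 G i t \<in> carrier_mat n (dim1 G i)" "xi G P \<eta> \<zeta> i t \<in> carrier_mat (dim1 G i) n"
    "?B i \<in> carrier_mat n n" "Bc_bar G \<eta> \<zeta> i t \<in> carrier_mat n (dim_c G i)" if "i \<in> {1, 2}" for i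
    using bounded_coeffD(1)[OF level1_bounded(1)[OF that] t] bounded_coeffD(1)[OF xi_bounded[OF that] t]
      bounded_coeffD(1)[OF Bc_bar_bounded[OF that] t] by (auto intro: mult_carrier_mat)
  have B2: "cB2 G i j t \<in> carrier_mat n (dim2 G i j)" "cB3 G j i t \<in> carrier_mat n (dim3 G j i)"
    if "i \<in> {1, 2}" "j \<in> {1, 2, 3}" for i j
    using bounded_coeffD(1)[OF level23_bounded(1)[OF that] t] bounded_coeffD(1)[OF level23_bounded(3)[OF that] t]
    by auto
  have ETP: "transpose_mat (cE G t) * P t \<in> carrier_mat (dimv G) n"
    by (rule mult_carrier_mat[OF _ P]) (use E in simp)
  have Ec: "cE G t * transpose_mat (cE G t) * P t \<in> carrier_mat n n"
    by (rule mult_carrier_mat[OF mult_carrier_mat[OF E] P]) (use E in simp)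
  \<comment> \<open>The worst-case disturbance along \<open>xb\<close> is exactly the feedback term
    built into \<open>A_bar\<close>, evaluated at \<open>xb\<close>.\<close>
  have Ev: "(?E *\<^sub>v ?x) $ k = (cE G t *\<^sub>v v_star G P xb t \<omega>) $ k"
  proof -
    have "cE G t * transpose_mat (cE G t) * P t = cE G t * (transpose_mat (cE G t) * P t)"
      by (rule assoc_mult_mat[OF E _ P]) (use E in simp)
    then have "cE G t * transpose_mat (cE G t) * P t *\<^sub>v ?x = cE G t *\<^sub>v ((transpose_mat (cE G t) * P t) *\<^sub>v ?x)"
      using assoc_mult_mat_vec[OF E ETP x] by simp
    moreover have "?E *\<^sub>v ?x = (1 / (gam G)\<^sup>2) \<cdot>\<^sub>v (cE G t * transpose_mat (cE G t) * P t *\<^sub>v ?x)"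
      by (rule smult_mat_mult_vec[OF Ec x])
    moreover have "cE G t *\<^sub>v v_star G P xb t \<omega> =
        (1 / (gam G)\<^sup>2) \<cdot>\<^sub>v (cE G t *\<^sub>v ((transpose_mat (cE G t) * P t) *\<^sub>v ?x))"
      unfolding v_star_def by (rule mult_mat_vec[OF E mult_mat_vec_carrier[OF ETP x]])
    ultimately show ?thesis by simp
  qed
  have split: "(A_bar G P \<eta> \<zeta> t *\<^sub>v w) $ k =
      (cA G t *\<^sub>v w) $ k + (?E *\<^sub>v w) $ k + ((?B 1 *\<^sub>v w) $ k + (?B 2 *\<^sub>v w) $ k)"
    if w: "w \<in> carrier_vec n" for w
  proof -
    have b: "?B 1 \<in> carrier_mat n n" "?B 2 \<in> carrier_mat n n" using B1(3) by simp_all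
    have e: "?E \<in> carrier_mat n n" using Ec by (rule smult_carrier_mat)
    have "A_bar G P \<eta> \<zeta> t *\<^sub>v w = (cA G t *\<^sub>v w + ?E *\<^sub>v w) + (?B 1 *\<^sub>v w + ?B 2 *\<^sub>v w)"
      unfolding A_bar_def add_mult_distrib_mat_vec[OF add_carrier_mat[OF e] add_carrier_mat[OF b(2)] w]
        add_mult_distrib_mat_vec[OF A e w] add_mult_distrib_mat_vec[OF b w] ..
    then show ?thesis using k A P b B1(1)[of 1] B1(1)[of 2] E by (simp del: index_mult_mat_vec)
  qed
  have minus: "(X *\<^sub>v (z - ?x)) $ k = (X *\<^sub>v z) $ k - (X *\<^sub>v ?x) $ k" if "X \<in> carrier_mat n n" for X
    unfolding mult_minus_distrib_mat_vec[OF that z x] using that k by (simp del: index_mult_mat_vec)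
  have pl: "(?B i *\<^sub>v z) $ k + (Bc_bar G \<eta> \<zeta> i t *\<^sub>v uc_star G P xb i t \<omega>) $ k =
      (?B i *\<^sub>v (z - ?x)) $ k + (cB1 G i t *\<^sub>v u1_star G P xb i t \<omega>) $ k
      + sum3 (\<lambda>j. (cB2 G i j t *\<^sub>v u2_star G P xb i j t \<omega>) $ k)
      + sum3 (\<lambda>j. (cB3 G j i t *\<^sub>v u3_star G P xb j i t \<omega>) $ k)" if "i \<in> {1, 2}" for i
    unfolding Bc_bar_def
    by (rule player_identity[where xb = xb and t = t and \<omega> = \<omega> and Y = "\<lambda>i j. cB2 G i j t"
          and Z = "\<lambda>j i. cB3 G j i t", OF that t x z B1(1)[OF that] _ _ k])
       (rule B2(1)[OF that] B2(2)[OF that], assumption)+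
  have L: "(A_bar G P \<eta> \<zeta> t *\<^sub>v z + sum2 (\<lambda>i. Bc_bar G \<eta> \<zeta> i t *\<^sub>v uc_star G P xb i t \<omega>)) $ k =
      (A_bar G P \<eta> \<zeta> t *\<^sub>v z) $ k + sum2 (\<lambda>i. (Bc_bar G \<eta> \<zeta> i t *\<^sub>v uc_star G P xb i t \<omega>) $ k)"
    using k B1(4)[of 1] B1(4)[of 2] by (simp del: index_mult_mat_vec)
  have R: "(cA G t *\<^sub>v ?x + sum2 (\<lambda>i. cB1 G i t *\<^sub>v u1_star G P xb i t \<omega>)
      + sum2 (\<lambda>i. sum3 (\<lambda>j. cB2 G i j t *\<^sub>v u2_star G P xb i j t \<omega>))
      + sum3 (\<lambda>j. sum2 (\<lambda>i. cB3 G j i t *\<^sub>v u3_star G P xb j i t \<omega>)) + cE G t *\<^sub>v v_star G P xb t \<omega>) $ k =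
    (cA G t *\<^sub>v ?x) $ k + sum2 (\<lambda>i. (cB1 G i t *\<^sub>v u1_star G P xb i t \<omega>) $ k)
      + sum2 (\<lambda>i. sum3 (\<lambda>j. (cB2 G i j t *\<^sub>v u2_star G P xb i j t \<omega>) $ k))
      + sum3 (\<lambda>j. sum2 (\<lambda>i. (cB3 G j i t *\<^sub>v u3_star G P xb j i t \<omega>) $ k))
      + (cE G t *\<^sub>v v_star G P xb t \<omega>) $ k"
    using k A E
    by (simp add: carrier_matD(1)[OF B1(1)] carrier_matD(1)[OF B2(1)] carrier_matD(1)[OF B2(2)] del: index_mult_mat_vec)
  show ?thesis
    unfolding L R split[OF z] split[OF minus_carrier_vec[OF z x]] minus[OF A] minus[OF smult_carrier_mat[OF Ec]] Ev
    using pl[of 1] pl[of 2] by simp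
qed

text \<open>As for the drift, but simpler: the disturbance does not enter the diffusion.\<close>

lemma diffusion_identity:
  fixes xb :: "'w vproc"
  assumes t: "t \<in> {0..T}" and x: "xb t \<omega> \<in> carrier_vec n" and z: "z \<in> carrier_vec n" and k: "k < n"
  shows "(C_bar G P \<eta> \<zeta> t *\<^sub>v z + sum2 (\<lambda>i. Dc_bar G \<eta> \<zeta> i t *\<^sub>v uc_star G P xb i t \<omega>)) $ k =
    (cC G t *\<^sub>v xb t \<omega> + sum2 (\<lambda>i. cD1 G i t *\<^sub>v u1_star G P xb i t \<omega>)
      + sum2 (\<lambda>i. sum3 (\<lambda>j. cD2 G i j t *\<^sub>v u2_star G P xb i j t \<omega>))
      + sum3 (\<lambda>j. sum2 (\<lambda>i. cD3 G j i t *\<^sub>v u3_star G P xb j i t \<omega>))) $ k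
    + (C_bar G P \<eta> \<zeta> t *\<^sub>v (z - xb t \<omega>)) $ k"
proof -
  let ?x = "xb t \<omega>" and ?D = "\<lambda>i. cD1 G i t * xi G P \<eta> \<zeta> i t"
  note C = bounded_coeffD(1)[OF basic_bounded(2) t]
  have D1: "cD1 G i t \<in> carrier_mat n (dim1 G i)" "?D i \<in> carrier_mat n n"
    "Dc_bar G \<eta> \<zeta> i t \<in> carrier_mat n (dim_c G i)" if "i \<in> {1, 2}" for i
    using bounded_coeffD(1)[OF level1_bounded(2)[OF that] t] bounded_coeffD(1)[OF xi_bounded[OF that] t]
      bounded_coeffD(1)[OF Nmat_bounded[OF that] t]
    unfolding Dc_bar_def by (auto intro: mult_carrier_mat add_carrier_mat)
  have D2: "cD2 G i j t \<in> carrier_mat n (dim2 G i j)" "cD3 G j i t \<in> carrier_mat n (dim3 G j i)"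
    if "i \<in> {1, 2}" "j \<in> {1, 2, 3}" for i j
    using bounded_coeffD(1)[OF level23_bounded(2)[OF that] t] bounded_coeffD(1)[OF level23_bounded(4)[OF that] t]
    by auto
  have split: "(C_bar G P \<eta> \<zeta> t *\<^sub>v w) $ k = (cC G t *\<^sub>v w) $ k + ((?D 1 *\<^sub>v w) $ k + (?D 2 *\<^sub>v w) $ k)"
    if w: "w \<in> carrier_vec n" for w
  proof -
    have b: "?D 1 \<in> carrier_mat n n" "?D 2 \<in> carrier_mat n n" using D1(2) by simp_all
    have "C_bar G P \<eta> \<zeta> t *\<^sub>v w = cC G t *\<^sub>v w + (?D 1 *\<^sub>v w + ?D 2 *\<^sub>v w)"
      unfolding C_bar_def add_mult_distrib_mat_vec[OF C add_carrier_mat[OF b(2)] w]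
        add_mult_distrib_mat_vec[OF b w] ..
    then show ?thesis using k C b D1(1)[of 1] D1(1)[of 2] by (simp del: index_mult_mat_vec)
  qed
  have minus: "(cC G t *\<^sub>v (z - ?x)) $ k = (cC G t *\<^sub>v z) $ k - (cC G t *\<^sub>v ?x) $ k"
    unfolding mult_minus_distrib_mat_vec[OF C z x] using C k by (simp del: index_mult_mat_vec)
  have pl: "(?D i *\<^sub>v z) $ k + (Dc_bar G \<eta> \<zeta> i t *\<^sub>v uc_star G P xb i t \<omega>) $ k =
      (?D i *\<^sub>v (z - ?x)) $ k + (cD1 G i t *\<^sub>v u1_star G P xb i t \<omega>) $ k
      + sum3 (\<lambda>j. (cD2 G i j t *\<^sub>v u2_star G P xb i j t \<omega>) $ k)
      + sum3 (\<lambda>j. (cD3 G j i t *\<^sub>v u3_star G P xb j i t \<omega>) $ k)" if "i \<in> {1, 2}" for i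
    unfolding Dc_bar_def
    by (rule player_identity[where xb = xb and t = t and \<omega> = \<omega> and Y = "\<lambda>i j. cD2 G i j t"
          and Z = "\<lambda>j i. cD3 G j i t", OF that t x z D1(1)[OF that] _ _ k])
       (rule D2(1)[OF that] D2(2)[OF that], assumption)+
  have L: "(C_bar G P \<eta> \<zeta> t *\<^sub>v z + sum2 (\<lambda>i. Dc_bar G \<eta> \<zeta> i t *\<^sub>v uc_star G P xb i t \<omega>)) $ k =
      (C_bar G P \<eta> \<zeta> t *\<^sub>v z) $ k + sum2 (\<lambda>i. (Dc_bar G \<eta> \<zeta> i t *\<^sub>v uc_star G P xb i t \<omega>) $ k)"
    using k D1(3)[of 1] D1(3)[of 2] by (simp del: index_mult_mat_vec)
  have R: "(cC G t *\<^sub>v ?x + sum2 (\<lambda>i. cD1 G i t *\<^sub>v u1_star G P xb i t \<omega>)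
      + sum2 (\<lambda>i. sum3 (\<lambda>j. cD2 G i j t *\<^sub>v u2_star G P xb i j t \<omega>))
      + sum3 (\<lambda>j. sum2 (\<lambda>i. cD3 G j i t *\<^sub>v u3_star G P xb j i t \<omega>))) $ k =
    (cC G t *\<^sub>v ?x) $ k + sum2 (\<lambda>i. (cD1 G i t *\<^sub>v u1_star G P xb i t \<omega>) $ k)
      + sum2 (\<lambda>i. sum3 (\<lambda>j. (cD2 G i j t *\<^sub>v u2_star G P xb i j t \<omega>) $ k))
      + sum3 (\<lambda>j. sum2 (\<lambda>i. (cD3 G j i t *\<^sub>v u3_star G P xb j i t \<omega>) $ k))"
    using k C
    by (simp add: carrier_matD(1)[OF D1(1)] carrier_matD(1)[OF D2(1)] carrier_matD(1)[OF D2(2)] del: index_mult_mat_vec)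
  show ?thesis
    unfolding L R split[OF z] split[OF minus_carrier_vec[OF z x]] minus
    using pl[of 1] pl[of 2] by simp
qed

end

text \<open>Cauchy-Schwarz with one constant for all rows and times: \<open>L\<close> sums the
  squares of the entrywise bounds and so dominates the squared Frobenius norm.\<close>

lemma bounded_coeff_lipschitz:
  assumes X: "bounded_coeff T r c X"
  obtains L where "0 \<le> L"
    "\<And>t y k. t \<in> {0..T} \<Longrightarrow> y \<in> carrier_vec c \<Longrightarrow> k < r \<Longrightarrow> ((X t *\<^sub>v y) $ k)\<^sup>2 \<le> L * (\<Sum>l<c. (y $ l)\<^sup>2)"
proof -
  have "\<forall>a b. \<exists>K. a < r \<longrightarrow> b < c \<longrightarrow> (\<forall>t\<in>{0..T}. \<bar>X t $$ (a, b)\<bar> \<le> K)"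
    using X unfolding bounded_coeff_def by blast
  then obtain K where K: "\<And>a b t. a < r \<Longrightarrow> b < c \<Longrightarrow> t \<in> {0..T} \<Longrightarrow> \<bar>X t $$ (a, b)\<bar> \<le> K a b"
    by metis
  define L where "L = (\<Sum>a<r. \<Sum>b<c. (K a b)\<^sup>2)"
  show thesis
  proof (rule that[of L])
    show "0 \<le> L" unfolding L_def by (intro sum_nonneg zero_le_power2)
    fix t k and y :: "real vec" assume t: "t \<in> {0..T}" and y: "y \<in> carrier_vec c" and k: "k < r"
    have "(X t *\<^sub>v y) $ k = (\<Sum>l<c. X t $$ (k, l) * y $ l)"
      using bounded_coeffD(1)[OF X t] y k by (simp add: scalar_prod_def atLeast0LessThan)
    then have "((X t *\<^sub>v y) $ k)\<^sup>2 \<le> (\<Sum>l<c. (X t $$ (k, l))\<^sup>2) * (\<Sum>l<c. (y $ l)\<^sup>2)"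
      by (simp only: Cauchy_Schwarz_ineq_sum)
    also have "\<dots> \<le> L * (\<Sum>l<c. (y $ l)\<^sup>2)"
    proof (rule mult_right_mono)
    have "(\<Sum>l<c. (X t $$ (k, l))\<^sup>2) \<le> (\<Sum>l<c. (K k l)\<^sup>2)"
    proof (rule sum_mono)
      fix l assume "l \<in> {..<c}"
      then have "\<bar>X t $$ (k, l)\<bar> \<le> \<bar>K k l\<bar>" using K[OF k _ t, of l] by force
      then show "(X t $$ (k, l))\<^sup>2 \<le> (K k l)\<^sup>2" by (simp only: abs_le_square_iff)
    qed
    also have "(\<Sum>l<c. (K k l)\<^sup>2) \<le> L"
      unfolding L_def by (rule member_le_sum[where f = "\<lambda>a. \<Sum>b<c. (K a b)\<^sup>2"]) (use k in \<open>auto intro: sum_nonneg\<close>)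
    finally show "(\<Sum>l<c. (X t $$ (k, l))\<^sup>2) \<le> L" .
    qed (simp add: sum_nonneg)
    finally show "((X t *\<^sub>v y) $ k)\<^sup>2 \<le> L * (\<Sum>l<c. (y $ l)\<^sup>2)" .
  qed
qed

subsection \<open>The Ito isometry\<close>

locale brownian_filtration = prob_space M for M :: "'w measure" +
  fixes F :: "real \<Rightarrow> 'w measure" and T :: real and W :: "real \<Rightarrow> 'w \<Rightarrow> real"
  assumes filtration: "F = augmented_filtration M W"
    and brownian: "brownian_motion M F T W"
begin

lemma W_measurable: "0 \<le> t \<Longrightarrow> t \<le> T \<Longrightarrow> W t \<in> borel_measurable M"
  using brownian by (auto simp: brownian_motion_def)

lemma W_adapted: "0 \<le> t \<Longrightarrow> t \<le> T \<Longrightarrow> W t \<in> borel_measurable (F t)"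
  using brownian by (auto simp: brownian_motion_def)

lemma generator_subset:
  "{W s -` B \<inter> space M | s B. 0 \<le> s \<and> s \<le> t \<and> B \<in> sets borel} \<union> null_sets M \<subseteq> Pow (space M)"
  using sets.sets_into_space by (auto simp: null_sets_def)

lemma space_F [simp]: "space (F t) = space M"
  unfolding filtration augmented_filtration_def using generator_subset by (rule space_measure_of)

lemma sets_F: "sets (F t) = sigma_sets (space M)
    ({W s -` B \<inter> space M | s B. 0 \<le> s \<and> s \<le> t \<and> B \<in> sets borel} \<union> null_sets M)"
  unfolding filtration augmented_filtration_def using generator_subset by (rule sets_measure_of)

text \<open>The generators involve \<open>W s\<close> up to time \<open>t\<close>, and measurability
  of \<open>W s\<close> is known within the horizon only.\<close>

lemma subalgebra_F: "t \<le> T \<Longrightarrow> subalgebra M (F t)"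
  unfolding subalgebra_def sets_F
  by (auto intro!: sets.sigma_sets_subset measurable_sets[OF W_measurable])

lemma subalgebra_F_mono: "s \<le> t \<Longrightarrow> subalgebra (F t) (F s)"
  unfolding subalgebra_def sets_F space_F
  by (intro conjI refl sigma_sets_mono' Un_mono order_refl) (blast intro: order_trans)

lemma measurable_F: "t \<le> T \<Longrightarrow> f \<in> borel_measurable (F t) \<Longrightarrow> f \<in> borel_measurable M"
  using measurable_from_subalg subalgebra_F by blast

lemma measurable_F_mono: "s \<le> t \<Longrightarrow> f \<in> borel_measurable (F s) \<Longrightarrow> f \<in> borel_measurable (F t)"
  using measurable_from_subalg subalgebra_F_mono by blast

definition inc :: "real \<Rightarrow> real \<Rightarrow> 'w \<Rightarrow> real" where
  "inc s t \<omega> = W t \<omega> - W s \<omega>"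

lemma inc_adapted:
  "0 \<le> r \<Longrightarrow> r \<le> s \<Longrightarrow> s \<le> T \<Longrightarrow> 0 \<le> q \<Longrightarrow> q \<le> s \<Longrightarrow> inc r q \<in> borel_measurable (F s)"
  unfolding inc_def
  by (intro borel_measurable_diff) (metis W_adapted measurable_F_mono order_trans)+

text \<open>The increment is independent of the whole sigma-algebra at time \<open>s\<close>, hence
  of the smaller one generated by \<open>X\<close>.\<close>

lemma inc_indep:
  assumes st: "0 \<le> s" "s < t" "t \<le> T" and X: "X \<in> borel_measurable (F s)"
  shows "indep_var borel X borel (inc s t)"
  unfolding indep_var_eq
proof (intro conjI)
  show "random_variable borel X" using measurable_F[OF _ X] st by auto
  show "random_variable borel (inc s t)"
    unfolding inc_def using st by (intro borel_measurable_diff W_measurable) auto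
  have 1: "indep_set (sets (F s)) (sets (vimage_algebra (space M) (\<lambda>\<omega>. W t \<omega> - W s \<omega>) borel))"
    using brownian st by (auto simp: brownian_motion_def)
  have "sigma_sets (space M) {X -` A \<inter> space M |A. A \<in> sets borel} \<subseteq> sets (F s)"
    using sets.sigma_sets_subset[of "{X -` A \<inter> space M |A. A \<in> sets borel}" "F s"] measurable_sets[OF X]
    by auto
  then show "indep_set (sigma_sets (space M) {X -` A \<inter> space M |A. A \<in> sets borel})
     (sigma_sets (space M) {inc s t -` A \<inter> space M |A. A \<in> sets borel})"
    using 1 unfolding sets_vimage_algebra inc_def indep_sets2_eq by auto
qed

text \<open>The Gaussian law enters the isometry only through these moments.\<close>

lemma inc_moments:
  assumes st: "0 \<le> s" "s < t" "t \<le> T"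
  shows "integrable M (inc s t)" "(\<integral>\<omega>. inc s t \<omega> \<partial>M) = 0"
    "integrable M (\<lambda>\<omega>. (inc s t \<omega>)\<^sup>2)" "(\<integral>\<omega>. (inc s t \<omega>)\<^sup>2 \<partial>M) = t - s"
proof -
  have D: "distributed M lborel (inc s t) (\<lambda>y. ennreal (normal_density 0 (sqrt (t - s)) y))"
    using brownian st by (auto simp: brownian_motion_def inc_def[abs_def])
  show 0: "(\<integral>\<omega>. inc s t \<omega> \<partial>M) = 0"
    using normal_distributed_expectation[OF _ D] st by simp
  show "(\<integral>\<omega>. (inc s t \<omega>)\<^sup>2 \<partial>M) = t - s"
    using normal_distributed_variance[OF _ D] st unfolding 0 by simp
  show "integrable M (inc s t)"
    using distributed_integrable[OF D, of "\<lambda>x. x"] integrable_normal_moment[of "sqrt (t - s)" 0 1] st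
    by simp
  show "integrable M (\<lambda>\<omega>. (inc s t \<omega>)\<^sup>2)"
    using distributed_integrable[OF D, of "\<lambda>x. x\<^sup>2"] integrable_normal_moment[of "sqrt (t - s)" 0 2] st
    by simp
qed

lemma inc_linear:
  assumes st: "0 \<le> s" "s \<le> t" "t \<le> T" and X: "X \<in> borel_measurable (F s)" "integrable M X"
  shows "integrable M (\<lambda>\<omega>. X \<omega> * inc s t \<omega>)" "(\<integral>\<omega>. X \<omega> * inc s t \<omega> \<partial>M) = 0"
proof -
  have "integrable M (\<lambda>\<omega>. X \<omega> * inc s t \<omega>) \<and> (\<integral>\<omega>. X \<omega> * inc s t \<omega> \<partial>M) = 0"
  proof (cases "s = t")
    case False
    then have lt: "s < t" using st by simp
    note I = inc_indep[OF st(1) lt st(3) X(1)]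
    show ?thesis
      using indep_var_integrable[OF I X(2)] indep_var_lebesgue_integral[OF I X(2)]
        inc_moments[OF st(1) lt st(3)] by simp
  qed (simp add: inc_def)
  then show "integrable M (\<lambda>\<omega>. X \<omega> * inc s t \<omega>)" "(\<integral>\<omega>. X \<omega> * inc s t \<omega> \<partial>M) = 0" by auto
qed

lemma inc_quadratic:
  assumes st: "0 \<le> s" "s \<le> t" "t \<le> T" and X: "X \<in> borel_measurable (F s)" "integrable M X"
  shows "integrable M (\<lambda>\<omega>. X \<omega> * (inc s t \<omega>)\<^sup>2)"
    "(\<integral>\<omega>. X \<omega> * (inc s t \<omega>)\<^sup>2 \<partial>M) = (\<integral>\<omega>. X \<omega> \<partial>M) * (t - s)"
proof -
  have "integrable M (\<lambda>\<omega>. X \<omega> * (inc s t \<omega>)\<^sup>2) \<and>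
    (\<integral>\<omega>. X \<omega> * (inc s t \<omega>)\<^sup>2 \<partial>M) = (\<integral>\<omega>. X \<omega> \<partial>M) * (t - s)"
  proof (cases "s = t")
    case False
    then have lt: "s < t" using st by simp
    have "indep_var borel ((\<lambda>x. x) \<circ> X) borel ((\<lambda>x. x\<^sup>2) \<circ> inc s t)"
      by (rule indep_var_compose[OF inc_indep[OF st(1) lt st(3) X(1)]]) auto
    then have I: "indep_var borel X borel (\<lambda>\<omega>. (inc s t \<omega>)\<^sup>2)" by (simp add: comp_def)
    show ?thesis
      using indep_var_integrable[OF I X(2)] indep_var_lebesgue_integral[OF I X(2)]
        inc_moments[OF st(1) lt st(3)] by simp
  qed (simp add: inc_def)
  then show "integrable M (\<lambda>\<omega>. X \<omega> * (inc s t \<omega>)\<^sup>2)"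
    "(\<integral>\<omega>. X \<omega> * (inc s t \<omega>)\<^sup>2 \<partial>M) = (\<integral>\<omega>. X \<omega> \<partial>M) * (t - s)" by auto
qed

section \<open>Covariances of weighted increments\<close>

definition bdd_adapted :: "real \<Rightarrow> ('w \<Rightarrow> real) \<Rightarrow> bool" where
  "bdd_adapted t X \<longleftrightarrow> X \<in> borel_measurable (F t) \<and> (\<exists>c. \<forall>\<omega>\<in>space M. \<bar>X \<omega>\<bar> \<le> c)"

lemma bdd_adapted_mono: "bdd_adapted s X \<Longrightarrow> s \<le> t \<Longrightarrow> bdd_adapted t X"
  unfolding bdd_adapted_def using measurable_F_mono by blast

lemma bdd_adapted_mult:
  assumes X: "bdd_adapted t X" and Y: "bdd_adapted t Y"
  shows "bdd_adapted t (\<lambda>\<omega>. X \<omega> * Y \<omega>)"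
proof -
  obtain c d where "\<forall>\<omega>\<in>space M. \<bar>X \<omega>\<bar> \<le> c" "\<forall>\<omega>\<in>space M. \<bar>Y \<omega>\<bar> \<le> d"
    using X Y unfolding bdd_adapted_def by blast
  then have "\<forall>\<omega>\<in>space M. \<bar>X \<omega> * Y \<omega>\<bar> \<le> c * d"
    by (auto simp: abs_mult intro!: mult_mono')
  moreover have "(\<lambda>\<omega>. X \<omega> * Y \<omega>) \<in> borel_measurable (F t)"
    using X Y unfolding bdd_adapted_def by (intro borel_measurable_times) blast+
  ultimately show ?thesis unfolding bdd_adapted_def by blast
qed

lemma bdd_adapted_measurable: "bdd_adapted t X \<Longrightarrow> X \<in> borel_measurable (F t)"
  by (simp add: bdd_adapted_def)

lemma bdd_adapted_integrable_mult:
  assumes X: "bdd_adapted t X" "t \<le> T" and Y: "integrable M Y"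
  shows "integrable M (\<lambda>\<omega>. X \<omega> * Y \<omega>)"
proof -
  obtain c where c: "\<forall>\<omega>\<in>space M. \<bar>X \<omega>\<bar> \<le> c" using X unfolding bdd_adapted_def by blast
  show ?thesis
  proof (rule Bochner_Integration.integrable_bound[of _ "\<lambda>\<omega>. c * Y \<omega>"])
    show "(\<lambda>\<omega>. X \<omega> * Y \<omega>) \<in> borel_measurable M"
      using measurable_F[OF X(2) bdd_adapted_measurable[OF X(1)]] Y by simp
    show "AE \<omega> in M. norm (X \<omega> * Y \<omega>) \<le> norm (c * Y \<omega>)"
    proof (rule AE_I2)
      fix \<omega> assume "\<omega> \<in> space M"
      then have "\<bar>X \<omega>\<bar> \<le> \<bar>c\<bar>" using c by force
      then show "norm (X \<omega> * Y \<omega>) \<le> norm (c * Y \<omega>)" by (simp add: abs_mult mult_right_mono)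
    qed
  qed (use Y in simp)
qed

lemma bdd_adapted_integrable: "bdd_adapted t X \<Longrightarrow> t \<le> T \<Longrightarrow> integrable M X"
  using bdd_adapted_integrable_mult[of t X "\<lambda>_. 1"] by simp

text \<open>Assuming that the first interval starts no later, \<open>X \<omega> * Y \<omega>\<close>
  is adapted at time \<open>c\<close>. The product of the two increments is expanded into products
  of increments over disjoint intervals and one square over the overlap. The former have mean zero,
  and the square contributes the length of the overlap, which is the \<open>max 0\<close>
  factor.\<close>

lemma inc_covariance_aux:
  assumes ab: "0 \<le> a" "a \<le> b" "b \<le> T" and cd: "0 \<le> c" "c \<le> d" "d \<le> T" and ac: "a \<le> c"
    and X: "bdd_adapted a X" and Y: "bdd_adapted c Y"
  shows "integrable M (\<lambda>\<omega>. (X \<omega> * inc a b \<omega>) * (Y \<omega> * inc c d \<omega>)) \<and>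
    (\<integral>\<omega>. (X \<omega> * inc a b \<omega>) * (Y \<omega> * inc c d \<omega>) \<partial>M)
      = (\<integral>\<omega>. X \<omega> * Y \<omega> \<partial>M) * max 0 (min b d - max a c)"
proof -
  define Z where "Z \<omega> = X \<omega> * Y \<omega>" for \<omega>
  have Z: "bdd_adapted c Z"
    unfolding Z_def[abs_def] using bdd_adapted_mono[OF X ac] Y by (rule bdd_adapted_mult)
  have Zi: "integrable M Z" using bdd_adapted_integrable[OF Z] cd by simp
  \<comment> \<open>The last increment starts after everything else in the product has been
    revealed, so the expectation vanishes.\<close>
  have part: "integrable M (\<lambda>\<omega>. (Z \<omega> * inc r q \<omega>) * inc s t \<omega>) \<and>
      (\<integral>\<omega>. (Z \<omega> * inc r q \<omega>) * inc s t \<omega> \<partial>M) = 0"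
    if "0 \<le> r" "r \<le> q" "q \<le> s" "s \<le> t" "t \<le> T" "c \<le> s" for r q s t
  proof -
    have le: "q \<le> T" "s \<le> T" "0 \<le> q" using that by linarith+
    have "integrable M (\<lambda>\<omega>. 1 * inc r q \<omega>)"
      by (rule inc_linear(1)[OF that(1,2) le(1)]) simp_all
    then have q: "integrable M (inc r q)" by simp
    have m: "inc r q \<in> borel_measurable (F s)"
      using that le by (intro inc_adapted) linarith+
    have Zm: "Z \<in> borel_measurable (F s)"
      by (rule bdd_adapted_measurable[OF bdd_adapted_mono[OF Z that(6)]])
    have 1: "(\<lambda>\<omega>. Z \<omega> * inc r q \<omega>) \<in> borel_measurable (F s)"
      by (rule borel_measurable_times[OF Zm m])
    have 2: "integrable M (\<lambda>\<omega>. Z \<omega> * inc r q \<omega>)"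
      by (rule bdd_adapted_integrable_mult[OF Z _ q]) (use cd in linarith)
    have 3: "0 \<le> s" using cd that by linarith
    show ?thesis using inc_linear[OF 3 that(4,5) 1 2] by blast
  qed
  have sq: "integrable M (\<lambda>\<omega>. Z \<omega> * (inc c t \<omega>)\<^sup>2) \<and>
      (\<integral>\<omega>. Z \<omega> * (inc c t \<omega>)\<^sup>2 \<partial>M) = (\<integral>\<omega>. Z \<omega> \<partial>M) * (t - c)" if "c \<le> t" "t \<le> T" for t
    using inc_quadratic[OF cd(1) that bdd_adapted_measurable[OF Z] Zi] by blast
  have *: "integrable M (\<lambda>\<omega>. Z \<omega> * inc a b \<omega> * inc c d \<omega>) \<and>
    (\<integral>\<omega>. Z \<omega> * inc a b \<omega> * inc c d \<omega> \<partial>M) = (\<integral>\<omega>. Z \<omega> \<partial>M) * max 0 (min b d - max a c)"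
  proof (cases "b \<le> c")
    case True
    have "max 0 (min b d - max a c) = 0" using True ac cd by linarith
    then show ?thesis using part[OF ab(1,2) True cd(2,3) order_refl] by (simp only: mult_zero_right)
  next
    case bc: False
    then have cb: "c \<le> b" by simp
    show ?thesis
    proof (cases "b \<le> d")
      case True
      \<comment> \<open>With c \<le> b \<le> d, the second interval is split at \<open>b\<close>
        and, in the product with its part before \<open>b\<close>, the first one is split at
        \<open>c\<close>.\<close>
      have eq: "(\<lambda>\<omega>. Z \<omega> * inc a b \<omega> * inc c d \<omega>) =
        (\<lambda>\<omega>. Z \<omega> * inc a b \<omega> * inc b d \<omega> + Z \<omega> * inc a c \<omega> * inc c b \<omega> + Z \<omega> * (inc c b \<omega>)\<^sup>2)"
        by (rule ext) (simp add: inc_def algebra_simps power2_eq_square)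
      have m: "max 0 (min b d - max a c) = b - c" using True ac cb by linarith
      note 1 = part[OF ab(1,2) order_refl True cd(3) cb] part[OF ab(1) ac order_refl cb ab(3) order_refl] sq[OF cb ab(3)]
      show ?thesis unfolding eq m using 1 by simp
    next
      case False
      then have db: "d \<le> b" by simp
      \<comment> \<open>With d \<le> b, the second interval lies inside the first, which is split at
        \<open>c\<close> and at \<open>d\<close>.\<close>
      have eq: "(\<lambda>\<omega>. Z \<omega> * inc a b \<omega> * inc c d \<omega>) =
        (\<lambda>\<omega>. Z \<omega> * inc a c \<omega> * inc c d \<omega> + Z \<omega> * inc c d \<omega> * inc d b \<omega> + Z \<omega> * (inc c d \<omega>)\<^sup>2)"
        by (rule ext) (simp add: inc_def algebra_simps power2_eq_square)
      have m: "max 0 (min b d - max a c) = d - c" using db ac cd by linarith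
      note 1 = part[OF ab(1) ac order_refl cd(2,3) order_refl] part[OF cd(1,2) order_refl db ab(3) cd(2)] sq[OF cd(2,3)]
      show ?thesis unfolding eq m using 1 by simp
    qed
  qed
  have eq: "(\<lambda>\<omega>. (X \<omega> * inc a b \<omega>) * (Y \<omega> * inc c d \<omega>)) = (\<lambda>\<omega>. Z \<omega> * inc a b \<omega> * inc c d \<omega>)"
    by (rule ext) (simp add: Z_def)
  show ?thesis using * unfolding eq by (simp only: Z_def)
qed

lemma inc_covariance:
  assumes ab: "0 \<le> a" "a \<le> b" "b \<le> T" and cd: "0 \<le> c" "c \<le> d" "d \<le> T"
    and X: "bdd_adapted a X" and Y: "bdd_adapted c Y"
  shows "integrable M (\<lambda>\<omega>. (X \<omega> * inc a b \<omega>) * (Y \<omega> * inc c d \<omega>)) \<and>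
    (\<integral>\<omega>. (X \<omega> * inc a b \<omega>) * (Y \<omega> * inc c d \<omega>) \<partial>M)
      = (\<integral>\<omega>. X \<omega> * Y \<omega> \<partial>M) * max 0 (min b d - max a c)"
proof (cases "a \<le> c")
  case True then show ?thesis using inc_covariance_aux assms by blast
next
  case False
  then show ?thesis
    using inc_covariance_aux[OF cd ab _ Y X] by (simp add: mult.commute min.commute max.commute)
qed

text \<open>Stating the isometry for arbitrary finite families of intervals avoids a common refinement
  of two partitions: the difference of two simple processes is again of this form.\<close>

lemma isometry:
  fixes X :: "'k \<Rightarrow> 'w \<Rightarrow> real"
  assumes K: "finite K"
    and ab: "\<And>k. k \<in> K \<Longrightarrow> 0 \<le> a k \<and> a k \<le> b k \<and> b k \<le> T \<and> bdd_adapted (a k) (X k)"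
  shows "(\<integral>\<^sup>+\<omega>. ennreal ((\<Sum>k\<in>K. X k \<omega> * inc (a k) (b k) \<omega>)\<^sup>2) \<partial>M) =
    (\<integral>\<^sup>+\<omega>. (\<integral>\<^sup>+s. ennreal ((\<Sum>k\<in>K. X k \<omega> * indicator {a k<..b k} s)\<^sup>2) \<partial>lborel) \<partial>M)"
proof -
  \<comment> \<open>\<open>L k l\<close> is the length of the overlap of two intervals. It is both
    the time integral of the product of their indicators and the covariance factor of their
    increments, so both sides of the isometry reduce to the expectation of the quadratic form
    \<open>Q\<close>.\<close>
  define L where "L k l = max 0 (min (b k) (b l) - max (a k) (a l))" for k l
  define Q where "Q \<omega> = (\<Sum>k\<in>K. \<Sum>l\<in>K. X k \<omega> * X l \<omega> * L k l)" for \<omega>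
  have int: "integrable lborel (\<lambda>s. X k \<omega> * indicator {a k<..b k} s * (X l \<omega> * indicator {a l<..b l} s)) \<and>
      (\<integral>s. X k \<omega> * indicator {a k<..b k} s * (X l \<omega> * indicator {a l<..b l} s) \<partial>lborel) = X k \<omega> * X l \<omega> * L k l"
    for k l \<omega>
  proof -
    have "(\<lambda>s. X k \<omega> * indicator {a k<..b k} s * (X l \<omega> * indicator {a l<..b l} s)) =
        (\<lambda>s. X k \<omega> * X l \<omega> * indicator {max (a k) (a l)<..min (b k) (b l)} s)"
      by (auto simp: indicator_def fun_eq_iff)
    moreover have "measure lborel {p<..q} = max 0 (q - p) \<and> emeasure lborel {p<..q} < \<infinity>" for p q :: real
      by (cases "p \<le> q") simp_all
    ultimately show ?thesis unfolding L_def by (simp add: less_top)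
  qed
  have in1: "(\<integral>\<^sup>+s. ennreal ((\<Sum>k\<in>K. X k \<omega> * indicator {a k<..b k} s)\<^sup>2) \<partial>lborel) = ennreal (Q \<omega>)" for \<omega>
  proof -
    have i: "integrable lborel (\<lambda>s. \<Sum>k\<in>K. \<Sum>l\<in>K. X k \<omega> * indicator {a k<..b k} s * (X l \<omega> * indicator {a l<..b l} s))"
      using int by auto
    have eq: "(\<lambda>s. (\<Sum>k\<in>K. X k \<omega> * indicator {a k<..b k} s)\<^sup>2) =
        (\<lambda>s. \<Sum>k\<in>K. \<Sum>l\<in>K. X k \<omega> * indicator {a k<..b k} s * (X l \<omega> * indicator {a l<..b l} s))"
      by (auto simp: power2_eq_square sum_product)
    have "(\<integral>\<^sup>+s. ennreal ((\<Sum>k\<in>K. X k \<omega> * indicator {a k<..b k} s)\<^sup>2) \<partial>lborel) =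
        ennreal (\<integral>s. (\<Sum>k\<in>K. X k \<omega> * indicator {a k<..b k} s)\<^sup>2 \<partial>lborel)"
      by (rule nn_integral_eq_integral) (use i eq in auto)
    also have "(\<integral>s. (\<Sum>k\<in>K. X k \<omega> * indicator {a k<..b k} s)\<^sup>2 \<partial>lborel) = Q \<omega>"
      unfolding eq Q_def using int by (simp add: Bochner_Integration.integral_sum)
    finally show ?thesis .
  qed
  \<comment> \<open>Nonnegativity allows the passage between the real and the extended integral of
    \<open>Q\<close>; it holds because \<open>Q\<close> is the integral of a square.\<close>
  have Qnn: "0 \<le> Q \<omega>" for \<omega>
  proof -
    have "Q \<omega> = (\<integral>s. (\<Sum>k\<in>K. X k \<omega> * indicator {a k<..b k} s)\<^sup>2 \<partial>lborel)"
      unfolding Q_def power2_eq_square sum_product using int by (simp add: Bochner_Integration.integral_sum)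
    then show ?thesis by simp
  qed
  have cov: "integrable M (\<lambda>\<omega>. X k \<omega> * inc (a k) (b k) \<omega> * (X l \<omega> * inc (a l) (b l) \<omega>)) \<and>
     (\<integral>\<omega>. X k \<omega> * inc (a k) (b k) \<omega> * (X l \<omega> * inc (a l) (b l) \<omega>) \<partial>M) = (\<integral>\<omega>. X k \<omega> * X l \<omega> \<partial>M) * L k l"
    if "k \<in> K" "l \<in> K" for k l
    unfolding L_def using ab[OF that(1)] ab[OF that(2)] by (intro inc_covariance) auto
  have XX: "integrable M (\<lambda>\<omega>. X k \<omega> * X l \<omega>)" if "k \<in> K" "l \<in> K" for k l
    using ab[OF that(1)] ab[OF that(2)]
    by (intro bdd_adapted_integrable_mult[of "a k"] bdd_adapted_integrable[of "a l"]) auto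
  have eq: "(\<lambda>\<omega>. (\<Sum>k\<in>K. X k \<omega> * inc (a k) (b k) \<omega>)\<^sup>2) =
      (\<lambda>\<omega>. \<Sum>k\<in>K. \<Sum>l\<in>K. X k \<omega> * inc (a k) (b k) \<omega> * (X l \<omega> * inc (a l) (b l) \<omega>))"
    by (auto simp: power2_eq_square sum_product)
  have i2: "integrable M (\<lambda>\<omega>. (\<Sum>k\<in>K. X k \<omega> * inc (a k) (b k) \<omega>)\<^sup>2)"
    unfolding eq using cov by auto
  have "(\<integral>\<^sup>+\<omega>. ennreal ((\<Sum>k\<in>K. X k \<omega> * inc (a k) (b k) \<omega>)\<^sup>2) \<partial>M) =
      ennreal (\<integral>\<omega>. (\<Sum>k\<in>K. X k \<omega> * inc (a k) (b k) \<omega>)\<^sup>2 \<partial>M)"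
    by (rule nn_integral_eq_integral) (use i2 in auto)
  also have "(\<integral>\<omega>. (\<Sum>k\<in>K. X k \<omega> * inc (a k) (b k) \<omega>)\<^sup>2 \<partial>M) = (\<Sum>k\<in>K. \<Sum>l\<in>K. (\<integral>\<omega>. X k \<omega> * X l \<omega> \<partial>M) * L k l)"
    unfolding eq using cov by (simp add: Bochner_Integration.integral_sum)
  also have "\<dots> = (\<integral>\<omega>. Q \<omega> \<partial>M)"
    unfolding Q_def using XX by (simp add: Bochner_Integration.integral_sum)
  also have "ennreal \<dots> = (\<integral>\<^sup>+\<omega>. ennreal (Q \<omega>) \<partial>M)"
    by (rule nn_integral_eq_integral[symmetric]) (use XX Qnn in \<open>auto simp: Q_def\<close>)
  finally show ?thesis by (simp add: in1)
qed

section \<open>Integrals of simple processes\<close>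

lemma simple_process_times:
  assumes S: "simple_process M F T N \<tau> \<xi>" and k: "k \<le> N"
  shows "0 \<le> \<tau> k" "\<tau> k \<le> T"
proof -
  have step: "\<tau> k < \<tau> (Suc k)" if "k < N" for k using S that unfolding simple_process_def by blast
  have "\<tau> 0 \<le> \<tau> k" using k
  proof (induction k)
    case (Suc k)
    then show ?case using step[of k] by simp
  qed simp
  then show "0 \<le> \<tau> k" using S unfolding simple_process_def by simp
  have "\<tau> k \<le> \<tau> N" using k
  proof (induction k rule: inc_induct)
    case (step m)
    have "\<tau> m < \<tau> (Suc m)" using S step(2) unfolding simple_process_def by blast
    then show ?case using step.IH by simp
  qed simp
  then show "\<tau> k \<le> T" using S unfolding simple_process_def by simp
qed

lemma simple_process_bdd: "simple_process M F T N \<tau> \<xi> \<Longrightarrow> k < N \<Longrightarrow> bdd_adapted (\<tau> k) (\<xi> k)"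
  unfolding simple_process_def bdd_adapted_def by blast

lemma bdd_adapted_scale: "bdd_adapted t X \<Longrightarrow> bdd_adapted t (\<lambda>\<omega>. c * X \<omega>)"
proof (rule bdd_adapted_mult)
  show "bdd_adapted t (\<lambda>\<omega>. c)" unfolding bdd_adapted_def by auto
qed

text \<open>Instance of \<open>isometry\<close> over the disjoint union of the two index sets: every
  interval is cut off at \<open>t\<close>, and the second process gets the sign -1.\<close>

lemma simple_isometry:
  assumes S: "simple_process M F T N \<tau> \<xi>" and S': "simple_process M F T N' \<tau>' \<xi>'"
    and t: "0 \<le> t" "t \<le> T"
  shows "(\<integral>\<^sup>+\<omega>. ennreal ((simple_integral W N \<tau> \<xi> t \<omega> - simple_integral W N' \<tau>' \<xi>' t \<omega>)\<^sup>2) \<partial>M) =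
    sq_norm_proc M t (\<lambda>s \<omega>. simple_val N \<tau> \<xi> s \<omega> - simple_val N' \<tau>' \<xi>' s \<omega>)"
proof -
  define K where "K = {..<N} <+> {..<N'}"
  define a where "a k = (case k of Inl k \<Rightarrow> min (\<tau> k) t | Inr k \<Rightarrow> min (\<tau>' k) t)" for k
  define b where "b k = (case k of Inl k \<Rightarrow> min (\<tau> (Suc k)) t | Inr k \<Rightarrow> min (\<tau>' (Suc k)) t)" for k
  \<comment> \<open>If an interval starts at or after \<open>t\<close>, cutting it off moves its
    left end to \<open>t\<close>, where its coefficient need not be adapted yet. The coefficient is
    replaced by 0, which changes nothing because the cut interval is empty.\<close>
  define X where "X k \<omega> = (case k of Inl k \<Rightarrow> (if \<tau> k < t then 1 else 0) * \<xi> k \<omega>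
    | Inr k \<Rightarrow> (if \<tau>' k < t then - 1 else 0) * \<xi>' k \<omega>)" for k \<omega>
  have fin: "finite K" by (simp add: K_def)
  have part: "0 \<le> min (\<sigma> k) t \<and> min (\<sigma> k) t \<le> min (\<sigma> (Suc k)) t \<and> min (\<sigma> (Suc k)) t \<le> T \<and>
      bdd_adapted (min (\<sigma> k) t) (\<lambda>\<omega>. (if \<sigma> k < t then c else 0) * \<rho> k \<omega>)"
    if S: "simple_process M F T L \<sigma> \<rho>" and k: "k < L" for L \<sigma> \<rho> k c
  proof -
    have 1: "\<sigma> k < \<sigma> (Suc k)" using S k unfolding simple_process_def by blast
    have 2: "0 \<le> \<sigma> k" using simple_process_times(1)[OF S, of k] k by simp
    have "bdd_adapted (min (\<sigma> k) t) (\<lambda>\<omega>. (if \<sigma> k < t then c else 0) * \<rho> k \<omega>)"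
    proof (cases "\<sigma> k < t")
      case True
      then show ?thesis using bdd_adapted_scale[OF simple_process_bdd[OF S k], of c] by simp
    next
      case False
      then show ?thesis unfolding bdd_adapted_def by auto
    qed
    moreover have "min (\<sigma> k) t \<le> min (\<sigma> (Suc k)) t" using 1 by (intro min.mono) auto
    moreover have "min (\<sigma> (Suc k)) t \<le> T" using t by (intro min.coboundedI2)
    moreover have "0 \<le> min (\<sigma> k) t" using 2 t by simp
    ultimately show ?thesis by blast
  qed
  have ab: "0 \<le> a k \<and> a k \<le> b k \<and> b k \<le> T \<and> bdd_adapted (a k) (X k)" if "k \<in> K" for k
  proof (cases k)
    case (Inl x)
    then have "x < N" using that by (auto simp: K_def)
    from part[OF S this, of 1] show ?thesis by (simp only: Inl a_def b_def X_def[abs_def] sum.case)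
  next
    case (Inr x)
    then have "x < N'" using that by (auto simp: K_def)
    from part[OF S' this, of "- 1"] show ?thesis by (simp only: Inr a_def b_def X_def[abs_def] sum.case)
  qed
  have I: "(\<Sum>k\<in>K. X k \<omega> * inc (a k) (b k) \<omega>) = simple_integral W N \<tau> \<xi> t \<omega> - simple_integral W N' \<tau>' \<xi>' t \<omega>" for \<omega>
  proof -
    have "(\<Sum>k<N. X (Inl k) \<omega> * inc (a (Inl k)) (b (Inl k)) \<omega>) = simple_integral W N \<tau> \<xi> t \<omega>"
      unfolding simple_integral_def
    proof (rule sum.cong[OF refl])
      fix k assume "k \<in> {..<N}"
      then have "\<tau> k < \<tau> (Suc k)" using S unfolding simple_process_def by blast
      then show "X (Inl k) \<omega> * inc (a (Inl k)) (b (Inl k)) \<omega> = \<xi> k \<omega> * (W (min (\<tau> (Suc k)) t) \<omega> - W (min (\<tau> k) t) \<omega>)"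
        by (cases "\<tau> k < t") (simp_all add: X_def a_def b_def inc_def)
    qed
    moreover have "(\<Sum>k<N'. X (Inr k) \<omega> * inc (a (Inr k)) (b (Inr k)) \<omega>) = - simple_integral W N' \<tau>' \<xi>' t \<omega>"
      unfolding simple_integral_def sum_negf[symmetric]
    proof (rule sum.cong[OF refl])
      fix k assume "k \<in> {..<N'}"
      then have "\<tau>' k < \<tau>' (Suc k)" using S' unfolding simple_process_def by blast
      then show "X (Inr k) \<omega> * inc (a (Inr k)) (b (Inr k)) \<omega> = - (\<xi>' k \<omega> * (W (min (\<tau>' (Suc k)) t) \<omega> - W (min (\<tau>' k) t) \<omega>))"
        by (cases "\<tau>' k < t") (simp_all add: X_def a_def b_def inc_def)
    qed
    ultimately show ?thesis unfolding K_def by (simp add: sum.Plus)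
  qed
  have ind: "(if \<sigma> < t then c else 0) * r * indicator {min \<sigma> t<..min \<sigma>' t} s = c * (r * indicator {\<sigma><..\<sigma>'} s) * indicator {..t} s"
    for \<sigma> \<sigma>' c r s :: real by (auto simp: indicator_def)
  have V: "(\<Sum>k\<in>K. X k \<omega> * indicator {a k<..b k} s) =
      (simple_val N \<tau> \<xi> s \<omega> - simple_val N' \<tau>' \<xi>' s \<omega>) * indicator {..t} s" for \<omega> s
  proof -
    have v: "(\<Sum>k<N. X (Inl k) \<omega> * indicator {a (Inl k)<..b (Inl k)} s) = simple_val N \<tau> \<xi> s \<omega> * indicator {..t} s"
      unfolding simple_val_def sum_distrib_right by (rule sum.cong[OF refl]) (simp add: X_def a_def b_def ind)
    have v': "(\<Sum>k<N'. X (Inr k) \<omega> * indicator {a (Inr k)<..b (Inr k)} s) = - (simple_val N' \<tau>' \<xi>' s \<omega> * indicator {..t} s)"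
      unfolding simple_val_def sum_distrib_right sum_negf[symmetric]
      by (rule sum.cong[OF refl]) (simp add: X_def a_def b_def ind)
    show ?thesis
      unfolding K_def sum.Plus[OF finite_lessThan finite_lessThan] o_def v v' by (simp add: left_diff_distrib)
  qed
  \<comment> \<open>Partitions start at 0, so simple processes vanish at negative times. Hence
    cutting off at \<open>t\<close> amounts to restricting to [0,t], the domain of
    \<open>sq_norm_proc\<close>.\<close>
  have z: "simple_val L \<sigma> \<rho> s \<omega> = 0" if S: "simple_process M F T L \<sigma> \<rho>" and s: "s < 0" for L \<sigma> \<rho> s \<omega>
    unfolding simple_val_def
  proof (rule sum.neutral, rule ballI)
    fix k assume "k \<in> {..<L}"
    then have "0 \<le> \<sigma> k" using simple_process_times(1)[OF S, of k] by simp
    then show "\<rho> k \<omega> * indicator {\<sigma> k<..\<sigma> (Suc k)} s = 0" using s by simp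
  qed
  have eq: "ennreal (((simple_val N \<tau> \<xi> s \<omega> - simple_val N' \<tau>' \<xi>' s \<omega>) * indicator {..t} s)\<^sup>2) =
      ennreal ((simple_val N \<tau> \<xi> s \<omega> - simple_val N' \<tau>' \<xi>' s \<omega>)\<^sup>2) * indicator {0..t} s" for s \<omega>
    using z[OF S, of s \<omega>] z[OF S', of s \<omega>] by (cases "s < 0"; cases "s \<le> t") simp_all
  show ?thesis
    using isometry[of K a b X, OF fin ab] unfolding I V eq sq_norm_proc_def .
qed

subsection \<open>Square integrals on the product space\<close>

text \<open>Time is restricted to the horizon, where the processes are known to be measurable. The
  theorem states the coincidence of the controls with respect to this same measure.\<close>

definition prodm :: "(real \<times> 'w) measure" where
  "prodm = restrict_space lborel {0..T} \<Otimes>\<^sub>M M"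

lemma pair_sigma_finite_time: "pair_sigma_finite (restrict_space lborel {0..T}) M"
proof -
  have "finite_measure (restrict_space lborel {0..T})"
    by (rule finite_measureI) (simp add: emeasure_restrict_space space_restrict_space emeasure_lborel_Icc_eq)
  then show ?thesis
    by (intro pair_sigma_finite.intro finite_measure.axioms(1)) (auto intro: finite_measure.axioms(1) finite_measure_axioms)
qed

text \<open>Progressive measurability at the final time, with \<open>F T\<close> enlarged to
  \<open>M\<close> through the identity map.\<close>

lemma progressive_measurable:
  assumes "progressive F T \<phi>" "0 \<le> T"
  shows "(\<lambda>p. \<phi> (fst p) (snd p)) \<in> borel_measurable prodm"
proof -
  have 1: "(\<lambda>(s, \<omega>). \<phi> s \<omega>) \<in> borel_measurable (restrict_space borel {0..T} \<Otimes>\<^sub>M F T)"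
    using assms unfolding progressive_def by auto
  have id: "(\<lambda>x. x) \<in> measurable M (F T)"
    using subalgebra_F[of T] unfolding subalgebra_def by (auto intro!: measurableI)
  have fst: "fst \<in> measurable prodm (restrict_space borel {0..T})"
  proof -
    have "sets (restrict_space lborel {0..T}) = sets (restrict_space borel {0..T})"
      by (simp add: sets_restrict_space)
    then show ?thesis unfolding prodm_def
      using measurable_fst[of "restrict_space lborel {0..T}" M]
      by (metis measurable_cong_sets)
  qed
  have snd: "snd \<in> measurable prodm (F T)"
    unfolding prodm_def by (rule measurable_compose[OF measurable_snd id])
  have "(\<lambda>p. (fst p, snd p)) \<in> measurable prodm (restrict_space borel {0..T} \<Otimes>\<^sub>M F T)"
    using fst snd by (rule measurable_Pair)
  from measurable_compose[OF this 1] show ?thesis by (simp add: case_prod_unfold)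
qed

text \<open>Tonelli's theorem. The form on the product space suits pointwise estimates that hold
  almost everywhere; the form with time outermost is the one to which Gronwall's lemma
  applies.\<close>

lemma sq_norm_proc_eq:
  assumes m: "(\<lambda>p. \<phi> (fst p) (snd p)) \<in> borel_measurable prodm" and t: "t \<le> T"
  shows "sq_norm_proc M t \<phi> = (\<integral>\<^sup>+p. ennreal ((\<phi> (fst p) (snd p))\<^sup>2) * indicator {0..t} (fst p) \<partial>prodm)"
    and "sq_norm_proc M t \<phi> = (\<integral>\<^sup>+s. (\<integral>\<^sup>+\<omega>. ennreal ((\<phi> s \<omega>)\<^sup>2) \<partial>M) * indicator {0..t} s \<partial>lborel)"
proof -
  note fubini = nn_integral_fst
  interpret pair_sigma_finite "restrict_space lborel {0..T}" M by (rule pair_sigma_finite_time)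
  let ?f = "\<lambda>p. ennreal ((\<phi> (fst p) (snd p))\<^sup>2) * indicator {0..t} (fst p)"
  have i: "(\<lambda>p. indicator {0..t} (fst p) :: ennreal) \<in> borel_measurable prodm"
  proof -
    have "indicator {0..t} \<in> borel_measurable (restrict_space lborel {0..T})"
      by (rule measurable_restrict_space1) simp
    from measurable_compose[OF measurable_fst this] show ?thesis unfolding prodm_def .
  qed
  have f: "?f \<in> borel_measurable (restrict_space lborel {0..T} \<Otimes>\<^sub>M M)"
    using borel_measurable_times_ennreal[OF measurable_compose[OF borel_measurable_power[OF m, where n = 2] measurable_ennreal] i]
    unfolding prodm_def .
  have ind: "x * indicator {0..t} s * indicator {0..T} s = x * indicator {0..t} s" for x :: ennreal and s
    using t by (simp add: indicator_def)
  show "sq_norm_proc M t \<phi> = integral\<^sup>N prodm ?f"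
    unfolding prodm_def nn_integral_snd[OF f, symmetric] sq_norm_proc_def
    by (simp add: nn_integral_restrict_space ind)
  also have "\<dots> = (\<integral>\<^sup>+s. (\<integral>\<^sup>+\<omega>. ?f (s, \<omega>) \<partial>M) \<partial>restrict_space lborel {0..T})"
    unfolding prodm_def by (rule fubini[OF f, symmetric])
  also have "\<dots> = (\<integral>\<^sup>+s. (\<integral>\<^sup>+\<omega>. ennreal ((\<phi> s \<omega>)\<^sup>2) \<partial>M) * indicator {0..t} s \<partial>restrict_space lborel {0..T})"
  proof (rule nn_integral_cong)
    fix s assume "s \<in> space (restrict_space lborel {0..T})"
    show "(\<integral>\<^sup>+\<omega>. ?f (s, \<omega>) \<partial>M) = (\<integral>\<^sup>+\<omega>. ennreal ((\<phi> s \<omega>)\<^sup>2) \<partial>M) * indicator {0..t} s"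
      by (cases "s \<in> {0..t}") simp_all
  qed
  also have "\<dots> = (\<integral>\<^sup>+s. (\<integral>\<^sup>+\<omega>. ennreal ((\<phi> s \<omega>)\<^sup>2) \<partial>M) * indicator {0..t} s \<partial>lborel)"
    by (simp add: nn_integral_restrict_space ind)
  finally show "sq_norm_proc M t \<phi> = (\<integral>\<^sup>+s. (\<integral>\<^sup>+\<omega>. ennreal ((\<phi> s \<omega>)\<^sup>2) \<partial>M) * indicator {0..t} s \<partial>lborel)" .
qed

lemma simple_val_measurable:
  assumes "simple_process M F T N \<tau> \<xi>"
  shows "(\<lambda>p. simple_val N \<tau> \<xi> (fst p) (snd p)) \<in> borel_measurable prodm"
  unfolding simple_val_def
proof (rule borel_measurable_sum)
  fix k assume k: "k \<in> {..<N}"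
  have "\<xi> k \<in> borel_measurable M"
    using simple_process_bdd[OF assms] simple_process_times(2)[OF assms, of k] k
    by (auto intro: measurable_F bdd_adapted_measurable)
  then have 1: "(\<lambda>p. \<xi> k (snd p)) \<in> borel_measurable prodm"
    unfolding prodm_def by (rule measurable_compose[OF measurable_snd])
  have "indicator {\<tau> k<..\<tau> (Suc k)} \<in> borel_measurable (restrict_space lborel {0..T})"
    by (rule measurable_restrict_space1) simp
  then have "(\<lambda>p. indicator {\<tau> k<..\<tau> (Suc k)} (fst p) :: real) \<in> borel_measurable prodm"
    unfolding prodm_def by (rule measurable_compose[OF measurable_fst])
  with 1 show "(\<lambda>p. \<xi> k (snd p) * indicator {\<tau> k<..\<tau> (Suc k)} (fst p)) \<in> borel_measurable prodm"
    by (rule borel_measurable_times)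
qed

section \<open>Mean-square estimates with three summands\<close>

lemma square_sum_3: "\<bar>f\<bar> \<le> \<bar>a\<bar> + \<bar>b\<bar> + \<bar>c\<bar> \<Longrightarrow> f\<^sup>2 \<le> 3 * (a\<^sup>2 + b\<^sup>2 + c\<^sup>2)" for f a b c :: real
proof -
  assume "\<bar>f\<bar> \<le> \<bar>a\<bar> + \<bar>b\<bar> + \<bar>c\<bar>"
  then have "f\<^sup>2 \<le> (\<bar>a\<bar> + \<bar>b\<bar> + \<bar>c\<bar>)\<^sup>2" by (metis abs_ge_zero abs_le_square_iff abs_of_nonneg order_trans)
  moreover have "0 \<le> (\<bar>a\<bar> - \<bar>b\<bar>)\<^sup>2 + (\<bar>a\<bar> - \<bar>c\<bar>)\<^sup>2 + (\<bar>b\<bar> - \<bar>c\<bar>)\<^sup>2" by simp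
  ultimately show ?thesis by (simp add: power2_eq_square algebra_simps)
qed

text \<open>Takes the place of the triangle inequality for the mean-square norm. It works directly
  with extended integrals, so finiteness need not be tracked, at the price of a factor 3.\<close>

lemma nn_integral_square_3:
  fixes f g h k :: "'b \<Rightarrow> real"
  assumes [measurable]: "g \<in> borel_measurable N" "h \<in> borel_measurable N" "k \<in> borel_measurable N"
    and le: "\<And>x. x \<in> space N \<Longrightarrow> \<bar>f x\<bar> \<le> \<bar>g x\<bar> + \<bar>h x\<bar> + \<bar>k x\<bar>"
  shows "(\<integral>\<^sup>+x. ennreal ((f x)\<^sup>2) \<partial>N) \<le>
    3 * ((\<integral>\<^sup>+x. ennreal ((g x)\<^sup>2) \<partial>N) + (\<integral>\<^sup>+x. ennreal ((h x)\<^sup>2) \<partial>N) + (\<integral>\<^sup>+x. ennreal ((k x)\<^sup>2) \<partial>N))"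
proof -
  have "(\<integral>\<^sup>+x. ennreal ((f x)\<^sup>2) \<partial>N) \<le> (\<integral>\<^sup>+x. 3 * (ennreal ((g x)\<^sup>2) + ennreal ((h x)\<^sup>2) + ennreal ((k x)\<^sup>2)) \<partial>N)"
  proof (rule nn_integral_mono)
    fix x assume "x \<in> space N"
    then have "ennreal ((f x)\<^sup>2) \<le> ennreal (3 * ((g x)\<^sup>2 + (h x)\<^sup>2 + (k x)\<^sup>2))"
      using square_sum_3[OF le] by (intro ennreal_leI)
    also have "\<dots> = 3 * (ennreal ((g x)\<^sup>2) + ennreal ((h x)\<^sup>2) + ennreal ((k x)\<^sup>2))"
      by (subst ennreal_mult) simp_all
    finally show "ennreal ((f x)\<^sup>2) \<le> \<dots>" .
  qed
  then show ?thesis by (simp add: nn_integral_cmult nn_integral_add)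
qed

lemma sq_norm_proc_mono: "t \<le> t' \<Longrightarrow> sq_norm_proc M t \<phi> \<le> sq_norm_proc M t' \<phi>"
  unfolding sq_norm_proc_def by (intro nn_integral_mono mult_left_mono) (auto simp: indicator_def)

lemma sq_norm_proc_3:
  assumes f: "(\<lambda>p. f (fst p) (snd p)) \<in> borel_measurable prodm"
    and g: "(\<lambda>p. g (fst p) (snd p)) \<in> borel_measurable prodm"
    and h: "(\<lambda>p. h (fst p) (snd p)) \<in> borel_measurable prodm"
    and k: "(\<lambda>p. k (fst p) (snd p)) \<in> borel_measurable prodm"
    and t: "t \<le> T"
    and le: "\<And>s \<omega>. \<bar>f s \<omega>\<bar> \<le> \<bar>g s \<omega>\<bar> + \<bar>h s \<omega>\<bar> + \<bar>k s \<omega>\<bar>"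
  shows "sq_norm_proc M t f \<le> 3 * (sq_norm_proc M t g + sq_norm_proc M t h + sq_norm_proc M t k)"
proof -
  \<comment> \<open>The indicator equals its own square and can be moved into it, which reduces a
    norm over [0,t] to a plain square integral.\<close>
  define i where "i p = (indicator {0..t} (fst p) :: real)" for p :: "real \<times> 'w"
  have i: "i \<in> borel_measurable prodm"
  proof -
    have "indicator {0..t} \<in> borel_measurable (restrict_space lborel {0..T})"
      by (rule measurable_restrict_space1) simp
    from measurable_compose[OF measurable_fst this] show ?thesis unfolding prodm_def i_def[abs_def] .
  qed
  have eq: "sq_norm_proc M t \<phi> = (\<integral>\<^sup>+p. ennreal ((\<phi> (fst p) (snd p) * i p)\<^sup>2) \<partial>prodm)"
    if "(\<lambda>p. \<phi> (fst p) (snd p)) \<in> borel_measurable prodm" for \<phi>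
    unfolding sq_norm_proc_eq(1)[OF that t]
    by (intro nn_integral_cong) (simp add: i_def indicator_def)
  show ?thesis unfolding eq[OF f] eq[OF g] eq[OF h] eq[OF k]
    by (rule nn_integral_square_3[OF borel_measurable_times[OF g i] borel_measurable_times[OF h i]
          borel_measurable_times[OF k i]])
       (auto simp: i_def indicator_def le)
qed

section \<open>Comparison of two Ito integrals\<close>

lemma simple_integral_measurable:
  assumes S: "simple_process M F T N \<tau> \<xi>" and t: "0 \<le> t" "t \<le> T"
  shows "simple_integral W N \<tau> \<xi> t \<in> borel_measurable M"
  unfolding simple_integral_def[abs_def]
proof (rule borel_measurable_sum)
  fix k assume k: "k \<in> {..<N}"
  then have k': "k \<le> N" "Suc k \<le> N" "k < N" by simp_all
  have "\<xi> k \<in> borel_measurable M"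
    by (rule measurable_F[OF simple_process_times(2)[OF S k'(1)] bdd_adapted_measurable[OF simple_process_bdd[OF S k'(3)]]])
  moreover have "W (min (\<tau> k) t) \<in> borel_measurable M" if "k \<le> N" for k
    by (rule W_measurable) (use simple_process_times[OF S that] t in auto)
  ultimately show "(\<lambda>\<omega>. \<xi> k \<omega> * (W (min (\<tau> (Suc k)) t) \<omega> - W (min (\<tau> k) t) \<omega>)) \<in> borel_measurable M"
    using k' by (intro borel_measurable_times borel_measurable_diff)
qed

lemma ito_integral_measurable:
  assumes I: "ito_integral M F T W \<phi> I" and t: "0 \<le> t" "t \<le> T"
  shows "I t \<in> borel_measurable M" "(\<lambda>p. \<phi> (fst p) (snd p)) \<in> borel_measurable prodm"
proof -
  have "I t \<in> borel_measurable (F t)" using I t unfolding ito_integral_def by auto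
  then show "I t \<in> borel_measurable M" by (rule measurable_F[OF t(2)])
  have "progressive F T \<phi>" using I unfolding ito_integral_def L2F_def by auto
  then show "(\<lambda>p. \<phi> (fst p) (snd p)) \<in> borel_measurable prodm"
    using t by (intro progressive_measurable) auto
qed

text \<open>The two integrals come with unrelated approximations. Their difference is compared with
  the difference of two simple integrals, the isometry converts that to a difference of simple
  processes, and this is compared with the difference of the integrands. Each of the two comparisons
  costs a factor 3, hence 9 in the limit.\<close>

lemma ito_integral_difference:
  assumes I: "ito_integral M F T W \<phi> I" and I': "ito_integral M F T W \<psi> J" and t: "0 \<le> t" "t \<le> T"
  shows "(\<integral>\<^sup>+\<omega>. ennreal ((I t \<omega> - J t \<omega>)\<^sup>2) \<partial>M) \<le> 9 * sq_norm_proc M t (\<lambda>s \<omega>. \<phi> s \<omega> - \<psi> s \<omega>)"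
proof -
  have tT: "t \<in> {0..T}" using t by simp
  obtain N \<tau> \<xi> where S: "\<And>m. simple_process M F T (N m) (\<tau> m) (\<xi> m)"
    and c: "(\<lambda>m::nat. sq_norm_proc M T (\<lambda>t \<omega>. simple_val (N m) (\<tau> m) (\<xi> m) t \<omega> - \<phi> t \<omega>)) \<longlonglongrightarrow> 0"
    and d: "\<forall>t\<in>{0..T}. (\<lambda>m. \<integral>\<^sup>+\<omega>. ennreal ((simple_integral W (N m) (\<tau> m) (\<xi> m) t \<omega> - I t \<omega>)\<^sup>2) \<partial>M) \<longlonglongrightarrow> 0"
    using I unfolding ito_integral_def by blast
  obtain N' \<tau>' \<xi>' where S': "\<And>m. simple_process M F T (N' m) (\<tau>' m) (\<xi>' m)"
    and c': "(\<lambda>m::nat. sq_norm_proc M T (\<lambda>t \<omega>. simple_val (N' m) (\<tau>' m) (\<xi>' m) t \<omega> - \<psi> t \<omega>)) \<longlonglongrightarrow> 0"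
    and d': "\<forall>t\<in>{0..T}. (\<lambda>m. \<integral>\<^sup>+\<omega>. ennreal ((simple_integral W (N' m) (\<tau>' m) (\<xi>' m) t \<omega> - J t \<omega>)\<^sup>2) \<partial>M) \<longlonglongrightarrow> 0"
    using I' unfolding ito_integral_def by blast
  define A where "A m = (\<integral>\<^sup>+\<omega>. ennreal ((simple_integral W (N m) (\<tau> m) (\<xi> m) t \<omega> - I t \<omega>)\<^sup>2) \<partial>M)" for m
  define A' where "A' m = (\<integral>\<^sup>+\<omega>. ennreal ((simple_integral W (N' m) (\<tau>' m) (\<xi>' m) t \<omega> - J t \<omega>)\<^sup>2) \<partial>M)" for m
  define B where "B m = sq_norm_proc M T (\<lambda>t \<omega>. simple_val (N m) (\<tau> m) (\<xi> m) t \<omega> - \<phi> t \<omega>)" for m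
  define B' where "B' m = sq_norm_proc M T (\<lambda>t \<omega>. simple_val (N' m) (\<tau>' m) (\<xi>' m) t \<omega> - \<psi> t \<omega>)" for m
  define Q where "Q = sq_norm_proc M t (\<lambda>s \<omega>. \<phi> s \<omega> - \<psi> s \<omega>)"
  note \<phi>m = ito_integral_measurable(2)[OF I t] and \<psi>m = ito_integral_measurable(2)[OF I' t]
  note vm = simple_val_measurable[OF S] and vm' = simple_val_measurable[OF S']
  have bound: "(\<integral>\<^sup>+\<omega>. ennreal ((I t \<omega> - J t \<omega>)\<^sup>2) \<partial>M) \<le> 3 * (A m + A' m + 3 * (B m + B' m + Q))" for m
  proof -
    let ?v = "simple_val (N m) (\<tau> m) (\<xi> m)" and ?v' = "simple_val (N' m) (\<tau>' m) (\<xi>' m)"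
    let ?S = "simple_integral W (N m) (\<tau> m) (\<xi> m) t" and ?S' = "simple_integral W (N' m) (\<tau>' m) (\<xi>' m) t"
    have "(\<integral>\<^sup>+\<omega>. ennreal ((I t \<omega> - J t \<omega>)\<^sup>2) \<partial>M) \<le> 3 * (A m + A' m + (\<integral>\<^sup>+\<omega>. ennreal ((?S \<omega> - ?S' \<omega>)\<^sup>2) \<partial>M))"
      unfolding A_def A'_def
      by (rule nn_integral_square_3; (intro borel_measurable_diff simple_integral_measurable[OF S t]
          simple_integral_measurable[OF S' t] ito_integral_measurable(1)[OF I t] ito_integral_measurable(1)[OF I' t])?)
         linarith
    also have "(\<integral>\<^sup>+\<omega>. ennreal ((?S \<omega> - ?S' \<omega>)\<^sup>2) \<partial>M) = sq_norm_proc M t (\<lambda>s \<omega>. ?v s \<omega> - ?v' s \<omega>)"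
      by (rule simple_isometry[OF S S' t])
    also have "\<dots> \<le> 3 * (sq_norm_proc M t (\<lambda>s \<omega>. ?v s \<omega> - \<phi> s \<omega>) + sq_norm_proc M t (\<lambda>s \<omega>. ?v' s \<omega> - \<psi> s \<omega>) + Q)"
      unfolding Q_def
      by (rule sq_norm_proc_3[OF _ _ _ _ t(2)]; (intro borel_measurable_diff \<phi>m \<psi>m vm vm')?) linarith
    \<comment> \<open>The approximation errors are enlarged to norms over the whole horizon, which
      are known to converge. \<open>Q\<close> keeps its norm over [0,t], without which the estimate
      would be of no use for Gronwall's lemma.\<close>
    also have "\<dots> \<le> 3 * (B m + B' m + Q)"
      unfolding B_def B'_def by (intro mult_left_mono add_mono order_refl sq_norm_proc_mono t) simp_all
    finally show ?thesis by (simp add: add_left_mono mult_left_mono)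
  qed
  have lim: "A \<longlonglongrightarrow> 0" "A' \<longlonglongrightarrow> 0" "B \<longlonglongrightarrow> 0" "B' \<longlonglongrightarrow> 0"
    using c c' bspec[OF d tT] bspec[OF d' tT] unfolding A_def[abs_def] A'_def[abs_def] B_def[abs_def] B'_def[abs_def] by auto
  have "(\<lambda>m. 3 * (A m + A' m + 3 * (B m + B' m + Q))) \<longlonglongrightarrow> 3 * (0 + 0 + 3 * (0 + 0 + Q))"
    by (intro tendsto_add lim tendsto_const ennreal_tendsto_cmult) simp_all
  from LIMSEQ_le_const[OF this] bound
  have "(\<integral>\<^sup>+\<omega>. ennreal ((I t \<omega> - J t \<omega>)\<^sup>2) \<partial>M) \<le> 3 * (0 + 0 + 3 * (0 + 0 + Q))" by blast
  also have "\<dots> = 9 * Q" by (simp add: mult.assoc[symmetric])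
  finally show ?thesis unfolding Q_def .
qed

subsection \<open>Pathwise uniqueness\<close>

text \<open>A finite norm makes almost every path square integrable, and then integrable because the
  horizon has finite length. This licenses splitting the time integral of a difference of
  drifts.\<close>

lemma time_section_integrable:
  assumes m: "(\<lambda>p. \<phi> (fst p) (snd p)) \<in> borel_measurable prodm" and fin: "sq_norm_proc M T \<phi> < \<infinity>"
  shows "AE \<omega> in M. set_integrable lborel {0..T} (\<lambda>s. \<phi> s \<omega>) \<and> set_integrable lborel {0..T} (\<lambda>s. (\<phi> s \<omega>)\<^sup>2)"
proof -
  interpret pair_sigma_finite "restrict_space lborel {0..T}" M by (rule pair_sigma_finite_time)
  interpret R: finite_measure "restrict_space lborel {0..T}"
    by (rule finite_measureI) (simp add: emeasure_restrict_space space_restrict_space emeasure_lborel_Icc_eq)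
  have I: "integrable (restrict_space lborel {0..T}) f \<longleftrightarrow> set_integrable lborel {0..T} f" for f :: "real \<Rightarrow> real"
    unfolding set_integrable_def by (rule integrable_restrict_space) simp
  have m2: "(\<lambda>p. ennreal ((\<phi> (fst p) (snd p))\<^sup>2)) \<in> borel_measurable (restrict_space lborel {0..T} \<Otimes>\<^sub>M M)"
    using measurable_compose[OF borel_measurable_power[OF m, where n = 2] measurable_ennreal] unfolding prodm_def .
  have "(\<lambda>(\<omega>, s). ennreal ((\<phi> s \<omega>)\<^sup>2)) \<in> borel_measurable (M \<Otimes>\<^sub>M restrict_space lborel {0..T})"
    using measurable_pair_swap[OF m2] by simp
  then have "(\<lambda>\<omega>. \<integral>\<^sup>+s. ennreal ((\<phi> s \<omega>)\<^sup>2) \<partial>restrict_space lborel {0..T}) \<in> borel_measurable M"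
    by (rule M1.borel_measurable_nn_integral)
  moreover have "(\<integral>\<^sup>+\<omega>. (\<integral>\<^sup>+s. ennreal ((\<phi> s \<omega>)\<^sup>2) \<partial>restrict_space lborel {0..T}) \<partial>M) \<noteq> \<infinity>"
    using fin unfolding sq_norm_proc_def by (simp add: nn_integral_restrict_space)
  ultimately have "AE \<omega> in M. (\<integral>\<^sup>+s. ennreal ((\<phi> s \<omega>)\<^sup>2) \<partial>restrict_space lborel {0..T}) \<noteq> \<infinity>"
    by (rule nn_integral_noteq_infinite)
  then show ?thesis
  proof (rule AE_mp, intro AE_I2 impI)
    fix \<omega> assume \<omega>: "\<omega> \<in> space M" and f: "(\<integral>\<^sup>+s. ennreal ((\<phi> s \<omega>)\<^sup>2) \<partial>restrict_space lborel {0..T}) \<noteq> \<infinity>"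
    have 1: "(\<lambda>s. \<phi> s \<omega>) \<in> borel_measurable (restrict_space lborel {0..T})"
      using measurable_compose[OF measurable_Pair2'[OF \<omega>] m[unfolded prodm_def]] by simp
    have 2: "integrable (restrict_space lborel {0..T}) (\<lambda>s. (\<phi> s \<omega>)\<^sup>2)"
      by (rule integrableI_nonneg) (use 1 f in \<open>auto simp: less_top\<close>)
    have "integrable (restrict_space lborel {0..T}) (\<lambda>s. \<phi> s \<omega>)"
      using 1 2 by (rule R.square_integrable_imp_integrable)
    with 2 show "set_integrable lborel {0..T} (\<lambda>s. \<phi> s \<omega>) \<and> set_integrable lborel {0..T} (\<lambda>s. (\<phi> s \<omega>)\<^sup>2)"
      unfolding I by blast
  qed
qed

text \<open>Cauchy-Schwarz against the constant function: the integral of the square of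
  \<open>f - c\<close> is nonnegative for every \<open>c\<close>, and the best choice of
  \<open>c\<close> is the mean of \<open>f\<close>.\<close>

lemma set_integral_square_le:
  fixes f :: "real \<Rightarrow> real"
  assumes t: "0 \<le> t" and f: "set_integrable lborel {0..t} f" and f2: "set_integrable lborel {0..t} (\<lambda>s. (f s)\<^sup>2)"
  shows "(LBINT s:{0..t}. f s)\<^sup>2 \<le> t * (LBINT s:{0..t}. (f s)\<^sup>2)"
proof -
  define m where "m = (LBINT s:{0..t}. f s)"
  define A where "A = (LBINT s:{0..t}. (f s)\<^sup>2)"
  have q: "0 \<le> A - 2 * c * m + c\<^sup>2 * t" for c
  proof -
    have c: "set_integrable lborel {0..t} (\<lambda>s. c\<^sup>2)"
      by (simp add: set_integrable_def emeasure_lborel_Icc_eq)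
    have cf: "set_integrable lborel {0..t} (\<lambda>s. 2 * c * f s)" using f by simp
    have "0 \<le> (LBINT s:{0..t}. (f s)\<^sup>2 - 2 * c * f s + c\<^sup>2)"
    proof -
      have "(f s)\<^sup>2 - 2 * c * f s + c\<^sup>2 = (f s - c)\<^sup>2" for s by (simp add: power2_diff)
      then show ?thesis by (simp add: set_lebesgue_integral_def)
    qed
    also have "\<dots> = A - 2 * c * m + c\<^sup>2 * t"
      using t by (simp add: set_integral_add(2)[OF set_integral_diff(1)[OF f2 cf] c] set_integral_diff(2)[OF f2 cf]
          A_def m_def set_integral_const[of "{0..t}" lborel] emeasure_lborel_Icc_eq)
    finally show ?thesis .
  qed
  have "m\<^sup>2 \<le> t * A"
  proof (cases "t = 0")
    case True
    have "m = 0"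
    proof (rule ccontr)
      assume "m \<noteq> 0"
      \<comment> \<open>For \<open>t = 0\<close> the inequality \<open>q\<close> is affine in
        \<open>c\<close>; this value of \<open>c\<close> makes its right-hand side equal to
        -1.\<close>
      then show False using q[of "(A + 1) / (2 * m)"] True by (simp add: field_simps)
    qed
    then show ?thesis using True by simp
  next
    case False
    then have t: "t > 0" using t by simp
    have "0 \<le> t * (A - 2 * (m / t) * m + (m / t)\<^sup>2 * t)" using q[of "m / t"] t by simp
    also have "\<dots> = t * A - m\<^sup>2" using t by (simp add: field_simps power2_eq_square)
    finally show ?thesis by simp
  qed
  then show ?thesis by (simp add: m_def A_def)
qed

text \<open>Iterating the integral inequality \<open>m\<close> times improves the bound to
  \<open>H * (C * t) ^ m / fact m\<close>, which tends to 0. A finite starting bound is essential,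
  since infinite values can satisfy the inequality trivially.\<close>

lemma gronwall_zero:
  fixes h :: "real \<Rightarrow> ennreal"
  assumes fin: "\<And>t. t \<in> {0..T} \<Longrightarrow> h t \<le> ennreal H" and H: "0 \<le> H" and C: "0 \<le> C"
    and le: "\<And>t. t \<in> {0..T} \<Longrightarrow> h t \<le> ennreal C * (\<integral>\<^sup>+s. h s * indicator {0..t} s \<partial>lborel)"
    and t: "t \<in> {0..T}"
  shows "h t = 0"
proof -
  have it: "h t \<le> ennreal (H * (C * t) ^ m / fact m)" if "t \<in> {0..T}" for m t
    using that
  proof (induction m arbitrary: t)
    case 0
    then show ?case using fin by simp
  next
    case (Suc m)
    let ?c = "H * C ^ m / fact m"
    have c: "0 \<le> ?c" using H C by simp
    have "(\<integral>\<^sup>+s. h s * indicator {0..t} s \<partial>lborel) \<le> (\<integral>\<^sup>+s. ennreal (?c * s ^ m) * indicator {0..t} s \<partial>lborel)"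
    proof (rule nn_integral_mono)
      fix s
      show "h s * indicator {0..t} s \<le> ennreal (?c * s ^ m) * indicator {0..t} s"
        using Suc.IH[of s] Suc.prems by (cases "s \<in> {0..t}") (simp_all add: power_mult_distrib mult.assoc)
    qed
    also have "\<dots> = ennreal (?c * t ^ Suc m / real (Suc m) - ?c * 0 ^ Suc m / real (Suc m))"
    proof (rule nn_integral_FTC_Icc)
      fix s assume s: "s \<in> {0..t}"
      have r: "real (Suc m) \<noteq> 0" by simp
      have "((\<lambda>s. ?c * s ^ Suc m / real (Suc m)) has_real_derivative ?c * (real (Suc m) * s ^ m) / real (Suc m)) (at s)"
        using DERIV_cdivide[OF DERIV_cmult[OF DERIV_pow[of "Suc m" s UNIV], of ?c], of "real (Suc m)"] by (simp only: diff_Suc_Suc minus_nat.diff_0)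
      then show "((\<lambda>s. ?c * s ^ Suc m / real (Suc m)) has_real_derivative ?c * s ^ m) (at s)"
        by (simp only: mult.left_commute[of ?c] nonzero_mult_div_cancel_left[OF r])
      show "0 \<le> ?c * s ^ m" by (rule mult_nonneg_nonneg[OF c]) (use s in simp)
    qed (use Suc.prems in auto)
    finally have int: "(\<integral>\<^sup>+s. h s * indicator {0..t} s \<partial>lborel) \<le> ennreal (?c * t ^ Suc m / real (Suc m))"
      by simp
    have "h t \<le> ennreal C * (\<integral>\<^sup>+s. h s * indicator {0..t} s \<partial>lborel)" by (rule le[OF Suc.prems])
    also have "\<dots> \<le> ennreal C * ennreal (?c * t ^ Suc m / real (Suc m))" by (rule mult_left_mono[OF int]) simp
    also have "\<dots> = ennreal (C * (?c * t ^ Suc m / real (Suc m)))" by (rule ennreal_mult'[OF C, symmetric])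
    also have "C * (?c * t ^ Suc m / real (Suc m)) = H * (C * t) ^ Suc m / fact (Suc m)"
      by (simp add: power_mult_distrib fact_Suc field_simps del: of_nat_Suc)
    finally show ?case .
  qed
  have "(\<lambda>m. inverse (fact m) * (C * t) ^ m) \<longlonglongrightarrow> 0"
    by (rule summable_LIMSEQ_zero[OF summable_exp])
  then have "(\<lambda>m. ennreal (H * (inverse (fact m) * (C * t) ^ m))) \<longlonglongrightarrow> ennreal (H * 0)"
    by (intro tendsto_ennrealI tendsto_mult tendsto_const)
  moreover have "h t \<le> ennreal (H * (inverse (fact m) * (C * t) ^ m))" for m
    using it[OF t, of m] by (simp add: field_simps)
  ultimately have "h t \<le> ennreal (H * 0)" by (rule LIMSEQ_le_const[OF _ exI, OF _ allI, OF _ impI])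
  then show ?thesis by simp
qed

section \<open>Mean-square distance of two solutions\<close>

lemma section_measurable:
  assumes m: "(\<lambda>p. \<phi> (fst p) (snd p)) \<in> borel_measurable prodm" and t: "t \<le> T"
  shows "(\<lambda>\<omega>. \<integral>\<^sup>+s. ennreal ((\<phi> s \<omega>)\<^sup>2) * indicator {0..t} s \<partial>lborel) \<in> borel_measurable M"
    and "(\<lambda>s. (\<integral>\<^sup>+\<omega>. ennreal ((\<phi> s \<omega>)\<^sup>2) \<partial>M) * indicator {0..t} s) \<in> borel_measurable lborel"
    and "0 \<le> s \<Longrightarrow> s \<le> T \<Longrightarrow> (\<lambda>\<omega>. \<phi> s \<omega>) \<in> borel_measurable M"
proof -
  note M_nn = borel_measurable_nn_integral
  interpret pair_sigma_finite "restrict_space lborel {0..T}" M by (rule pair_sigma_finite_time)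
  have m2: "(\<lambda>p. ennreal ((\<phi> (fst p) (snd p))\<^sup>2)) \<in> borel_measurable (restrict_space lborel {0..T} \<Otimes>\<^sub>M M)"
    using measurable_compose[OF borel_measurable_power[OF m, where n = 2] measurable_ennreal] unfolding prodm_def .
  have i: "indicator {0..t} \<in> borel_measurable (restrict_space lborel {0..T})"
    by (rule measurable_restrict_space1) simp
  have m3: "(\<lambda>p. ennreal ((\<phi> (fst p) (snd p))\<^sup>2) * indicator {0..t} (fst p)) \<in> borel_measurable (restrict_space lborel {0..T} \<Otimes>\<^sub>M M)"
    by (rule borel_measurable_times_ennreal[OF m2 measurable_compose[OF measurable_fst i]])
  have "(\<lambda>(\<omega>, s). ennreal ((\<phi> s \<omega>)\<^sup>2) * indicator {0..t} s) \<in> borel_measurable (M \<Otimes>\<^sub>M restrict_space lborel {0..T})"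
    using measurable_pair_swap[OF m3] by simp
  then have "(\<lambda>\<omega>. \<integral>\<^sup>+s. ennreal ((\<phi> s \<omega>)\<^sup>2) * indicator {0..t} s \<partial>restrict_space lborel {0..T}) \<in> borel_measurable M"
    by (rule M1.borel_measurable_nn_integral)
  moreover have "x * indicator {0..t} s * indicator {0..T} s = x * indicator {0..t} s" for x :: ennreal and s
    using t by (simp add: indicator_def)
  ultimately show "(\<lambda>\<omega>. \<integral>\<^sup>+s. ennreal ((\<phi> s \<omega>)\<^sup>2) * indicator {0..t} s \<partial>lborel) \<in> borel_measurable M"
    by (simp add: nn_integral_restrict_space)
  have "(\<lambda>(s, \<omega>). ennreal ((\<phi> s \<omega>)\<^sup>2)) \<in> borel_measurable (restrict_space lborel {0..T} \<Otimes>\<^sub>M M)"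
    using m2 by (simp add: case_prod_unfold)
  then have "(\<lambda>s. \<integral>\<^sup>+\<omega>. ennreal ((\<phi> s \<omega>)\<^sup>2) \<partial>M) \<in> borel_measurable (restrict_space lborel {0..T})"
    by (rule M_nn)
  then have "(\<lambda>s. (\<integral>\<^sup>+\<omega>. ennreal ((\<phi> s \<omega>)\<^sup>2) \<partial>M) * indicator {0..T} s) \<in> borel_measurable lborel"
    by (subst (asm) borel_measurable_restrict_space_iff_ennreal) simp_all
  then have "(\<lambda>s. (\<integral>\<^sup>+\<omega>. ennreal ((\<phi> s \<omega>)\<^sup>2) \<partial>M) * indicator {0..T} s * indicator {0..t} s) \<in> borel_measurable lborel"
    by (rule borel_measurable_times_ennreal) simp
  moreover have "x * indicator {0..T} s * indicator {0..t} s = x * indicator {0..t} s" for x :: ennreal and s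
    using t by (simp add: indicator_def)
  ultimately show "(\<lambda>s. (\<integral>\<^sup>+\<omega>. ennreal ((\<phi> s \<omega>)\<^sup>2) \<partial>M) * indicator {0..t} s) \<in> borel_measurable lborel"
    by simp
  assume "0 \<le> s" "s \<le> T"
  then have "s \<in> space (restrict_space lborel {0..T})" by (simp add: space_restrict_space)
  from measurable_compose[OF measurable_Pair1'[OF this] m[unfolded prodm_def]]
  show "(\<lambda>\<omega>. \<phi> s \<omega>) \<in> borel_measurable M" by simp
qed

text \<open>The initial values cancel, leaving a drift part and a martingale part. Separating them
  costs the factor 2, Cauchy-Schwarz in time gives the factor \<open>T\<close> for the drift, and
  \<open>ito_integral_difference\<close> gives the 9.\<close>

lemma sde_difference_bound:
  assumes X: "sde_solution M F T W n b \<sigma> x0 x" and X': "sde_solution M F T W n b' \<sigma>' x0 x'"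
    and k: "k < n" and t: "0 \<le> t" "t \<le> T"
    and b: "(\<lambda>p. b (fst p) (snd p) $ k) \<in> borel_measurable prodm" "sq_norm_proc M T (\<lambda>s \<omega>. b s \<omega> $ k) < \<infinity>"
    and b': "(\<lambda>p. b' (fst p) (snd p) $ k) \<in> borel_measurable prodm" "sq_norm_proc M T (\<lambda>s \<omega>. b' s \<omega> $ k) < \<infinity>"
  shows "(\<integral>\<^sup>+\<omega>. ennreal ((x t \<omega> $ k - x' t \<omega> $ k)\<^sup>2) \<partial>M) \<le>
    2 * (ennreal T * sq_norm_proc M t (\<lambda>s \<omega>. b s \<omega> $ k - b' s \<omega> $ k)
      + 9 * sq_norm_proc M t (\<lambda>s \<omega>. \<sigma> s \<omega> $ k - \<sigma>' s \<omega> $ k))"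
proof -
  obtain I where I: "ito_integral M F T W (\<lambda>t \<omega>. \<sigma> t \<omega> $ k) (I k)"
    and xI: "AE \<omega> in M. \<forall>t\<in>{0..T}. x t \<omega> $ k = x0 $ k + (LBINT s:{0..t}. b s \<omega> $ k) + I k t \<omega>"
    using X k unfolding sde_solution_def by blast
  obtain J where J: "ito_integral M F T W (\<lambda>t \<omega>. \<sigma>' t \<omega> $ k) (J k)"
    and xJ: "AE \<omega> in M. \<forall>t\<in>{0..T}. x' t \<omega> $ k = x0 $ k + (LBINT s:{0..t}. b' s \<omega> $ k) + J k t \<omega>"
    using X' k unfolding sde_solution_def by blast
  define f where "f s \<omega> = b s \<omega> $ k - b' s \<omega> $ k" for s \<omega>
  have fm: "(\<lambda>p. f (fst p) (snd p)) \<in> borel_measurable prodm"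
    unfolding f_def by (rule borel_measurable_diff[OF b(1) b'(1)])
  \<comment> \<open>Two summands suffice here; the second is repeated to fit the bound with
    three.\<close>
  have "sq_norm_proc M T f \<le> 3 * (sq_norm_proc M T (\<lambda>s \<omega>. b s \<omega> $ k) + sq_norm_proc M T (\<lambda>s \<omega>. b' s \<omega> $ k)
      + sq_norm_proc M T (\<lambda>s \<omega>. b' s \<omega> $ k))"
    by (rule sq_norm_proc_3[OF fm b(1) b'(1) b'(1) order_refl]) (simp add: f_def)
  also have "\<dots> < \<infinity>" using b(2) b'(2) by (simp add: ennreal_mult_less_top)
  finally have ff: "sq_norm_proc M T f < \<infinity>" .
  define Z where "Z \<omega> = (\<integral>\<^sup>+s. ennreal ((f s \<omega>)\<^sup>2) * indicator {0..t} s \<partial>lborel)" for \<omega>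
  have Zm: "Z \<in> borel_measurable M" unfolding Z_def[abs_def] by (rule section_measurable(1)[OF fm t(2)])
  have IJm: "(\<lambda>\<omega>. I k t \<omega> - J k t \<omega>) \<in> borel_measurable M"
    by (rule borel_measurable_diff[OF ito_integral_measurable(1)[OF I t] ito_integral_measurable(1)[OF J t]])
  have "(\<integral>\<^sup>+\<omega>. ennreal ((x t \<omega> $ k - x' t \<omega> $ k)\<^sup>2) \<partial>M) \<le>
      (\<integral>\<^sup>+\<omega>. 2 * (ennreal T * Z \<omega> + ennreal ((I k t \<omega> - J k t \<omega>)\<^sup>2)) \<partial>M)"
  proof (rule nn_integral_mono_AE)
    show "AE \<omega> in M. ennreal ((x t \<omega> $ k - x' t \<omega> $ k)\<^sup>2) \<le> 2 * (ennreal T * Z \<omega> + ennreal ((I k t \<omega> - J k t \<omega>)\<^sup>2))"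
      using xI xJ time_section_integrable[OF b] time_section_integrable[OF b'] time_section_integrable[OF fm ff]
    proof eventually_elim
      fix \<omega>
      assume x: "\<forall>t\<in>{0..T}. x t \<omega> $ k = x0 $ k + (LBINT s:{0..t}. b s \<omega> $ k) + I k t \<omega>"
        and x': "\<forall>t\<in>{0..T}. x' t \<omega> $ k = x0 $ k + (LBINT s:{0..t}. b' s \<omega> $ k) + J k t \<omega>"
        and B: "set_integrable lborel {0..T} (\<lambda>s. b s \<omega> $ k) \<and> set_integrable lborel {0..T} (\<lambda>s. (b s \<omega> $ k)\<^sup>2)"
        and B': "set_integrable lborel {0..T} (\<lambda>s. b' s \<omega> $ k) \<and> set_integrable lborel {0..T} (\<lambda>s. (b' s \<omega> $ k)\<^sup>2)"
        and f: "set_integrable lborel {0..T} (\<lambda>s. f s \<omega>) \<and> set_integrable lborel {0..T} (\<lambda>s. (f s \<omega>)\<^sup>2)"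
      have sub: "set_integrable lborel {0..t} g" if "set_integrable lborel {0..T} g" for g :: "real \<Rightarrow> real"
        by (rule set_integrable_subset[OF that]) (use t in auto)
      have f2: "set_integrable lborel {0..t} (\<lambda>s. (f s \<omega>)\<^sup>2)" using f sub by blast
      define D where "D = (LBINT s:{0..t}. f s \<omega>)"
      \<comment> \<open>The two integrals may be merged only because both drift paths are integrable
        on [0,t].\<close>
      have "D = (LBINT s:{0..t}. b s \<omega> $ k) - (LBINT s:{0..t}. b' s \<omega> $ k)"
        unfolding D_def f_def using B B' sub by (intro set_integral_diff(2)) blast+
      then have e: "x t \<omega> $ k - x' t \<omega> $ k = D + (I k t \<omega> - J k t \<omega>)"
        using bspec[OF x, of t] bspec[OF x', of t] t by simp
      have "D\<^sup>2 \<le> t * (LBINT s:{0..t}. (f s \<omega>)\<^sup>2)"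
        unfolding D_def using f sub by (intro set_integral_square_le t) blast+
      moreover have n: "0 \<le> (LBINT s:{0..t}. (f s \<omega>)\<^sup>2)" by (simp add: set_lebesgue_integral_def)
      ultimately have "D\<^sup>2 \<le> T * (LBINT s:{0..t}. (f s \<omega>)\<^sup>2)"
        using mult_right_mono[OF t(2) n] by linarith
      then have "ennreal (D\<^sup>2) \<le> ennreal T * ennreal (LBINT s:{0..t}. (f s \<omega>)\<^sup>2)"
        using t n by (simp add: ennreal_mult[symmetric] ennreal_leI)
      also have "ennreal (LBINT s:{0..t}. (f s \<omega>)\<^sup>2) = Z \<omega>"
      proof -
        have "(\<integral>\<^sup>+s. ennreal (indicator {0..t} s *\<^sub>R (f s \<omega>)\<^sup>2) \<partial>lborel) = ennreal (LBINT s:{0..t}. (f s \<omega>)\<^sup>2)"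
          unfolding set_lebesgue_integral_def
          by (rule nn_integral_eq_integral) (use f2 in \<open>simp_all add: set_integrable_def\<close>)
        moreover have "ennreal (indicator {0..t} s *\<^sub>R (f s \<omega>)\<^sup>2) = ennreal ((f s \<omega>)\<^sup>2) * indicator {0..t} s" for s
          by (simp add: indicator_def)
        ultimately show ?thesis by (simp add: Z_def)
      qed
      finally have D: "ennreal (D\<^sup>2) \<le> ennreal T * Z \<omega>" .
      have "(D + (I k t \<omega> - J k t \<omega>))\<^sup>2 \<le> 2 * (D\<^sup>2 + (I k t \<omega> - J k t \<omega>)\<^sup>2)"
        using sum_squares_bound[of D "I k t \<omega> - J k t \<omega>"] by (simp add: power2_sum)
      then have "ennreal ((x t \<omega> $ k - x' t \<omega> $ k)\<^sup>2) \<le> ennreal (2 * (D\<^sup>2 + (I k t \<omega> - J k t \<omega>)\<^sup>2))"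
        unfolding e by (rule ennreal_leI)
      also have "\<dots> = 2 * (ennreal (D\<^sup>2) + ennreal ((I k t \<omega> - J k t \<omega>)\<^sup>2))"
        by (subst ennreal_mult) simp_all
      also have "\<dots> \<le> 2 * (ennreal T * Z \<omega> + ennreal ((I k t \<omega> - J k t \<omega>)\<^sup>2))"
        by (intro mult_left_mono add_mono D) simp_all
      finally show "ennreal ((x t \<omega> $ k - x' t \<omega> $ k)\<^sup>2) \<le> \<dots>" .
    qed
  qed
  also have "\<dots> = 2 * (ennreal T * (\<integral>\<^sup>+\<omega>. Z \<omega> \<partial>M) + (\<integral>\<^sup>+\<omega>. ennreal ((I k t \<omega> - J k t \<omega>)\<^sup>2) \<partial>M))"
    using Zm IJm by (simp add: nn_integral_cmult nn_integral_add)
  also have "\<dots> \<le> 2 * (ennreal T * (\<integral>\<^sup>+\<omega>. Z \<omega> \<partial>M) + 9 * sq_norm_proc M t (\<lambda>s \<omega>. \<sigma> s \<omega> $ k - \<sigma>' s \<omega> $ k))"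
    by (intro mult_left_mono add_left_mono ito_integral_difference[OF I J t]) simp
  also have "(\<integral>\<^sup>+\<omega>. Z \<omega> \<partial>M) = sq_norm_proc M t (\<lambda>s \<omega>. b s \<omega> $ k - b' s \<omega> $ k)"
    by (simp add: sq_norm_proc_def Z_def f_def)
  finally show ?thesis .
qed

text \<open>The pointwise bound is required almost everywhere because the coefficients can be
  compared only where the controls coincide. The same estimate also shows that bounded matrices
  preserve finite norms.\<close>

lemma sq_norm_proc_lipschitz:
  assumes y: "\<And>l. l < n \<Longrightarrow> (\<lambda>p. y l (fst p) (snd p)) \<in> borel_measurable prodm"
    and f: "(\<lambda>p. f (fst p) (snd p)) \<in> borel_measurable prodm"
    and L: "0 \<le> L" and le: "AE p in prodm. (f (fst p) (snd p))\<^sup>2 \<le> L * (\<Sum>l<n. (y l (fst p) (snd p))\<^sup>2)"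
    and t: "t \<le> T"
  shows "sq_norm_proc M t f \<le> ennreal L * (\<Sum>l<n. sq_norm_proc M t (y l))"
proof -
  have i: "(\<lambda>p. indicator {0..t} (fst p) :: ennreal) \<in> borel_measurable prodm"
  proof -
    have "indicator {0..t} \<in> borel_measurable (restrict_space lborel {0..T})"
      by (rule measurable_restrict_space1) simp
    from measurable_compose[OF measurable_fst this] show ?thesis unfolding prodm_def .
  qed
  have m: "(\<lambda>p. ennreal ((y l (fst p) (snd p))\<^sup>2) * indicator {0..t} (fst p)) \<in> borel_measurable prodm" if "l < n" for l
    by (rule borel_measurable_times_ennreal[OF measurable_compose[OF borel_measurable_power[OF y[OF that]] measurable_ennreal] i])
  have "sq_norm_proc M t f \<le>
      (\<integral>\<^sup>+p. ennreal L * (\<Sum>l<n. ennreal ((y l (fst p) (snd p))\<^sup>2) * indicator {0..t} (fst p)) \<partial>prodm)"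
    unfolding sq_norm_proc_eq(1)[OF f t]
  proof (rule nn_integral_mono_AE, use le in eventually_elim)
    fix p assume "(f (fst p) (snd p))\<^sup>2 \<le> L * (\<Sum>l<n. (y l (fst p) (snd p))\<^sup>2)"
    then have "ennreal ((f (fst p) (snd p))\<^sup>2) \<le> ennreal (L * (\<Sum>l<n. (y l (fst p) (snd p))\<^sup>2))"
      by (rule ennreal_leI)
    also have "\<dots> = ennreal L * (\<Sum>l<n. ennreal ((y l (fst p) (snd p))\<^sup>2))"
      using L by (subst ennreal_mult) (simp_all add: sum_nonneg)
    finally show "ennreal ((f (fst p) (snd p))\<^sup>2) * indicator {0..t} (fst p) \<le>
        ennreal L * (\<Sum>l<n. ennreal ((y l (fst p) (snd p))\<^sup>2) * indicator {0..t} (fst p))"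
      by (cases "fst p \<in> {0..t}") simp_all
  qed
  also have "\<dots> = ennreal L * (\<integral>\<^sup>+p. (\<Sum>l<n. ennreal ((y l (fst p) (snd p))\<^sup>2) * indicator {0..t} (fst p)) \<partial>prodm)"
    by (rule nn_integral_cmult) (use m in simp)
  also have "(\<integral>\<^sup>+p. (\<Sum>l<n. ennreal ((y l (fst p) (snd p))\<^sup>2) * indicator {0..t} (fst p)) \<partial>prodm) =
      (\<Sum>l<n. (\<integral>\<^sup>+p. ennreal ((y l (fst p) (snd p))\<^sup>2) * indicator {0..t} (fst p) \<partial>prodm))"
    by (rule nn_integral_sum) (use m in simp)
  also have "\<dots> = (\<Sum>l<n. sq_norm_proc M t (y l))"
    using sq_norm_proc_eq(1)[OF y t] by simp
  finally show ?thesis .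
qed

text \<open>The rationals of the open interval are dense in the closed one, and this is where a
  nondegenerate horizon enters.\<close>

lemma continuous_on_zero_rationals:
  fixes f :: "real \<Rightarrow> real"
  assumes f: "continuous_on {0..T} f" and T: "0 < T" and z: "\<And>q. q \<in> \<rat> \<inter> {0..T} \<Longrightarrow> f q = 0" and t: "t \<in> {0..T}"
  shows "f t = 0"
proof -
  have "closure ({0<..<T} \<inter> \<rat>) = closure {0<..<T}"
    by (rule closure_open_Int_superset) (simp_all add: Rats_closure_real)
  then have c: "closure ({0<..<T} \<inter> \<rat>) = {0..T}" using T by simp
  show ?thesis
    by (rule continuous_constant_on_closure[where S = "{0<..<T} \<inter> \<rat>" and f = f]) (use f z t c in auto)
qed

text \<open>The coefficients are processes already evaluated along the solutions, so the Lipschitz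
  condition compares two processes instead of constraining a function of the state. This fits the
  two state equations, whose coefficients have different forms and are comparable only under the
  coincidence of the controls.\<close>

lemma sde_pathwise_unique:
  assumes T: "0 < T"
    and X: "sde_solution M F T W n b \<sigma> x0 x" and X': "sde_solution M F T W n b' \<sigma>' x0 x'"
    and b: "\<And>k. k < n \<Longrightarrow> (\<lambda>p. b (fst p) (snd p) $ k) \<in> borel_measurable prodm"
      "\<And>k. k < n \<Longrightarrow> sq_norm_proc M T (\<lambda>s \<omega>. b s \<omega> $ k) < \<infinity>"
    and b': "\<And>k. k < n \<Longrightarrow> (\<lambda>p. b' (fst p) (snd p) $ k) \<in> borel_measurable prodm"
      "\<And>k. k < n \<Longrightarrow> sq_norm_proc M T (\<lambda>s \<omega>. b' s \<omega> $ k) < \<infinity>"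
    and L: "0 \<le> L"
    and lip: "AE p in prodm. \<forall>k<n.
      (b (fst p) (snd p) $ k - b' (fst p) (snd p) $ k)\<^sup>2
        \<le> L * (\<Sum>l<n. (x (fst p) (snd p) $ l - x' (fst p) (snd p) $ l)\<^sup>2) \<and>
      (\<sigma> (fst p) (snd p) $ k - \<sigma>' (fst p) (snd p) $ k)\<^sup>2
        \<le> L * (\<Sum>l<n. (x (fst p) (snd p) $ l - x' (fst p) (snd p) $ l)\<^sup>2)"
  shows "AE \<omega> in M. \<forall>t\<in>{0..T}. x t \<omega> = x' t \<omega>"
proof -
  define y where "y l s \<omega> = x s \<omega> $ l - x' s \<omega> $ l" for l s \<omega>
  have T0: "0 \<le> T" using T by simp
  have L2: "x \<in> L2F_vec M F T n" "x' \<in> L2F_vec M F T n"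
    using X X' unfolding sde_solution_def by auto
  have comp: "(\<lambda>p. z (fst p) (snd p) $ l) \<in> borel_measurable prodm \<and> sq_norm_proc M T (\<lambda>s \<omega>. z s \<omega> $ l) < \<infinity>"
    if "z \<in> L2F_vec M F T n" "l < n" for z l
    using that progressive_measurable[OF _ T0] unfolding L2F_vec_def L2F_def by auto
  have ym: "(\<lambda>p. y l (fst p) (snd p)) \<in> borel_measurable prodm" if "l < n" for l
    unfolding y_def using comp[OF L2(1) that] comp[OF L2(2) that] by (intro borel_measurable_diff) auto
  have yf: "sq_norm_proc M T (y l) < \<infinity>" if l: "l < n" for l
  proof -
    have "sq_norm_proc M T (y l) \<le> 3 * (sq_norm_proc M T (\<lambda>s \<omega>. x s \<omega> $ l) + sq_norm_proc M T (\<lambda>s \<omega>. x' s \<omega> $ l)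
        + sq_norm_proc M T (\<lambda>s \<omega>. x' s \<omega> $ l))"
      by (rule sq_norm_proc_3[OF ym[OF l] _ _ _ order_refl])
         (use comp[OF L2(1) l] comp[OF L2(2) l] in \<open>auto simp: y_def\<close>)
    also have "\<dots> < \<infinity>" using comp[OF L2(1) l] comp[OF L2(2) l] by (simp add: ennreal_mult_less_top)
    finally show ?thesis .
  qed
  define S where "S t = (\<Sum>l<n. sq_norm_proc M t (y l))" for t
  define h where "h t = (\<Sum>l<n. (\<integral>\<^sup>+\<omega>. ennreal ((y l t \<omega>)\<^sup>2) \<partial>M))" for t
  \<comment> \<open>Each of the \<open>n\<close> components obeys
    \<open>sde_difference_bound\<close>, in which the Lipschitz bound replaces both norms by
    \<open>L\<close> times \<open>S t\<close>.\<close>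
  define C where "C = real n * (2 * (T * L + 9 * L))"
  have C: "0 \<le> C" using L T by (simp add: C_def)
  have hS: "h t \<le> ennreal C * S t" if t: "t \<in> {0..T}" for t
  proof -
    have t': "0 \<le> t" "t \<le> T" using t by auto
    have "(\<integral>\<^sup>+\<omega>. ennreal ((y k t \<omega>)\<^sup>2) \<partial>M) \<le> ennreal (2 * (T * L + 9 * L)) * S t" if k: "k < n" for k
    proof -
      \<comment> \<open>Joint measurability of the diffusion processes comes with
        \<open>ito_integral\<close>, which demands its integrand in \<open>L2F\<close>.\<close>
      obtain I J where IJ: "ito_integral M F T W (\<lambda>t \<omega>. \<sigma> t \<omega> $ k) I" "ito_integral M F T W (\<lambda>t \<omega>. \<sigma>' t \<omega> $ k) J"
        using X X' k unfolding sde_solution_def by blast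
      have fb: "sq_norm_proc M t (\<lambda>s \<omega>. b s \<omega> $ k - b' s \<omega> $ k) \<le> ennreal L * S t"
        unfolding S_def
      proof (rule sq_norm_proc_lipschitz[OF ym _ L _ t'(2)])
        show "(\<lambda>p. b (fst p) (snd p) $ k - b' (fst p) (snd p) $ k) \<in> borel_measurable prodm"
          by (rule borel_measurable_diff[OF b(1)[OF k] b'(1)[OF k]])
        show "AE p in prodm. (b (fst p) (snd p) $ k - b' (fst p) (snd p) $ k)\<^sup>2 \<le> L * (\<Sum>l<n. (y l (fst p) (snd p))\<^sup>2)"
          using lip by eventually_elim (use k in \<open>auto simp: y_def\<close>)
      qed
      have fs: "sq_norm_proc M t (\<lambda>s \<omega>. \<sigma> s \<omega> $ k - \<sigma>' s \<omega> $ k) \<le> ennreal L * S t"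
        unfolding S_def
      proof (rule sq_norm_proc_lipschitz[OF ym _ L _ t'(2)])
        show "(\<lambda>p. \<sigma> (fst p) (snd p) $ k - \<sigma>' (fst p) (snd p) $ k) \<in> borel_measurable prodm"
          by (rule borel_measurable_diff[OF ito_integral_measurable(2)[OF IJ(1) t'] ito_integral_measurable(2)[OF IJ(2) t']])
        show "AE p in prodm. (\<sigma> (fst p) (snd p) $ k - \<sigma>' (fst p) (snd p) $ k)\<^sup>2 \<le> L * (\<Sum>l<n. (y l (fst p) (snd p))\<^sup>2)"
          using lip by eventually_elim (use k in \<open>auto simp: y_def\<close>)
      qed
      have "(\<integral>\<^sup>+\<omega>. ennreal ((y k t \<omega>)\<^sup>2) \<partial>M) \<le> 2 * (ennreal T * (ennreal L * S t) + 9 * (ennreal L * S t))"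
        unfolding y_def
        by (rule order_trans[OF sde_difference_bound[OF X X' k t' b(1)[OF k] b(2)[OF k] b'(1)[OF k] b'(2)[OF k]]])
           (intro mult_left_mono add_mono fb fs; simp)
      also have "\<dots> = ennreal (2 * (T * L + 9 * L)) * S t"
        using L T by (simp add: ennreal_mult distrib_left distrib_right mult.assoc)
      finally show ?thesis .
    qed
    then have "h t \<le> (\<Sum>k<n. ennreal (2 * (T * L + 9 * L)) * S t)" unfolding h_def by (intro sum_mono) simp
    also have "\<dots> = ennreal C * S t"
      unfolding C_def using L T by (subst ennreal_mult) (simp_all add: mult.assoc ennreal_of_nat_eq_real_of_nat)
    finally show ?thesis .
  qed
  have Sh: "S t = (\<integral>\<^sup>+s. h s * indicator {0..t} s \<partial>lborel)" if t: "t \<le> T" for t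
  proof -
    have "S t = (\<Sum>l<n. (\<integral>\<^sup>+s. (\<integral>\<^sup>+\<omega>. ennreal ((y l s \<omega>)\<^sup>2) \<partial>M) * indicator {0..t} s \<partial>lborel))"
      unfolding S_def using sq_norm_proc_eq(2)[OF ym t] by simp
    also have "\<dots> = (\<integral>\<^sup>+s. (\<Sum>l<n. (\<integral>\<^sup>+\<omega>. ennreal ((y l s \<omega>)\<^sup>2) \<partial>M) * indicator {0..t} s) \<partial>lborel)"
      by (rule nn_integral_sum[symmetric]) (use section_measurable(2)[OF ym t] in simp)
    finally show ?thesis by (simp add: h_def sum_distrib_right)
  qed
  \<comment> \<open>Finiteness of the total norm supplies the uniform bound on \<open>h\<close> from
    which the Gronwall iteration starts.\<close>
  have "S T < \<infinity>" unfolding S_def using yf by simp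
  then obtain r where r: "0 \<le> r" "S T = ennreal r" by (cases "S T") auto
  have zero: "h t = 0" if t: "t \<in> {0..T}" for t
  proof (rule gronwall_zero[OF _ _ C _ t])
    show "0 \<le> C * r" using C r by simp
    fix t assume t: "t \<in> {0..T}"
    have "S t \<le> S T" unfolding S_def using t by (intro sum_mono sq_norm_proc_mono) simp
    then have "ennreal C * S t \<le> ennreal C * ennreal r" unfolding r(2)[symmetric] by (rule mult_left_mono) simp
    then show "h t \<le> ennreal (C * r)" using hS[OF t] C r by (simp add: ennreal_mult)
    show "h t \<le> ennreal C * (\<integral>\<^sup>+s. h s * indicator {0..t} s \<partial>lborel)"
      using hS[OF t] Sh[of t] t by simp
  qed
  have "AE \<omega> in M. \<forall>l<n. y l t \<omega> = 0" if t: "t \<in> {0..T}" for t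
  proof -
    have "AE \<omega> in M. y l t \<omega> = 0" if l: "l \<in> {..<n}" for l
    proof -
      have "(\<integral>\<^sup>+\<omega>. ennreal ((y l t \<omega>)\<^sup>2) \<partial>M) = 0" using zero[OF t] l unfolding h_def by simp
      moreover have "(\<lambda>\<omega>. y l t \<omega>) \<in> borel_measurable M"
        using section_measurable(3)[OF ym order_refl] t l by simp
      ultimately have "AE \<omega> in M. ennreal ((y l t \<omega>)\<^sup>2) = 0" by (subst (asm) nn_integral_0_iff_AE) simp_all
      then show ?thesis by eventually_elim simp
    qed
    then have "AE \<omega> in M. \<forall>l\<in>{..<n}. y l t \<omega> = 0" by (intro AE_finite_allI) auto
    then show ?thesis by eventually_elim simp
  qed
  \<comment> \<open>So far the null set depends on the time. Countably many times share one null
    set, and continuity of the paths extends the equality from the rational times to all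
    times.\<close>
  then have rat: "AE \<omega> in M. \<forall>q\<in>\<rat> \<inter> {0..T}. \<forall>l<n. y l q \<omega> = 0"
    by (intro AE_ball_countable[THEN iffD2]) (auto intro: countable_subset[OF Int_lower1 countable_rat])
  have cont: "AE \<omega> in M. \<forall>l\<in>{..<n}. continuous_on {0..T} (\<lambda>t. z t \<omega> $ l)" if "sde_solution M F T W n b \<sigma> x0 z" for b \<sigma> z
    using that unfolding sde_solution_def by (intro AE_finite_allI) auto
  show ?thesis
    using rat cont[OF X] cont[OF X'] AE_space
  proof eventually_elim
    fix \<omega> assume r: "\<forall>q\<in>\<rat> \<inter> {0..T}. \<forall>l<n. y l q \<omega> = 0"
      and c: "\<forall>l\<in>{..<n}. continuous_on {0..T} (\<lambda>t. x t \<omega> $ l)" "\<forall>l\<in>{..<n}. continuous_on {0..T} (\<lambda>t. x' t \<omega> $ l)"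
      and \<omega>: "\<omega> \<in> space M"
    show "\<forall>t\<in>{0..T}. x t \<omega> = x' t \<omega>"
    proof
      fix t assume t: "t \<in> {0..T}"
      have carr: "x t \<omega> \<in> carrier_vec n" "x' t \<omega> \<in> carrier_vec n" using L2 t \<omega> unfolding L2F_vec_def by auto
      show "x t \<omega> = x' t \<omega>"
      proof (rule eq_vecI)
        fix l assume "l < dim_vec (x' t \<omega>)"
        then have l: "l < n" using carr by simp
        have "continuous_on {0..T} (\<lambda>t. y l t \<omega>)"
          unfolding y_def using c l by (intro continuous_on_diff) auto
        then have "y l t \<omega> = 0" by (rule continuous_on_zero_rationals[OF _ T _ t]) (use r l in auto)
        then show "x t \<omega> $ l = x' t \<omega> $ l" by (simp add: y_def)
      qed (use carr in simp)
    qed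
  qed
qed

end

subsection \<open>Square integrable vector processes\<close>

context brownian_filtration
begin

text \<open>Joint measurability takes the place of progressive measurability: drifts are integrated
  over time only, and products with deterministic measurable matrices stay in this class by an
  entrywise argument.\<close>

definition sq_integrable :: "nat \<Rightarrow> 'w vproc \<Rightarrow> bool" where
  "sq_integrable d \<phi> \<longleftrightarrow> (\<forall>t\<in>{0..T}. \<forall>\<omega>\<in>space M. \<phi> t \<omega> \<in> carrier_vec d) \<and>
     (\<forall>k<d. (\<lambda>p. \<phi> (fst p) (snd p) $ k) \<in> borel_measurable prodm \<and> sq_norm_proc M T (\<lambda>s \<omega>. \<phi> s \<omega> $ k) < \<infinity>)"

lemma space_prodm: "p \<in> space prodm \<Longrightarrow> fst p \<in> {0..T} \<and> snd p \<in> space M"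
  by (auto simp: prodm_def space_pair_measure space_restrict_space)

text \<open>As for matrices, the components need an explicit formula only at points of the product
  space, where dimensions are known. Finiteness of the norm is inherited from \<open>\<psi>\<close>,
  whose dimension may differ.\<close>

lemma sq_integrableI:
  assumes c: "\<And>t \<omega>. t \<in> {0..T} \<Longrightarrow> \<omega> \<in> space M \<Longrightarrow> \<phi> t \<omega> \<in> carrier_vec d"
    and m: "\<And>k. k < d \<Longrightarrow> f k \<in> borel_measurable prodm"
    and eq: "\<And>k t \<omega>. k < d \<Longrightarrow> t \<in> {0..T} \<Longrightarrow> \<omega> \<in> space M \<Longrightarrow> \<phi> t \<omega> $ k = f k (t, \<omega>)"
    and L: "0 \<le> L" and psi: "sq_integrable e \<psi>"
    and le: "\<And>k t \<omega>. k < d \<Longrightarrow> t \<in> {0..T} \<Longrightarrow> \<omega> \<in> space M \<Longrightarrow> (\<phi> t \<omega> $ k)\<^sup>2 \<le> L * (\<Sum>l<e. (\<psi> t \<omega> $ l)\<^sup>2)"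
  shows "sq_integrable d \<phi>"
  unfolding sq_integrable_def
proof (intro conjI ballI allI impI)
  fix k assume k: "k < d"
  have "(\<lambda>p. \<phi> (fst p) (snd p) $ k) \<in> borel_measurable prodm \<longleftrightarrow> f k \<in> borel_measurable prodm"
    by (rule measurable_cong) (use eq[OF k] space_prodm in \<open>metis prod.collapse\<close>)
  then show km: "(\<lambda>p. \<phi> (fst p) (snd p) $ k) \<in> borel_measurable prodm" using m[OF k] by simp
  have "sq_norm_proc M T (\<lambda>s \<omega>. \<phi> s \<omega> $ k) \<le> ennreal L * (\<Sum>l<e. sq_norm_proc M T (\<lambda>s \<omega>. \<psi> s \<omega> $ l))"
  proof (rule sq_norm_proc_lipschitz[OF _ km L _ order_refl])
    show "(\<lambda>p. \<psi> (fst p) (snd p) $ l) \<in> borel_measurable prodm" if "l < e" for l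
      using psi that unfolding sq_integrable_def by blast
    show "AE p in prodm. (\<phi> (fst p) (snd p) $ k)\<^sup>2 \<le> L * (\<Sum>l<e. (\<psi> (fst p) (snd p) $ l)\<^sup>2)"
      by (rule AE_I2) (use le[OF k] space_prodm in blast)
  qed
  also have "\<dots> < \<infinity>"
    using psi unfolding sq_integrable_def by (simp add: ennreal_mult_less_top)
  finally show "sq_norm_proc M T (\<lambda>s \<omega>. \<phi> s \<omega> $ k) < \<infinity>" .
qed (use c in blast)

lemma sq_integrable_mult:
  assumes X: "bounded_coeff T r c X" and phi: "sq_integrable c \<phi>"
  shows "sq_integrable r (\<lambda>t \<omega>. X t *\<^sub>v \<phi> t \<omega>)"
proof -
  obtain L where L: "0 \<le> L"
    "\<And>t y k. t \<in> {0..T} \<Longrightarrow> y \<in> carrier_vec c \<Longrightarrow> k < r \<Longrightarrow> ((X t *\<^sub>v y) $ k)\<^sup>2 \<le> L * (\<Sum>l<c. (y $ l)\<^sup>2)"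
    using bounded_coeff_lipschitz[OF X] by blast
  have carr: "\<phi> t \<omega> \<in> carrier_vec c" if "t \<in> {0..T}" "\<omega> \<in> space M" for t \<omega>
    using phi that unfolding sq_integrable_def by blast
  have sets: "sets (restrict_space lborel {0..T}) = sets (restrict_space borel {0..T})"
    by (simp add: sets_restrict_space)
  show ?thesis
  proof (rule sq_integrableI[OF _ _ _ L(1) phi,
        where f = "\<lambda>k p. \<Sum>l<c. X (fst p) $$ (k, l) * \<phi> (fst p) (snd p) $ l"], goal_cases)
    case (1 t \<omega>)
    then show ?case using bounded_coeffD(1)[OF X 1(1)] carr by simp
  next
    case (2 k)
    show ?case
    proof (intro borel_measurable_sum borel_measurable_times)
      fix l assume l: "l \<in> {..<c}"
      then have "(\<lambda>t. X t $$ (k, l)) \<in> borel_measurable (restrict_space borel {0..T})"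
        using bdd_meas_measurable[OF bounded_coeffD(2)[OF X 2, of l]] by simp
      then have "(\<lambda>t. X t $$ (k, l)) \<in> borel_measurable (restrict_space lborel {0..T})"
        using measurable_cong_sets[OF sets refl] by blast
      from measurable_compose[OF measurable_fst this]
      show "(\<lambda>p. X (fst p) $$ (k, l)) \<in> borel_measurable prodm" unfolding prodm_def .
      show "(\<lambda>p. \<phi> (fst p) (snd p) $ l) \<in> borel_measurable prodm"
        using phi l unfolding sq_integrable_def by blast
    qed
  next
    case (3 k t \<omega>)
    then show ?case
      using bounded_coeffD(1)[OF X 3(2)] carr[OF 3(2,3)] by (simp add: scalar_prod_def atLeast0LessThan)
  next
    case (4 k t \<omega>)
    then show ?case using L(2) carr by blast
  qed
qed

lemma sq_integrable_add:
  assumes phi: "sq_integrable d \<phi>" and psi: "sq_integrable d \<psi>"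
  shows "sq_integrable d (\<lambda>t \<omega>. \<phi> t \<omega> + \<psi> t \<omega>)"
  unfolding sq_integrable_def
proof (intro conjI ballI allI impI)
  have carr: "\<phi> t \<omega> \<in> carrier_vec d" "\<psi> t \<omega> \<in> carrier_vec d" if "t \<in> {0..T}" "\<omega> \<in> space M" for t \<omega>
    using phi psi that unfolding sq_integrable_def by blast+
  show "\<phi> t \<omega> + \<psi> t \<omega> \<in> carrier_vec d" if "t \<in> {0..T}" "\<omega> \<in> space M" for t \<omega>
    using carr[OF that] by simp
  fix k assume k: "k < d"
  have m: "(\<lambda>p. \<phi> (fst p) (snd p) $ k) \<in> borel_measurable prodm" "(\<lambda>p. \<psi> (fst p) (snd p) $ k) \<in> borel_measurable prodm"
    and f: "sq_norm_proc M T (\<lambda>s \<omega>. \<phi> s \<omega> $ k) < \<infinity>" "sq_norm_proc M T (\<lambda>s \<omega>. \<psi> s \<omega> $ k) < \<infinity>"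
    using phi psi k unfolding sq_integrable_def by blast+
  have eq: "(\<phi> t \<omega> + \<psi> t \<omega>) $ k = \<phi> t \<omega> $ k + \<psi> t \<omega> $ k" if "t \<in> {0..T}" "\<omega> \<in> space M" for t \<omega>
    using carr[OF that] k by simp
  have s: "(\<lambda>p. \<phi> (fst p) (snd p) $ k + \<psi> (fst p) (snd p) $ k) \<in> borel_measurable prodm"
    by (rule borel_measurable_add[OF m])
  have "(\<lambda>p. (\<phi> (fst p) (snd p) + \<psi> (fst p) (snd p)) $ k) \<in> borel_measurable prodm \<longleftrightarrow>
      (\<lambda>p. \<phi> (fst p) (snd p) $ k + \<psi> (fst p) (snd p) $ k) \<in> borel_measurable prodm"
    by (rule measurable_cong) (use eq space_prodm in blast)
  then show "(\<lambda>p. (\<phi> (fst p) (snd p) + \<psi> (fst p) (snd p)) $ k) \<in> borel_measurable prodm" using s by blast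
  have "sq_norm_proc M T (\<lambda>s \<omega>. (\<phi> s \<omega> + \<psi> s \<omega>) $ k) = sq_norm_proc M T (\<lambda>s \<omega>. \<phi> s \<omega> $ k + \<psi> s \<omega> $ k)"
    unfolding sq_norm_proc_def
  proof (intro nn_integral_cong)
    fix \<omega> s assume "\<omega> \<in> space M"
    then show "ennreal (((\<phi> s \<omega> + \<psi> s \<omega>) $ k)\<^sup>2) * indicator {0..T} s = ennreal ((\<phi> s \<omega> $ k + \<psi> s \<omega> $ k)\<^sup>2) * indicator {0..T} s"
      using eq[of s \<omega>] by (cases "s \<in> {0..T}") simp_all
  qed
  also have "\<dots> \<le> 3 * (sq_norm_proc M T (\<lambda>s \<omega>. \<phi> s \<omega> $ k) + sq_norm_proc M T (\<lambda>s \<omega>. \<psi> s \<omega> $ k)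
      + sq_norm_proc M T (\<lambda>s \<omega>. \<psi> s \<omega> $ k))"
    by (rule sq_norm_proc_3[OF s m(1) m(2) m(2) order_refl]) linarith
  also have "\<dots> < \<infinity>" using f by (simp add: ennreal_mult_less_top)
  finally show "sq_norm_proc M T (\<lambda>s \<omega>. (\<phi> s \<omega> + \<psi> s \<omega>) $ k) < \<infinity>" .
qed

lemma sq_integrable_L2F_vec:
  assumes "\<phi> \<in> L2F_vec M F T d" "0 \<le> T"
  shows "sq_integrable d \<phi>"
  using assms progressive_measurable[OF _ assms(2)] unfolding sq_integrable_def L2F_vec_def L2F_def by auto

lemma sq_integrable_smult:
  assumes phi: "sq_integrable d \<phi>"
  shows "sq_integrable d (\<lambda>t \<omega>. c \<cdot>\<^sub>v \<phi> t \<omega>)"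
proof -
  have carr: "\<phi> t \<omega> \<in> carrier_vec d" if "t \<in> {0..T}" "\<omega> \<in> space M" for t \<omega>
    using phi that unfolding sq_integrable_def by blast
  show ?thesis
  proof (rule sq_integrableI[OF _ _ _ zero_le_power2[of c] phi, where f = "\<lambda>k p. c * \<phi> (fst p) (snd p) $ k"],
      goal_cases)
    case (1 t \<omega>)
    then show ?case using carr by simp
  next
    case (2 k)
    have "(\<lambda>p. \<phi> (fst p) (snd p) $ k) \<in> borel_measurable prodm"
      using phi 2 unfolding sq_integrable_def by blast
    then show ?case by (intro borel_measurable_times borel_measurable_const)
  next
    case (3 k t \<omega>)
    then show ?case using carr[OF 3(2,3)] by simp
  next
    case (4 k t \<omega>)
    have "(\<phi> t \<omega> $ k)\<^sup>2 \<le> (\<Sum>l<d. (\<phi> t \<omega> $ l)\<^sup>2)"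
      by (rule member_le_sum[where f = "\<lambda>l. (\<phi> t \<omega> $ l)\<^sup>2"]) (use 4 in simp_all)
    then show ?case using carr[OF 4(2,3)] 4(1) by (simp add: power_mult_distrib mult_left_mono)
  qed
qed

lemma sq_integrable_uminus:
  assumes "sq_integrable d \<phi>"
  shows "sq_integrable d (\<lambda>t \<omega>. - \<phi> t \<omega>)"
proof -
  have "- v = (- 1) \<cdot>\<^sub>v v" for v :: "real vec" by (rule eq_vecI) simp_all
  then show ?thesis using sq_integrable_smult[OF assms, of "- 1"] by simp
qed

end

text \<open>The controls are assumed equal almost everywhere for time and probability, the sense in
  which elements of the square-integrable class are identified. Indistinguishability of the states
  can still be concluded because their paths are continuous.\<close>

theorem mainTheorem6:
  fixes M :: "'w measure"
    and F :: "real \<Rightarrow> 'w measure"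
    and W :: "real \<Rightarrow> 'w \<Rightarrow> real"
    and G :: game
    and P :: "real \<Rightarrow> real mat"
    and \<eta> \<zeta> :: incentive
    and x0 :: "real vec"
    and u_plus :: "nat \<Rightarrow> 'w vproc"
    and x_bar x_tilde :: "'w vproc"
  assumes "prob_space M"
    and "complete_measure M"
    and "F = augmented_filtration M W"
    and "brownian_motion M F (hor G) W"
    and "standing_assumptions G"
    and "x0 \<in> carrier_vec (dimx G)"
    and "riccati_solution G P"
    and "team_optimal_trajectory M F W G P x0 x_bar"
    and "incentive_parameters G \<eta> \<zeta>"
    and "open_loop_nash M F W G P \<eta> \<zeta> x0 u_plus"
    and "level2_state M F W G P \<eta> \<zeta> x0 u_plus x_tilde"
    and "\<forall>i\<in>{1, 2}. AE (t, \<omega>) in restrict_space lborel {0..hor G} \<Otimes>\<^sub>M M.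
           u_plus i t \<omega> = uc_star G P x_bar i t \<omega>"
  shows "AE \<omega> in M. \<forall>t\<in>{0..hor G}. x_tilde t \<omega> = x_bar t \<omega>"
proof -
  interpret brownian_filtration M F "hor G" W
    by (rule brownian_filtration.intro[OF assms(1) brownian_filtration_axioms.intro[OF assms(3,4)]])
  interpret riccati_game G P \<eta> \<zeta>
    by (rule riccati_game.intro[OF assms(5,7,9)])
  have T: "0 < hor G" using assms(5) unfolding standing_assumptions_def Let_def by blast
  then have T0: "0 \<le> hor G" by simp
  note X = assms(11)[unfolded level2_state_def]
    and X' = assms(8)[unfolded team_optimal_trajectory_def state_solution_def]
  let ?b = "\<lambda>t \<omega>. A_bar G P \<eta> \<zeta> t *\<^sub>v x_tilde t \<omega> + sum2 (\<lambda>i. Bc_bar G \<eta> \<zeta> i t *\<^sub>v u_plus i t \<omega>)"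
  let ?b' = "\<lambda>t \<omega>. cA G t *\<^sub>v x_bar t \<omega> + sum2 (\<lambda>i. cB1 G i t *\<^sub>v u1_star G P x_bar i t \<omega>)
      + sum2 (\<lambda>i. sum3 (\<lambda>j. cB2 G i j t *\<^sub>v u2_star G P x_bar i j t \<omega>))
      + sum3 (\<lambda>j. sum2 (\<lambda>i. cB3 G j i t *\<^sub>v u3_star G P x_bar j i t \<omega>)) + cE G t *\<^sub>v v_star G P x_bar t \<omega>"
  let ?s = "\<lambda>t \<omega>. C_bar G P \<eta> \<zeta> t *\<^sub>v x_tilde t \<omega> + sum2 (\<lambda>i. Dc_bar G \<eta> \<zeta> i t *\<^sub>v u_plus i t \<omega>)"
  let ?s' = "\<lambda>t \<omega>. cC G t *\<^sub>v x_bar t \<omega> + sum2 (\<lambda>i. cD1 G i t *\<^sub>v u1_star G P x_bar i t \<omega>)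
      + sum2 (\<lambda>i. sum3 (\<lambda>j. cD2 G i j t *\<^sub>v u2_star G P x_bar i j t \<omega>))
      + sum3 (\<lambda>j. sum2 (\<lambda>i. cD3 G j i t *\<^sub>v u3_star G P x_bar j i t \<omega>))"
  have x2: "x_tilde \<in> L2F_vec M F (hor G) (dimx G)" "x_bar \<in> L2F_vec M F (hor G) (dimx G)"
    using X X' unfolding sde_solution_def by blast+
  have u2: "u_plus i \<in> L2F_vec M F (hor G) (dim_c G i)" if "i \<in> {1, 2}" for i
    using assms(10) that unfolding open_loop_nash_def by blast
  note xt = sq_integrable_L2F_vec[OF x2(1) T0] and xb = sq_integrable_L2F_vec[OF x2(2) T0]
  \<comment> \<open>The notion of a solution includes no integrability of the drift, so it is
    derived here from bounded coefficients and square-integrable states and controls.\<close>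
  have b: "sq_integrable (dimx G) ?b"
    by (intro sq_integrable_add sq_integrable_mult[OF A_bar_bounded xt]
        sq_integrable_mult[OF Bc_bar_bounded sq_integrable_L2F_vec[OF u2 T0]]) simp_all
  have u1: "sq_integrable (dim1 G i) (u1_star G P x_bar i)" if "i \<in> {1, 2}" for i
    unfolding u1_star_def[abs_def] by (intro sq_integrable_uminus sq_integrable_mult[OF K1_bounded[OF that] xb])
  have u2: "sq_integrable (dim2 G i j) (u2_star G P x_bar i j)" if "i \<in> {1, 2}" "j \<in> {1, 2, 3}" for i j
    unfolding u2_star_def[abs_def] by (intro sq_integrable_uminus sq_integrable_mult[OF K2_bounded[OF that] xb])
  have u3: "sq_integrable (dim3 G j i) (u3_star G P x_bar j i)" if "i \<in> {1, 2}" "j \<in> {1, 2, 3}" for i j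
    unfolding u3_star_def[abs_def] by (intro sq_integrable_uminus sq_integrable_mult[OF K3_bounded[OF that] xb])
  have v: "sq_integrable (dimv G) (v_star G P x_bar)"
    unfolding v_star_def[abs_def]
    by (intro sq_integrable_smult sq_integrable_mult[OF bounded_coeff_mult[OF
          bounded_coeff_transpose[OF basic_bounded(3)] P_bounded] xb])
  have b': "sq_integrable (dimx G) ?b'"
    by (intro sq_integrable_add sq_integrable_mult[OF basic_bounded(1) xb] sq_integrable_mult[OF basic_bounded(3) v]
        sq_integrable_mult[OF level1_bounded(1) u1] sq_integrable_mult[OF level23_bounded(1) u2]
        sq_integrable_mult[OF level23_bounded(3) u3]) simp_all
  obtain LA where LA: "0 \<le> LA" "\<And>t y k. t \<in> {0..hor G} \<Longrightarrow> y \<in> carrier_vec (dimx G) \<Longrightarrow> k < dimx G \<Longrightarrow>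
      ((A_bar G P \<eta> \<zeta> t *\<^sub>v y) $ k)\<^sup>2 \<le> LA * (\<Sum>l<dimx G. (y $ l)\<^sup>2)"
    using bounded_coeff_lipschitz[OF A_bar_bounded] by blast
  obtain LC where LC: "0 \<le> LC" "\<And>t y k. t \<in> {0..hor G} \<Longrightarrow> y \<in> carrier_vec (dimx G) \<Longrightarrow> k < dimx G \<Longrightarrow>
      ((C_bar G P \<eta> \<zeta> t *\<^sub>v y) $ k)\<^sup>2 \<le> LC * (\<Sum>l<dimx G. (y $ l)\<^sup>2)"
    using bounded_coeff_lipschitz[OF C_bar_bounded] by blast
  have ae: "AE p in prodm. u_plus 1 (fst p) (snd p) = uc_star G P x_bar 1 (fst p) (snd p)"
    "AE p in prodm. u_plus 2 (fst p) (snd p) = uc_star G P x_bar 2 (fst p) (snd p)"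
    using assms(12) unfolding prodm_def case_prod_unfold by blast+
  show ?thesis
  \<comment> \<open>The sum \<open>LA + LC\<close> is a common Lipschitz constant for the drift and
    the diffusion.\<close>
  proof (rule sde_pathwise_unique[OF T X X', where L = "LA + LC"])
    show "AE p in prodm. \<forall>k<dimx G.
      (?b (fst p) (snd p) $ k - ?b' (fst p) (snd p) $ k)\<^sup>2
        \<le> (LA + LC) * (\<Sum>l<dimx G. (x_tilde (fst p) (snd p) $ l - x_bar (fst p) (snd p) $ l)\<^sup>2) \<and>
      (?s (fst p) (snd p) $ k - ?s' (fst p) (snd p) $ k)\<^sup>2
        \<le> (LA + LC) * (\<Sum>l<dimx G. (x_tilde (fst p) (snd p) $ l - x_bar (fst p) (snd p) $ l)\<^sup>2)"
      using ae(1) ae(2) AE_space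
    proof eventually_elim
      fix p
      assume u: "u_plus 1 (fst p) (snd p) = uc_star G P x_bar 1 (fst p) (snd p)"
        "u_plus 2 (fst p) (snd p) = uc_star G P x_bar 2 (fst p) (snd p)" and p: "p \<in> space prodm"
      obtain t \<omega> where p_eq: "p = (t, \<omega>)" by (cases p)
      have t: "t \<in> {0..hor G}" and \<omega>: "\<omega> \<in> space M" using space_prodm[OF p] by (auto simp: p_eq)
      have xc: "x_bar t \<omega> \<in> carrier_vec (dimx G)" and zc: "x_tilde t \<omega> \<in> carrier_vec (dimx G)"
        using x2 t \<omega> unfolding L2F_vec_def by blast+
      have yc: "x_tilde t \<omega> - x_bar t \<omega> \<in> carrier_vec (dimx G)" using xc zc by simp
      have u: "u_plus 1 t \<omega> = uc_star G P x_bar 1 t \<omega>" "u_plus 2 t \<omega> = uc_star G P x_bar 2 t \<omega>"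
        using u by (simp_all only: p_eq fst_conv snd_conv)
      let ?S = "\<Sum>l<dimx G. (x_tilde t \<omega> $ l - x_bar t \<omega> $ l)\<^sup>2"
      have S: "(\<Sum>l<dimx G. ((x_tilde t \<omega> - x_bar t \<omega>) $ l)\<^sup>2) = ?S"
        using xc zc by (intro sum.cong) auto
      have S0: "0 \<le> ?S" by (intro sum_nonneg zero_le_power2)
      have le: "LA * ?S \<le> (LA + LC) * ?S" "LC * ?S \<le> (LA + LC) * ?S"
        using LA(1) LC(1) by (intro mult_right_mono S0; simp)+
      have "(?b t \<omega> $ k - ?b' t \<omega> $ k)\<^sup>2 \<le> (LA + LC) * ?S \<and> (?s t \<omega> $ k - ?s' t \<omega> $ k)\<^sup>2 \<le> (LA + LC) * ?S"
        if k: "k < dimx G" for k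
      proof
        \<comment> \<open>Once the controls are replaced by the starred ones, the drift identity
          with \<open>x_tilde\<close> as actual state leaves only \<open>A_bar\<close> acting on the
          difference of the states.\<close>
        have "?b t \<omega> $ k - ?b' t \<omega> $ k = (A_bar G P \<eta> \<zeta> t *\<^sub>v (x_tilde t \<omega> - x_bar t \<omega>)) $ k"
          unfolding u drift_identity[where xb = x_bar and t = t and \<omega> = \<omega>, OF t xc zc k] by (rule add_diff_cancel_left')
        then show "(?b t \<omega> $ k - ?b' t \<omega> $ k)\<^sup>2 \<le> (LA + LC) * ?S"
          using order_trans[OF LA(2)[OF t yc k, unfolded S] le(1)] by (simp only:)
        have "?s t \<omega> $ k - ?s' t \<omega> $ k = (C_bar G P \<eta> \<zeta> t *\<^sub>v (x_tilde t \<omega> - x_bar t \<omega>)) $ k"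
          unfolding u diffusion_identity[where xb = x_bar and t = t and \<omega> = \<omega>, OF t xc zc k] by (rule add_diff_cancel_left')
        then show "(?s t \<omega> $ k - ?s' t \<omega> $ k)\<^sup>2 \<le> (LA + LC) * ?S"
          using order_trans[OF LC(2)[OF t yc k, unfolded S] le(2)] by (simp only:)
      qed
      then show "\<forall>k<dimx G.
        (?b (fst p) (snd p) $ k - ?b' (fst p) (snd p) $ k)\<^sup>2
          \<le> (LA + LC) * (\<Sum>l<dimx G. (x_tilde (fst p) (snd p) $ l - x_bar (fst p) (snd p) $ l)\<^sup>2) \<and>
        (?s (fst p) (snd p) $ k - ?s' (fst p) (snd p) $ k)\<^sup>2
          \<le> (LA + LC) * (\<Sum>l<dimx G. (x_tilde (fst p) (snd p) $ l - x_bar (fst p) (snd p) $ l)\<^sup>2)"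
        unfolding p_eq fst_conv snd_conv by blast
    qed
    show "0 \<le> LA + LC" using LA(1) LC(1) by (rule add_nonneg_nonneg)
  qed (use b b' in \<open>unfold sq_integrable_def, blast+\<close>)
qed

end
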